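(* Let $p \in (1,2)$ and let $A \in \mathbb{R}^{n \times d}$ have full column rank. Let $\Pi = S D \in \mathbb{R}^{s \times n}$, where $S \in \mathbb{R}^{s \times n}$ is a random matrix each of whose columns is chosen independently and uniformly at random from the $s$ standard basis vectors of $\mathbb{R}^s$, and $D \in \mathbb{R}^{n \times n}$ is a diagonal matrix whose diagonal entries are chosen independently from $\mathcal{D}_p$ (independently of $S$). Set $s = \omega d^5 \log^5 d$ with $\omega$ sufficiently large. Then with a constant probability, $$\frac{1}{O((d\log d)^{2/p})}\|Ax\|_p \le \|\Pi A x\|_p \le O((d \log d)^{1/p})\,\|Ax\|_p \quad \text{for all } x \in \mathbb{R}^d,$$ where the hidden constants do not depend on $n$, $d$ or $A$. In addition, $\Pi A$ can be computed in $O(\mathrm{nnz}(A))$ time.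
   Context: $\mathcal{D}_p$ denotes the standard $p$-stable distribution, i.e. the distribution on $\mathbb{R}$ with characteristic function $\psi(t) = e^{-|t|^p}$. $\mathrm{nnz}(A)$ is the number of nonzero entries of $A$; $\|\cdot\|_p$ is the $\ell_p$ norm. *)

theory Defs
  imports "HOL-Probability.Probability" "Jordan_Normal_Form.DL_Rank"
begin

definition std_stable :: "real \<Rightarrow> real measure \<Rightarrow> bool" where
  "std_stable p M \<longleftrightarrow>
     real_distribution M \<and> (\<forall>t. char M t = of_real (exp (- (\<bar>t\<bar> powr p))))"

definition lp_norm :: "real \<Rightarrow> real Matrix.vec \<Rightarrow> real" where
  "lp_norm p v = (\<Sum>i<dim_vec v. \<bar>vec_index v i\<bar> powr p) powr (1 / p)"

definition nonzero_positions :: "real mat \<Rightarrow> (nat \<times> nat) set" where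
  "nonzero_positions A = {(i, j). i < dim_row A \<and> j < dim_col A \<and> A $$ (i, j) \<noteq> 0}"

definition nnz :: "real mat \<Rightarrow> nat" where
  "nnz A = card (nonzero_positions A)"

definition full_column_rank :: "real mat \<Rightarrow> bool" where
  "full_column_rank A \<longleftrightarrow> vec_space.rank (dim_row A) A = dim_col A"


text \<open>The random matrix \<open>S\<close> is encoded by the map \<open>h\<close> that sends a column index \<open>i\<close> to the index
  of the standard basis vector in column \<open>i\<close>; \<open>D\<close> is encoded by its diagonal \<open>g\<close>.\<close>

definition S_mat :: "nat \<Rightarrow> nat \<Rightarrow> (nat \<Rightarrow> nat) \<Rightarrow> real mat" where
  "S_mat s n h = mat_of_cols s (map (\<lambda>i. unit_vec s (h i)) [0..<n])"

definition D_mat :: "nat \<Rightarrow> (nat \<Rightarrow> real) \<Rightarrow> real mat" where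
  "D_mat n g = mat_diag n g"

definition Pi_mat :: "nat \<Rightarrow> nat \<Rightarrow> (nat \<Rightarrow> nat) \<Rightarrow> (nat \<Rightarrow> real) \<Rightarrow> real mat" where
  "Pi_mat s n h g = S_mat s n h * D_mat n g"

definition sketch_space ::
    "real measure \<Rightarrow> nat \<Rightarrow> nat \<Rightarrow> ((nat \<Rightarrow> nat) \<times> (nat \<Rightarrow> real)) measure" where
  "sketch_space \<D> s n =
     (\<Pi>\<^sub>M i\<in>{..<n}. measure_pmf (pmf_of_set {..<s})) \<Otimes>\<^sub>M (\<Pi>\<^sub>M i\<in>{..<n}. \<D>)"

definition sketch_dim :: "real \<Rightarrow> nat \<Rightarrow> nat" where
  "sketch_dim \<omega> d = nat \<lceil>\<omega> * real d ^ 5 * ln (real d) ^ 5\<rceil>"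


text \<open>Running time is measured on a real RAM: a random access machine with a memory of words and
  a memory of real numbers, every instruction taking one time unit. Words have \<open>w\<close> bits, and
  word arithmetic is modulo \<open>2 ^ w\<close>, except that subtraction is cut off at zero. Only words serve as addresses.
  Each memory has its own registers, and the first argument of an instruction names
  the register that it writes, except for \<open>WStore\<close> and \<open>RStore\<close>, where the first argument
  is the word register that holds the address. The machine halts when the program counter leaves the program.\<close>

datatype instr =
    WConst nat nat
  | WAdd nat nat nat
  | WSub nat nat nat
  | WMul nat nat nat
  | WLoad nat nat
  | WStore nat nat
  | RConst nat int
  | RAdd nat nat nat
  | RSub nat nat nat
  | RMul nat nat nat
  | RDiv nat nat nat
  | RLoad nat nat
  | RStore nat nat
  | Jump nat
  | JumpWLess nat nat nat
  | JumpRLess nat nat nat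

record ram_state =
  pc :: nat
  wreg :: "nat \<Rightarrow> nat"
  rreg :: "nat \<Rightarrow> real"
  wmem :: "nat \<Rightarrow> nat"
  rmem :: "nat \<Rightarrow> real"

definition set_wreg :: "nat \<Rightarrow> nat \<Rightarrow> nat \<Rightarrow> ram_state \<Rightarrow> ram_state" where
  "set_wreg w r v \<sigma> = \<sigma>\<lparr>pc := Suc (pc \<sigma>), wreg := (wreg \<sigma>)(r := v mod 2 ^ w)\<rparr>"

definition set_rreg :: "nat \<Rightarrow> real \<Rightarrow> ram_state \<Rightarrow> ram_state" where
  "set_rreg r v \<sigma> = \<sigma>\<lparr>pc := Suc (pc \<sigma>), rreg := (rreg \<sigma>)(r := v)\<rparr>"

fun exec_instr :: "nat \<Rightarrow> instr \<Rightarrow> ram_state \<Rightarrow> ram_state" where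
  "exec_instr w (WConst r c) \<sigma> = set_wreg w r c \<sigma>"
| "exec_instr w (WAdd r a b) \<sigma> = set_wreg w r (wreg \<sigma> a + wreg \<sigma> b) \<sigma>"
| "exec_instr w (WSub r a b) \<sigma> = set_wreg w r (wreg \<sigma> a - wreg \<sigma> b) \<sigma>"
| "exec_instr w (WMul r a b) \<sigma> = set_wreg w r (wreg \<sigma> a * wreg \<sigma> b) \<sigma>"
| "exec_instr w (WLoad r a) \<sigma> = set_wreg w r (wmem \<sigma> (wreg \<sigma> a)) \<sigma>"
| "exec_instr w (WStore a r) \<sigma> =
     \<sigma>\<lparr>pc := Suc (pc \<sigma>), wmem := (wmem \<sigma>)(wreg \<sigma> a := wreg \<sigma> r)\<rparr>"
| "exec_instr w (RConst r c) \<sigma> = set_rreg r (of_int c) \<sigma>"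
| "exec_instr w (RAdd r a b) \<sigma> = set_rreg r (rreg \<sigma> a + rreg \<sigma> b) \<sigma>"
| "exec_instr w (RSub r a b) \<sigma> = set_rreg r (rreg \<sigma> a - rreg \<sigma> b) \<sigma>"
| "exec_instr w (RMul r a b) \<sigma> = set_rreg r (rreg \<sigma> a * rreg \<sigma> b) \<sigma>"
| "exec_instr w (RDiv r a b) \<sigma> = set_rreg r (rreg \<sigma> a / rreg \<sigma> b) \<sigma>"
| "exec_instr w (RLoad r a) \<sigma> = set_rreg r (rmem \<sigma> (wreg \<sigma> a)) \<sigma>"
| "exec_instr w (RStore a r) \<sigma> =
     \<sigma>\<lparr>pc := Suc (pc \<sigma>), rmem := (rmem \<sigma>)(wreg \<sigma> a := rreg \<sigma> r)\<rparr>"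
| "exec_instr w (Jump l) \<sigma> = \<sigma>\<lparr>pc := l\<rparr>"
| "exec_instr w (JumpWLess a b l) \<sigma> =
     \<sigma>\<lparr>pc := if wreg \<sigma> a < wreg \<sigma> b then l else Suc (pc \<sigma>)\<rparr>"
| "exec_instr w (JumpRLess a b l) \<sigma> =
     \<sigma>\<lparr>pc := if rreg \<sigma> a < rreg \<sigma> b then l else Suc (pc \<sigma>)\<rparr>"

definition halted :: "instr list \<Rightarrow> ram_state \<Rightarrow> bool" where
  "halted P \<sigma> \<longleftrightarrow> length P \<le> pc \<sigma>"

definition step :: "nat \<Rightarrow> instr list \<Rightarrow> ram_state \<Rightarrow> ram_state" where
  "step w P \<sigma> = (if halted P \<sigma> then \<sigma> else exec_instr w (P ! pc \<sigma>) \<sigma>)"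

definition run :: "nat \<Rightarrow> instr list \<Rightarrow> nat \<Rightarrow> ram_state \<Rightarrow> ram_state" where
  "run w P t = (step w P ^^ t)"


text \<open>The sparse matrix \<open>A\<close> is given as the list \<open>es\<close> of its nonzero positions, in any order,
  with the corresponding entries; \<open>S\<close> and \<open>D\<close> are given by \<open>h\<close> and \<open>g\<close>, so reading a random
  choice costs one step. With \<open>m = nnz A\<close>, the word memory starts with the \<open>m\<close> row indices, the
  \<open>m\<close> column indices and \<open>h 0, \<dots>, h (n - 1)\<close>, the real memory with the \<open>m\<close> entries and
  \<open>g 0, \<dots>, g (n - 1)\<close>; the registers 0 to 3 hold the sizes. Everything else is initially
  zero. The product is to be left in the real memory, in row-major order, behind the input.\<close>

definition lists_nonzeros :: "(nat \<times> nat) list \<Rightarrow> real mat \<Rightarrow> bool" where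
  "lists_nonzeros es A \<longleftrightarrow> distinct es \<and> set es = nonzero_positions A"

definition input_state ::
    "nat \<Rightarrow> real mat \<Rightarrow> (nat \<times> nat) list \<Rightarrow> (nat \<Rightarrow> nat) \<Rightarrow> (nat \<Rightarrow> real) \<Rightarrow> ram_state" where
  "input_state s A es h g =
    (let n = dim_row A; d = dim_col A; m = length es in
     \<lparr>pc = 0,
      wreg = (\<lambda>_. 0)(0 := n, 1 := d, 2 := s, 3 := m),
      rreg = (\<lambda>_. 0),
      wmem = (\<lambda>a. if a < m then fst (es ! a)
                  else if a < 2 * m then snd (es ! (a - m))
                  else if a < 2 * m + n then h (a - 2 * m)
                  else 0),
      rmem = (\<lambda>a. if a < m then A $$ (es ! a)
                  else if a < m + n then g (a - m)
                  else 0)\<rparr>)"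

definition holds_result :: "nat \<Rightarrow> real mat \<Rightarrow> ram_state \<Rightarrow> bool" where
  "holds_result off B \<sigma> \<longleftrightarrow>
     (\<forall>k<dim_row B. \<forall>j<dim_col B. rmem \<sigma> (off + k * dim_col B + j) = B $$ (k, j))"

text \<open>The bound on \<open>2 ^ w\<close> only says that words can address the input and the output.\<close>

definition computes_sketch_within ::
    "instr list \<Rightarrow> nat \<Rightarrow> nat \<Rightarrow> real mat \<Rightarrow> (nat \<Rightarrow> nat) \<Rightarrow> (nat \<Rightarrow> real) \<Rightarrow> bool" where
  "computes_sketch_within P T s A h g \<longleftrightarrow>
    (\<forall>es w. lists_nonzeros es A \<longrightarrow>
       2 * nnz A + dim_row A + s * dim_col A < 2 ^ w \<longrightarrow>
       (\<exists>t\<le>T. let \<sigma> = run w P t (input_state s A es h g) in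
          halted P \<sigma> \<and>
          holds_result (nnz A + dim_row A) (Pi_mat s (dim_row A) h g * A) \<sigma>))"

end

theory Submission
  imports Defs "HOL-Real_Asymp.Real_Asymp"
begin

text \<open>By Lewis's change of density the column space of \<open>A\<close> has a basis \<open>u\<close> whose rows have
  Euclidean norms \<open>r\<^sub>i\<close> with \<open>\<Sum>i. r\<^sub>i powr p = d\<close> and \<open>\<parallel>z\<parallel>\<^sub>2 \<le> \<parallel>u z\<parallel>\<^sub>p\<close>; call \<open>r\<^sub>i powr p\<close> the weight of row
  \<open>i\<close>. If \<open>\<parallel>u z\<parallel>\<^sub>p = 1\<close>, then coordinate \<open>i\<close> of \<open>u z\<close> contributes at most its weight.

  Upper bound: \<open>\<parallel>\<Pi> u z\<parallel>\<^sub>p powr p\<close> is at most the sum over the buckets of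
  \<open>\<parallel>\<Sum>i. g\<^sub>i u\<^sub>i\<parallel>\<^sub>2 powr p\<close>. Each summand has tail \<open>O (W / t)\<close> for the weight \<open>W\<close> of the bucket, so
  truncation at a power of \<open>s\<close> bounds the sum by \<open>O (d log s)\<close>.

  Lower bound: rows of weight above \<open>1 / (2 K)\<close>, for \<open>K\<close> of order \<open>d log d\<close>, are heavy. No two heavy rows
  collide, and the light rows in heavy buckets are negligible. If half of the mass of \<open>u z\<close> is on
  heavy rows, it survives because the rows with \<open>\<bar>g\<^sub>i\<bar> \<le> c / d\<close> have small total weight, which
  leaves at least a constant times \<open>d powr -p\<close>, and \<open>p < 2\<close>. If half of it is on light rows, almost
  all of these lie in buckets of weight at most \<open>1 / K\<close>, so the Laplace transform gives
  a lower tail \<open>exp (- c K)\<close>, which beats the cardinality of a grid of polynomial mesh.\<close>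

section \<open>Stable distributions\<close>

text \<open>For p-stable g the mean of |g|^p is infinite, so Markov's inequality on p-th powers
  gives nothing. The norm of a bucket is only of weak type, which is where the factor log s of the
  upper bound comes from.

  For the lower bound no single concentration estimate is strong enough. If u z sits on a few rows,
  it shrinks as soon as the scalars there are small, an event of merely polynomial probability, and
  a union over the exp (O (d log d)) grid points would not survive it. Hence the heavy part avoids
  the grid: its events are phrased in terms of weights, which dominate the coordinates of all u z on
  the unit sphere at once. Only the light part, where many independent buckets contribute, is
  treated point by point.

  The order of K is forced by the grid and in turn constrains s. There are O (K d) heavy rows, so
  avoiding collisions asks for s above K^2 d^2, and the light noise in heavy buckets, of order K d^2
  log s / s, must stay below d^-p. Since p < 2, d^-p is at least a constant times (d log d)^-2, and
  the p-th root is the lower factor.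

  The hash is fixed first. Given it, the buckets are disjoint sets of independent variables.\<close>

lemma Re_char:
  assumes "real_distribution M"
  shows "Re (char M t) = (\<integral>x. cos (t * x) \<partial>M)"
proof -
  interpret real_distribution M by fact
  have "integrable M (\<lambda>x. iexp (t * x))"
    using integrable_iexp[of "\<lambda>x. complex_of_real (t * x)"] by simp
  then have "Re (char M t) = (\<integral>x. Re (iexp (t * x)) \<partial>M)"
    unfolding char_def by (rule integral_Re[symmetric])
  also have "\<dots> = (\<integral>x. cos (t * x) \<partial>M)"
    by (intro Bochner_Integration.integral_cong) (auto simp: Re_exp)
  finally show ?thesis .
qed

lemma std_stableD:
  assumes "std_stable p M"
  shows "real_distribution M" "(\<integral>x. cos (t * x) \<partial>M) = exp (- (\<bar>t\<bar> powr p))"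
  using assms Re_char[of M t] by (auto simp: std_stable_def)

lemma one_minus_exp_ge:
  fixes v :: real
  assumes "0 \<le> v" "v \<le> 1"
  shows "v / 2 \<le> 1 - exp (- v)"
proof -
  have "exp (- v) \<le> 1 / (1 + v)"
    using exp_ge_add_one_self[of v] assms by (simp add: exp_minus inverse_eq_divide frac_le)
  also have "\<dots> \<le> 1 - v / 2"
    using assms by (simp add: field_simps power2_eq_square mult_left_le)
  finally show ?thesis by simp
qed

text \<open>By Fubini, a Gaussian average of the characteristic function. It controls the tails, the truncated
  second moment and the mass near zero.\<close>
lemma std_stable_gaussian:
  assumes M: "std_stable p M"
  shows "(\<integral>x. exp (- ((x/a)\<^sup>2) / 2) \<partial>M) = (\<integral>u. exp (- (\<bar>u/a\<bar> powr p)) \<partial>std_normal_distribution)"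
proof -
  interpret M: real_distribution M using std_stableD[OF M] by blast
  let ?N = "std_normal_distribution"
  interpret N: real_distribution ?N by (rule real_dist_normal_dist)
  interpret pair_sigma_finite M ?N ..
  interpret P: pair_prob_space M ?N ..
  have "(\<integral>x. exp (- ((x/a)\<^sup>2) / 2) \<partial>M) = (\<integral>x. (\<integral>u. cos ((x/a) * u) \<partial>?N) \<partial>M)"
    using Re_char[OF real_dist_normal_dist] by (simp add: char_std_normal_distribution)
  also have "\<dots> = (\<integral>u. (\<integral>x. cos ((x/a) * u) \<partial>M) \<partial>?N)"
    by (rule Fubini_integral[symmetric], rule P.integrable_const_bound[of _ 1]) auto
  also have "\<dots> = (\<integral>u. exp (- (\<bar>u/a\<bar> powr p)) \<partial>?N)"
    using std_stableD(2)[OF M, of "u/a" for u] by (simp add: mult.commute)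
  finally show ?thesis .
qed

text \<open>The integrand is comparable with the minimum of 1 and (x/a)^2, so this one estimate
  yields both the tail and the truncated second moment. The Gaussian average turns it into 1 - exp
  (-|u/a|^p), at most |u/a|^p, which has a finite Gaussian mean.\<close>

lemma std_stable_gaussian_defect:
  assumes M: "std_stable p M" and a: "0 < a" and p: "1 < p" "p < 2"
  shows "integrable M (\<lambda>x. 1 - exp (- ((x/a)\<^sup>2) / 2))"
    and "(\<integral>x. 1 - exp (- ((x/a)\<^sup>2) / 2) \<partial>M) \<le> 2 * a powr (-p)"
proof -
  interpret M: real_distribution M using std_stableD[OF M] by blast
  let ?N = "std_normal_distribution"
  interpret N: real_distribution ?N by (rule real_dist_normal_dist)
  have iM: "integrable M (\<lambda>x. exp (- ((x/a)\<^sup>2) / 2))"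
    by (rule M.integrable_const_bound[of _ 1]) auto
  then show "integrable M (\<lambda>x. 1 - exp (- ((x/a)\<^sup>2) / 2))" by auto
  have iN: "integrable ?N (\<lambda>u. exp (- (\<bar>u/a\<bar> powr p)))"
    by (rule N.integrable_const_bound[of _ 1]) auto
  have sq: "integrable ?N (\<lambda>u. u\<^sup>2)" "(\<integral>u. u\<^sup>2 \<partial>?N) = 1"
    using std_normal_distribution_even_moments[of 1] by (auto simp: fact_numeral)
  have "(\<integral>x. 1 - exp (- ((x/a)\<^sup>2) / 2) \<partial>M) = 1 - (\<integral>x. exp (- ((x/a)\<^sup>2) / 2) \<partial>M)"
    using iM M.prob_space by (simp del: M.space_eq_univ)
  also have "\<dots> = 1 - (\<integral>u. exp (- (\<bar>u/a\<bar> powr p)) \<partial>?N)"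
    by (simp only: std_stable_gaussian[OF M])
  also have "\<dots> = (\<integral>u. 1 - exp (- (\<bar>u/a\<bar> powr p)) \<partial>?N)"
    using iN N.prob_space by (simp del: N.space_eq_univ)
  also have "\<dots> \<le> (\<integral>u. a powr (-p) * (1 + u\<^sup>2) \<partial>?N)"
  proof (rule integral_mono)
    show "integrable ?N (\<lambda>u. 1 - exp (- (\<bar>u/a\<bar> powr p)))" using iN by auto
    show "integrable ?N (\<lambda>u. a powr (-p) * (1 + u\<^sup>2))" using sq by auto
    fix u :: real
    \<comment> \<open>This trades the Gaussian p-th moment for the second one, which is 1; the
      constant 2 = 1 + 1 then serves every p.\<close>
    have "\<bar>u\<bar> powr p \<le> 1 + u\<^sup>2"
    proof (cases "\<bar>u\<bar> \<le> 1")
      case True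
      then have "\<bar>u\<bar> powr p \<le> 1" using p powr_mono2[of p "\<bar>u\<bar>" 1] by simp
      then show ?thesis using zero_le_power2[of u] by linarith
    next
      case False
      then have "\<bar>u\<bar> powr p \<le> \<bar>u\<bar> powr 2" using p by (intro powr_mono) auto
      then show ?thesis using False by simp
    qed
    then have "a powr (-p) * \<bar>u\<bar> powr p \<le> a powr (-p) * (1 + u\<^sup>2)" by (intro mult_left_mono) auto
    moreover have "\<bar>u/a\<bar> powr p = a powr (-p) * \<bar>u\<bar> powr p"
      using a by (simp add: abs_divide powr_divide powr_minus_divide)
    ultimately show "1 - exp (- (\<bar>u/a\<bar> powr p)) \<le> a powr (-p) * (1 + u\<^sup>2)"
      using exp_ge_add_one_self[of "- (\<bar>u/a\<bar> powr p)"] by linarith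
  qed
  also have "\<dots> = 2 * a powr (-p)"
    using sq N.prob_space by (simp del: N.space_eq_univ)
  finally show "(\<integral>x. 1 - exp (- ((x/a)\<^sup>2) / 2) \<partial>M) \<le> 2 * a powr (-p)" .
qed

lemma std_stable_truncated_second_moment:
  assumes M: "std_stable p M" and T: "0 < T" and p: "1 < p" "p < 2"
  shows "(\<integral>x. x\<^sup>2 * indicator {x. \<bar>x\<bar> \<le> T} x \<partial>M) \<le> 8 * T powr (2 - p)"
proof -
  interpret real_distribution M using std_stableD[OF M] by blast
  have "(\<integral>x. x\<^sup>2 * indicator {x. \<bar>x\<bar> \<le> T} x \<partial>M) \<le> (\<integral>x. 4 * T\<^sup>2 * (1 - exp (- ((x/T)\<^sup>2) / 2)) \<partial>M)"
  proof (rule integral_mono')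
    show "integrable M (\<lambda>x. 4 * T\<^sup>2 * (1 - exp (- ((x/T)\<^sup>2) / 2)))"
      by (intro integrable_mult_right std_stable_gaussian_defect(1)[OF M T p])
    fix x :: real
    show "x\<^sup>2 * indicator {x. \<bar>x\<bar> \<le> T} x \<le> 4 * T\<^sup>2 * (1 - exp (- ((x/T)\<^sup>2) / 2))"
    proof (cases "\<bar>x\<bar> \<le> T")
      case True
      then have "(x/T)\<^sup>2 \<le> 1" using T by (simp add: abs_square_le_1)
      then have "(x/T)\<^sup>2 / 4 \<le> 1 - exp (- ((x/T)\<^sup>2) / 2)" using one_minus_exp_ge[of "(x/T)\<^sup>2 / 2"] by simp
      then have "4 * T\<^sup>2 * ((x/T)\<^sup>2 / 4) \<le> 4 * T\<^sup>2 * (1 - exp (- ((x/T)\<^sup>2) / 2))"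
        by (intro mult_left_mono) auto
      then show ?thesis using True T by (simp add: power_divide)
    qed auto
  qed auto
  also have "\<dots> = 4 * T\<^sup>2 * (\<integral>x. 1 - exp (- ((x/T)\<^sup>2) / 2) \<partial>M)"
    by (rule integral_mult_right_zero)
  also have "\<dots> \<le> 4 * T\<^sup>2 * (2 * T powr (-p))"
    by (intro mult_left_mono std_stable_gaussian_defect(2)[OF M T p]) auto
  also have "\<dots> = 8 * T powr (2 - p)"
    using T by (simp add: powr_diff powr_minus_divide)
  finally show ?thesis .
qed

lemma std_stable_tail:
  assumes M: "std_stable p M" and T: "0 < T" and p: "1 < p" "p < 2"
  shows "measure M {x. \<bar>x\<bar> > T} \<le> 8 * T powr (-p)"
proof -
  interpret real_distribution M using std_stableD[OF M] by blast
  have "measure M {x. \<bar>x\<bar> > T} = (\<integral>x. indicator {x. \<bar>x\<bar> > T} x \<partial>M)" by simp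
  also have "\<dots> \<le> (\<integral>x. 4 * (1 - exp (- ((x/T)\<^sup>2) / 2)) \<partial>M)"
  proof (rule integral_mono')
    show "integrable M (\<lambda>x. 4 * (1 - exp (- ((x/T)\<^sup>2) / 2)))"
      by (intro integrable_mult_right std_stable_gaussian_defect(1)[OF M T p])
    fix x :: real
    show "indicator {x. \<bar>x\<bar> > T} x \<le> 4 * (1 - exp (- ((x/T)\<^sup>2) / 2))"
    proof (cases "\<bar>x\<bar> > T")
      case True
      then have "1 \<le> (x/T)\<^sup>2" using T by (simp add: power_divide abs_le_square_iff[symmetric])
      then have "exp (- ((x/T)\<^sup>2) / 2) \<le> exp (- (1/2))" by simp
      \<comment> \<open>Beyond \<open>T\<close> the defect is at least 1/4, and 8 = 4 * 2.\<close>
      also have "\<dots> \<le> 3 / 4" using one_minus_exp_ge[of "1/2"] by simp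
      finally show ?thesis using True by simp
    qed auto
  qed auto
  also have "\<dots> = 4 * (\<integral>x. 1 - exp (- ((x/T)\<^sup>2) / 2) \<partial>M)"
    by (rule integral_mult_right_zero)
  also have "\<dots> \<le> 4 * (2 * T powr (-p))"
    by (intro mult_left_mono std_stable_gaussian_defect(2)[OF M T p]) auto
  finally show ?thesis by simp
qed

text \<open>The characteristic function is even and determines the law. Symmetry centres the
  truncated variables, so that independent ones become orthogonal.\<close>

lemma std_stable_symmetric:
  assumes M: "std_stable p M"
  shows "distr M borel uminus = M"
proof (rule Levy_uniqueness)
  show rd: "real_distribution M" using std_stableD[OF M] by blast
  then interpret real_distribution M .
  show "real_distribution (distr M borel uminus)" by (rule real_distribution_distr) simp
  show "char (distr M borel uminus) = char M"
  proof
    fix t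
    have "char (distr M borel uminus) t = (CLINT x|M. iexp (t * (- x)))"
      unfolding char_def by (subst integral_distr) auto
    also have "\<dots> = char M (- t)" unfolding char_def by simp
    also have "\<dots> = char M t" using M by (simp add: std_stable_def)
    finally show "char (distr M borel uminus) t = char M t" .
  qed
qed

lemma std_stable_integral_odd:
  fixes f :: "real \<Rightarrow> real"
  assumes M: "std_stable p M" and f: "f \<in> borel_measurable borel" "\<And>x. f (- x) = - f x"
  shows "(\<integral>x. f x \<partial>M) = 0"
proof -
  interpret real_distribution M using std_stableD[OF M] by blast
  have "(\<integral>x. f x \<partial>M) = (\<integral>x. f x \<partial>(distr M borel uminus))"
    using std_stable_symmetric[OF M] by simp
  also have "\<dots> = (\<integral>x. f (- x) \<partial>M)" using f(1) by (subst integral_distr) auto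
  finally show ?thesis using f(2) by simp
qed

lemma exp_minus_abs_integral:
  fixes a :: real
  assumes "0 < a"
  shows "integrable lborel (\<lambda>u. exp (- \<bar>u\<bar> / a))" "(\<integral>u. exp (- \<bar>u\<bar> / a) \<partial>lborel) = 2 * a"
proof -
  let ?g = "\<lambda>u. exponential_density (1/a) u"
  have g: "has_bochner_integral lborel ?g 1"
  proof -
    interpret prob_space "density lborel ?g"
      using assms by (intro prob_space_exponential_density) auto
    have "(\<integral>\<^sup>+u. ennreal (?g u) \<partial>lborel) = 1"
      using emeasure_space_1 by (simp add: emeasure_density)
    then show ?thesis
      using assms by (intro has_bochner_integral_nn_integral) (auto simp: exponential_density_nonneg)
  qed
  have g': "has_bochner_integral lborel (\<lambda>u. ?g (- u)) 1"
    using g lborel_integrable_real_affine_iff[of "-1" ?g 0] lborel_integral_real_affine[of "-1" ?g 0]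
    by (simp add: has_bochner_integral_iff)
  have s: "has_bochner_integral lborel (\<lambda>u. a * (?g u + ?g (- u))) (a * (1 + 1))"
    by (intro has_bochner_integral_mult_right has_bochner_integral_add g g')
  \<comment> \<open>At 0 both the exponential density and its reflection contribute, so the identity
    fails there and holds only off a null set.\<close>
  have ae: "AE u in lborel. a * (?g u + ?g (- u)) = exp (- \<bar>u\<bar> / a)"
    using AE_lborel_singleton[of "0::real"]
    by eventually_elim (use assms in \<open>auto simp: exponential_density_def\<close>)
  have "has_bochner_integral lborel (\<lambda>u. exp (- \<bar>u\<bar> / a)) (a * (1 + 1))"
    using has_bochner_integral_cong_AE[OF _ _ ae, THEN iffD1, OF _ _ s] by simp
  then show "integrable lborel (\<lambda>u. exp (- \<bar>u\<bar> / a))" "(\<integral>u. exp (- \<bar>u\<bar> / a) \<partial>lborel) = 2 * a"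
    by (auto simp: has_bochner_integral_iff)
qed

text \<open>A substitute for a bound on the density: the Gaussian weight is at least exp (-1/2) on
  the ball, and its mean equals an average of exp (-|u/a|^p), which is concentrated on an interval
  of length of order a.\<close>

lemma std_stable_small_ball:
  assumes M: "std_stable p M" and a: "0 < a" and p: "1 < p"
  shows "measure M {x. \<bar>x\<bar> \<le> a} \<le> 18 * a"
proof -
  interpret M: real_distribution M using std_stableD[OF M] by blast
  let ?N = "std_normal_distribution"
  have "measure M {x. \<bar>x\<bar> \<le> a} * exp (-1/2) = (\<integral>x. exp (-1/2) * indicator {x. \<bar>x\<bar> \<le> a} x \<partial>M)"
    by simp
  also have "\<dots> \<le> (\<integral>x. exp (- ((x/a)\<^sup>2) / 2) \<partial>M)"
  proof (rule integral_mono)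
    show "integrable M (\<lambda>x. exp (- ((x/a)\<^sup>2) / 2))"
      by (rule M.integrable_const_bound[of _ 1]) auto
    fix x show "exp (-1/2) * indicator {x. \<bar>x\<bar> \<le> a} x \<le> exp (- ((x/a)\<^sup>2) / 2)"
      using a by (auto simp: indicator_def power_divide abs_le_square_iff[symmetric])
  qed (intro integrable_mult_right M.integrable_const_bound[of _ 1], auto)
  also have "\<dots> = (\<integral>u. exp (- (\<bar>u/a\<bar> powr p)) \<partial>?N)" by (rule std_stable_gaussian[OF M])
  also have "\<dots> = (\<integral>u. std_normal_density u * exp (- (\<bar>u/a\<bar> powr p)) \<partial>lborel)"
    by (subst integral_density) (auto simp: normal_density_nonneg)
  also have "\<dots> \<le> (\<integral>u. exp 1 * exp (- \<bar>u\<bar> / a) \<partial>lborel)"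
  proof (rule integral_mono')
    show "integrable lborel (\<lambda>u. exp 1 * exp (- \<bar>u\<bar> / a))"
      using exp_minus_abs_integral[OF a] by auto
    fix u :: real
    have "1 / sqrt (2 * pi) \<le> 1"
      using pi_ge_two by (simp add: real_le_rsqrt)
    then have d: "std_normal_density u \<le> 1"
      unfolding std_normal_density_def using mult_mono[of "1 / sqrt (2 * pi)" 1 "exp (- u\<^sup>2 / 2)" 1] by auto
    \<comment> \<open>A linear lower bound for the exponent, valid for all p > 1, leaves a two-sided
      exponential with an explicit integral.\<close>
    have "\<bar>u/a\<bar> - 1 \<le> \<bar>u/a\<bar> powr p"
    proof (cases "\<bar>u/a\<bar> \<le> 1")
      case True
      then show ?thesis using powr_ge_zero[of "\<bar>u/a\<bar>" p] by linarith
    next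
      case False
      then have "\<bar>u/a\<bar> powr 1 \<le> \<bar>u/a\<bar> powr p" using p by (intro powr_mono) auto
      then show ?thesis by simp
    qed
    then have "exp (- (\<bar>u/a\<bar> powr p)) \<le> exp (1 + - \<bar>u\<bar> / a)" using a by simp
    then have "exp (- (\<bar>u/a\<bar> powr p)) \<le> exp 1 * exp (- \<bar>u\<bar> / a)" by (simp add: exp_add[symmetric])
    then show "std_normal_density u * exp (- (\<bar>u/a\<bar> powr p)) \<le> exp 1 * exp (- \<bar>u\<bar> / a)"
      using mult_mono[OF d, of "exp (- (\<bar>u/a\<bar> powr p))" "exp 1 * exp (- \<bar>u\<bar> / a)"] by simp
  qed (auto simp: normal_density_nonneg)
  also have "\<dots> = exp 1 * (2 * a)" using exp_minus_abs_integral[OF a] by simp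
  finally have "measure M {x. \<bar>x\<bar> \<le> a} \<le> exp 1 * (2 * a) * exp (1/2)"
    by (simp add: exp_minus field_simps)
  \<comment> \<open>Both exp 1 and exp (1/2) are bounded by 3, hence 18.\<close>
  also have "\<dots> \<le> 3 * (2 * a) * 3"
    using exp_le a exp_le_cancel_iff[of "1/2" "1::real"] by (intro mult_mono) (auto simp del: exp_le_cancel_iff)
  finally show ?thesis by simp
qed

text \<open>By the small ball estimate, 18/36 = 1/2, so |x| exceeds 1/36 with probability at least
  1/2, and there |x|^p is at least 1/1296. The mass near 0 stops the decay for large u in this
  argument, hence the cap at 1. In 5184 = 4 * 1296 one factor 2 is that probability, the other comes
  from \<open>one_minus_exp_ge\<close>.\<close>

lemma std_stable_laplace:
  assumes M: "std_stable p M" and p: "1 < p" "p < 2" and u: "0 \<le> u"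
  shows "(\<integral>x. exp (- u * \<bar>x\<bar> powr p) \<partial>M) \<le> exp (- min u 1 / 5184)"
proof -
  interpret M: real_distribution M using std_stableD[OF M] by blast
  define b :: real where "b = (1/36) powr p"
  have b: "1/1296 \<le> b" "b \<le> 1"
  proof -
    have "(1/36::real) powr 2 \<le> (1/36) powr p" using p by (intro powr_mono') auto
    then show "1/1296 \<le> b" by (simp add: b_def power_divide)
    have "(1/36::real) powr p \<le> (1/36) powr 0" using p by (intro powr_mono') auto
    then show "b \<le> 1" by (simp add: b_def)
  qed
  define S :: "real set" where "S = {x. \<bar>x\<bar> \<le> 1/36}"
  have S: "S \<in> sets M" "measure M S \<le> 1/2"
    using std_stable_small_ball[OF M _ p(1), of "1/36"] by (auto simp: S_def)
  have iS: "integrable M (indicator S :: real \<Rightarrow> real)"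
    using S by (intro M.integrable_const_bound[of _ 1]) auto
  define m where "m = min u 1 / 1296"
  let ?e = "exp (- u * b)"
  have le1: "?e \<le> 1" using u b by (simp add: mult_nonneg_nonneg)
  have "(\<integral>x. exp (- u * \<bar>x\<bar> powr p) \<partial>M) \<le> (\<integral>x. ?e + (1 - ?e) * indicator S x \<partial>M)"
  proof (rule integral_mono)
    show "integrable M (\<lambda>x. exp (- u * \<bar>x\<bar> powr p))"
      using u by (intro M.integrable_const_bound[of _ 1]) (auto simp: mult_nonneg_nonneg)
    show "integrable M (\<lambda>x. ?e + (1 - ?e) * indicator S x)" using iS by auto
    fix x :: real
    show "exp (- u * \<bar>x\<bar> powr p) \<le> ?e + (1 - ?e) * indicator S x"
    proof (cases "x \<in> S")
      case False
      then have "b \<le> \<bar>x\<bar> powr p" unfolding b_def using p by (intro powr_mono2) (auto simp: S_def)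
      then show ?thesis using False u by (simp add: mult_left_mono)
    qed (use u in \<open>auto simp: mult_nonneg_nonneg\<close>)
  qed
  also have "\<dots> = ?e + (1 - ?e) * measure M S"
    using iS M.prob_space by (simp add: sets.Int_space_eq2[OF S(1)] del: M.space_eq_univ)
  also have "\<dots> \<le> ?e + (1 - ?e) * (1/2)"
    using S le1 by (intro add_left_mono mult_left_mono) auto
  also have "\<dots> = 1 - (1 - ?e) / 2" by (simp add: field_simps)
  also have "\<dots> \<le> 1 - m / 4"
  proof -
    have m: "0 \<le> m" "m \<le> 1" using u by (auto simp: m_def)
    have "m \<le> u * b"
      using mult_mono[of "min u 1" u "1/1296" b] u b by (simp add: m_def)
    then have "?e \<le> exp (- m)" by simp
    also have "\<dots> \<le> 1 - m / 2" using one_minus_exp_ge[OF m] by linarith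
    finally show ?thesis by (simp add: field_simps)
  qed
  also have "\<dots> \<le> exp (- min u 1 / 5184)"
    using exp_ge_add_one_self[of "- min u 1 / 5184"] by (simp add: m_def)
  finally show ?thesis .
qed

section \<open>Combinations of independent stable variables\<close>

lemma std_stable_distrD:
  assumes "X \<in> borel_measurable M" "std_stable p (distr M borel X)" "1 < p" "p < 2" "0 < T"
  shows "measure M {w \<in> space M. \<bar>X w\<bar> > T} \<le> 8 * T powr (-p)"
    and "(\<integral>w. (X w)\<^sup>2 * indicator {x. \<bar>x\<bar> \<le> T} (X w) \<partial>M) \<le> 8 * T powr (2 - p)"
    and "measure M {w \<in> space M. \<bar>X w\<bar> \<le> T} \<le> 18 * T"
proof -
  have [measurable]: "X \<in> borel_measurable M" by fact
  have "measure (distr M borel X) {x. \<bar>x\<bar> > T} = measure M {w \<in> space M. \<bar>X w\<bar> > T}"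
    by (subst measure_distr) (auto intro!: arg_cong[where f="measure M"])
  then show "measure M {w \<in> space M. \<bar>X w\<bar> > T} \<le> 8 * T powr (-p)"
    using std_stable_tail[OF assms(2,5,3,4)] by simp
  have "measure (distr M borel X) {x. \<bar>x\<bar> \<le> T} = measure M {w \<in> space M. \<bar>X w\<bar> \<le> T}"
    by (subst measure_distr) (auto intro!: arg_cong[where f="measure M"])
  then show "measure M {w \<in> space M. \<bar>X w\<bar> \<le> T} \<le> 18 * T"
    using std_stable_small_ball[OF assms(2,5,3)] by simp
  show "(\<integral>w. (X w)\<^sup>2 * indicator {x. \<bar>x\<bar> \<le> T} (X w) \<partial>M) \<le> 8 * T powr (2 - p)"
    using std_stable_truncated_second_moment[OF assms(2,5,3,4)] by (subst (asm) integral_distr) auto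
qed

text \<open>The pattern of every truncation below: \<open>A i\<close> says that a variable exceeds
  its level, and off these events the quantity of interest coincides with its truncation
  \<open>Q\<close>, which has a mean.\<close>

lemma (in prob_space) union_Markov_bound:
  assumes I: "finite I" "\<And>i. i \<in> I \<Longrightarrow> A i \<in> events"
    and Q: "integrable M Q" "\<And>w. 0 \<le> Q w" and t: "0 < t"
    and sub: "\<And>w. w \<in> space M \<Longrightarrow> P w \<Longrightarrow> \<forall>i\<in>I. w \<notin> A i \<Longrightarrow> t \<le> Q w"
  shows "prob {w \<in> space M. P w} \<le> (\<Sum>i\<in>I. prob (A i)) + expectation Q / t"
proof -
  have [measurable]: "Q \<in> borel_measurable M" using Q by simp
  have m1: "(\<Union>i\<in>I. A i) \<in> events" using I by (intro sets.finite_UN) auto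
  have m2: "{w \<in> space M. t \<le> Q w} \<in> events" by measurable
  have "prob {w \<in> space M. P w} \<le> prob ((\<Union>i\<in>I. A i) \<union> {w \<in> space M. t \<le> Q w})"
    using sub by (intro finite_measure_mono sets.Un m1 m2) auto
  also have "\<dots> \<le> prob (\<Union>i\<in>I. A i) + prob {w \<in> space M. t \<le> Q w}"
    by (rule measure_Un_le[OF m1 m2])
  also have "\<dots> \<le> (\<Sum>i\<in>I. prob (A i)) + expectation Q / t"
    using I Q t
    by (intro add_mono finite_measure_subadditive_finite integral_Markov_inequality_measure[where A="{}"] AE_I2) auto
  finally show ?thesis .
qed

text \<open>Doubling the truncation level raises the mean by at most the level times the probability
  of exceeding it, and a weak type bound makes this product at most \<open>a\<close>. The mean
  therefore grows linearly in the number of doublings.\<close>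

lemma (in prob_space) weak_type_truncated_mean:
  assumes Z[measurable]: "Z \<in> borel_measurable M" and nn: "\<And>w. 0 \<le> Z w" and a: "0 < a"
    and tail: "\<And>t. 0 < t \<Longrightarrow> prob {w \<in> space M. t < Z w} \<le> a / t"
  shows "expectation (\<lambda>w. min (Z w) (a * 2 ^ L)) \<le> a * (1 + real L)"
proof (induction L)
  case 0
  have "expectation (\<lambda>w. min (Z w) a) \<le> expectation (\<lambda>w. a)"
    using nn a by (intro integral_mono integrable_const_bound[of _ a]) auto
  then show ?case by (simp add: prob_space)
next
  case (Suc L)
  have int: "integrable M (\<lambda>w. min (Z w) (a * 2 ^ L))" for L
    using nn a by (intro integrable_const_bound[of _ "a * 2^L"]) auto
  let ?S = "{w \<in> space M. a * 2 ^ L < Z w}"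
  have iS: "integrable M (indicator ?S :: 'a \<Rightarrow> real)"
    by (intro integrable_const_bound[of _ 1]) auto
  have "expectation (\<lambda>w. min (Z w) (a * 2 ^ Suc L))
    \<le> expectation (\<lambda>w. min (Z w) (a * 2 ^ L) + a * 2 ^ L * indicator ?S w)"
  proof (intro integral_mono int Bochner_Integration.integrable_add integrable_mult_right iS)
    fix w assume "w \<in> space M"
    then show "min (Z w) (a * 2 ^ Suc L) \<le> min (Z w) (a * 2 ^ L) + a * 2 ^ L * indicator ?S w"
      using a nn[of w] by (auto simp: min_def indicator_def)
  qed
  also have "\<dots> = expectation (\<lambda>w. min (Z w) (a * 2 ^ L)) + a * 2 ^ L * prob ?S"
    using int iS by simp
  also have "\<dots> \<le> a * (1 + real L) + a * 2 ^ L * (a / (a * 2 ^ L))"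
    using tail[of "a * 2 ^ L"] a by (intro add_mono Suc mult_left_mono) auto
  also have "\<dots> = a * (1 + real (Suc L))" using a by (simp add: field_simps)
  finally show ?case .
qed

text \<open>The summands may have infinite mean. Each is cut at a level proportional to its own
  \<open>a k\<close>, so that every cut costs the same probability 2^-L, while the truncated means
  pay only the factor 1 + L.\<close>

lemma (in prob_space) sum_weak_type_tail:
  assumes F: "finite F"
    and Z[measurable]: "\<And>k. k \<in> F \<Longrightarrow> Z k \<in> borel_measurable M"
    and nn: "\<And>k w. k \<in> F \<Longrightarrow> 0 \<le> Z k w" and a: "\<And>k. k \<in> F \<Longrightarrow> 0 < a k"
    and tail: "\<And>k t. k \<in> F \<Longrightarrow> 0 < t \<Longrightarrow> prob {w \<in> space M. t < Z k w} \<le> a k / t"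
    and R: "0 < R"
  shows "prob {w \<in> space M. R < (\<Sum>k\<in>F. Z k w)} \<le> real (card F) / 2 ^ L + (\<Sum>k\<in>F. a k) * (1 + real L) / R"
proof -
  define Y where "Y w = (\<Sum>k\<in>F. min (Z k w) (a k * 2 ^ L))" for w
  have int: "integrable M (\<lambda>w. min (Z k w) (a k * 2 ^ L))" if "k \<in> F" for k
    using that nn[OF that] a[OF that] by (intro integrable_const_bound[of _ "a k * 2^L"]) auto
  then have intY: "integrable M Y" unfolding Y_def by auto
  have "prob {w \<in> space M. R < (\<Sum>k\<in>F. Z k w)}
      \<le> (\<Sum>k\<in>F. prob {w \<in> space M. a k * 2 ^ L < Z k w}) + expectation Y / R"
  proof (rule union_Markov_bound[OF F _ intY _ R])
    fix w assume w: "w \<in> space M" "R < (\<Sum>k\<in>F. Z k w)" "\<forall>k\<in>F. w \<notin> {w \<in> space M. a k * 2 ^ L < Z k w}"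
    then have "Y w = (\<Sum>k\<in>F. Z k w)"
      unfolding Y_def by (intro sum.cong) (auto simp: min_absorb1 not_less)
    then show "R \<le> Y w" using w by simp
  qed (auto simp: Y_def min_def intro!: sum_nonneg mult_nonneg_nonneg nn less_imp_le[OF a])
  also have "\<dots> \<le> (\<Sum>k\<in>F. 1 / 2 ^ L) + (\<Sum>k\<in>F. a k * (1 + real L)) / R"
  proof (intro add_mono sum_mono divide_right_mono)
    fix k assume k: "k \<in> F"
    show "prob {w \<in> space M. a k * 2 ^ L < Z k w} \<le> 1 / 2 ^ L"
      using tail[OF k, of "a k * 2 ^ L"] a[OF k] by simp
  next
    have "expectation Y = (\<Sum>k\<in>F. expectation (\<lambda>w. min (Z k w) (a k * 2 ^ L)))"
      unfolding Y_def by (rule Bochner_Integration.integral_sum[OF int])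
    also have "\<dots> \<le> (\<Sum>k\<in>F. a k * (1 + real L))"
      using nn a tail by (intro sum_mono weak_type_truncated_mean) auto
    finally show "expectation Y \<le> (\<Sum>k\<in>F. a k * (1 + real L))" .
  qed (use R in auto)
  also have "\<dots> = real (card F) / 2 ^ L + (\<Sum>k\<in>F. a k) * (1 + real L) / R"
    by (simp add: sum_distrib_right)
  finally show ?thesis .
qed

section \<open>Finite families of independent stable variables\<close>

locale stable_family = prob_space M for M :: "'a measure" +
  fixes X :: "'i \<Rightarrow> 'a \<Rightarrow> real" and I :: "'i set" and p :: real
  assumes ind: "indep_vars (\<lambda>_. borel) X I"
    and st: "\<And>i. i \<in> I \<Longrightarrow> std_stable p (distr M borel (X i))"
    and I: "finite I" and p: "1 < p" "p < 2"
begin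

lemma X [measurable]: "i \<in> I \<Longrightarrow> X i \<in> borel_measurable M"
  using ind by (auto simp: indep_vars_def)

lemma subfamily: "J \<subseteq> I \<Longrightarrow> stable_family M X J p"
  using I p st by unfold_locales (auto intro: indep_vars_subset[OF ind] finite_subset)

text \<open>Coordinates exceeding the threshold are excluded by a union bound; the remaining sum has
  orthogonal summands, as the truncated variables are centred by symmetry.\<close>
lemma stable_vector_tail:
  fixes u :: "'i \<Rightarrow> 'j \<Rightarrow> real"
  assumes t: "0 < t"
  shows "prob {w \<in> space M. t < (\<Sum>j\<in>J. (\<Sum>i\<in>I. X i w * u i j)\<^sup>2) powr (p/2)}
    \<le> 16 * (\<Sum>i\<in>I. (\<Sum>j\<in>J. (u i j)\<^sup>2) powr (p/2)) / t"
proof (cases "finite J")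
  case False
  then show ?thesis using t by simp
next
  case J: True
  define T where "T = t powr (1/p)"
  have T: "0 < T" "T powr p = t" "T\<^sup>2 = t powr (2/p)"
    using t p by (auto simp: T_def powr_powr powr_power)
  define q where "q i = (\<Sum>j\<in>J. (u i j)\<^sup>2)" for i
  define r where "r i = sqrt (q i)" for i
  have q: "0 \<le> q i" for i by (simp add: q_def sum_nonneg)
  then have r: "0 \<le> r i" "(r i)\<^sup>2 = q i" for i by (auto simp: r_def)
  have rp: "q i powr (p/2) = r i powr p" for i
    using q by (simp add: r_def powr_half_sqrt[symmetric] powr_powr mult.commute)
  have u0: "u i j = 0" if "r i = 0" "j \<in> J" for i j
    using that J by (auto simp: r_def q_def sum_nonneg_eq_0_iff)
  \<comment> \<open>The guard \<open>0 < r i\<close> keeps \<open>Y i\<close> bounded for zero rows;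
    there \<open>u i j = 0\<close>, so nothing is lost.\<close>
  define f where "f i x = (if 0 < r i \<and> \<bar>x\<bar> * r i \<le> T then x else 0)" for i and x :: real
  have f_meas[measurable]: "f i \<in> borel_measurable borel" for i
    unfolding f_def by measurable
  define Y where "Y i w = f i (X i w)" for i w
  have Y[measurable]: "Y i \<in> borel_measurable M" if "i \<in> I" for i
    using that unfolding Y_def by measurable
  have indY: "indep_vars (\<lambda>_. borel) Y I"
    unfolding Y_def by (rule indep_vars_compose2[OF ind]) auto
  define B where "B i = (if 0 < r i then T / r i else 0)" for i
  have YB: "\<bar>Y i w\<bar> \<le> B i" for i w
    using T by (auto simp: Y_def f_def B_def field_simps)
  have intY: "integrable M (Y i)" if "i \<in> I" for i
    using that YB by (intro integrable_const_bound[of _ "B i"]) auto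
  have intYY: "integrable M (\<lambda>w. Y i w * Y i' w)" if "i \<in> I" "i' \<in> I" for i i'
    using that
    by (intro integrable_const_bound[of _ "B i * B i'"])
      (auto simp: abs_mult intro!: mult_mono YB order_trans[OF abs_ge_zero YB])
  have EY: "expectation (Y i) = 0" if "i \<in> I" for i
  proof -
    have "expectation (Y i) = (\<integral>x. f i x \<partial>distr M borel (X i))"
      using that by (subst integral_distr) (auto simp: Y_def[abs_def])
    also have "\<dots> = 0"
      by (rule std_stable_integral_odd[OF st[OF that]]) (auto simp: f_def)
    finally show ?thesis .
  qed
  have orth: "expectation (\<lambda>w. Y i w * Y i' w) = 0" if "i \<in> I" "i' \<in> I" "i \<noteq> i'" for i i'
  proof -
    have "expectation (\<lambda>w. \<Prod>k\<in>{i, i'}. Y k w) = (\<Prod>k\<in>{i, i'}. expectation (Y k))"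
      using that intY by (intro indep_vars_lebesgue_integral indep_vars_subset[OF indY]) auto
    then show ?thesis using that EY by simp
  qed
  \<comment> \<open>Row i is truncated at T / r, where r is its norm. Its contribution r^2 (T /
    r)^(2 - p) equals T^2 r^p / t by T^p = t, so it is governed by the same r^p / t as the
    probability of exceeding the level.\<close>
  have EYY: "q i * expectation (\<lambda>w. (Y i w)\<^sup>2) \<le> 8 * T\<^sup>2 * (q i powr (p/2) / t)" if "i \<in> I" for i
  proof (cases "r i = 0")
    case True
    then show ?thesis using r(2)[of i] T t by simp
  next
    case False
    then have ri: "0 < r i" using r(1)[of i] by simp
    have "expectation (\<lambda>w. (Y i w)\<^sup>2) = (\<integral>w. (X i w)\<^sup>2 * indicator {x. \<bar>x\<bar> \<le> T / r i} (X i w) \<partial>M)"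
      using ri by (intro Bochner_Integration.integral_cong) (auto simp: Y_def f_def indicator_def field_simps)
    also have "\<dots> \<le> 8 * (T / r i) powr (2 - p)"
      using std_stable_distrD(2)[OF X[OF that] st[OF that] p] ri T by simp
    finally have "q i * expectation (\<lambda>w. (Y i w)\<^sup>2) \<le> q i * (8 * (T / r i) powr (2 - p))"
      using q by (intro mult_left_mono)
    also have "\<dots> = 8 * T\<^sup>2 * (q i powr (p/2) / t)"
      unfolding rp using ri T
      by (simp add: r(2)[of i, symmetric] powr_diff powr_divide field_simps)
    finally show ?thesis .
  qed
  define Q where "Q w = (\<Sum>j\<in>J. (\<Sum>i\<in>I. Y i w * u i j)\<^sup>2)" for w
  have Q_eq: "Q w = (\<Sum>j\<in>J. \<Sum>i\<in>I. \<Sum>i'\<in>I. (u i j * u i' j) * (Y i w * Y i' w))" for w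
    unfolding Q_def power2_eq_square sum_product by (intro sum.cong refl) (simp add: mult_ac)
  have intQ: "integrable M Q"
    unfolding Q_eq by (intro Bochner_Integration.integrable_sum integrable_mult_right intYY)
  have "expectation Q = (\<Sum>j\<in>J. \<Sum>i\<in>I. \<Sum>i'\<in>I. (u i j * u i' j) * expectation (\<lambda>w. Y i w * Y i' w))"
    unfolding Q_eq by (simp add: Bochner_Integration.integral_sum intYY)
  also have "\<dots> = (\<Sum>j\<in>J. \<Sum>i\<in>I. \<Sum>i'\<in>I. if i' = i then (u i j)\<^sup>2 * expectation (\<lambda>w. (Y i w)\<^sup>2) else 0)"
    by (intro sum.cong refl) (auto simp: orth power2_eq_square)
  also have "\<dots> = (\<Sum>i\<in>I. q i * expectation (\<lambda>w. (Y i w)\<^sup>2))"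
    using I by (simp add: q_def sum_distrib_right sum.swap[of _ I])
  also have "\<dots> \<le> (\<Sum>i\<in>I. 8 * T\<^sup>2 * (q i powr (p/2) / t))"
    by (intro sum_mono EYY)
  finally have EQ: "expectation Q \<le> T\<^sup>2 * (8 * (\<Sum>i\<in>I. q i powr (p/2)) / t)"
    by (simp add: sum_distrib_left sum_divide_distrib mult_ac)
  have PX: "prob {w \<in> space M. T < \<bar>X i w\<bar> * r i} \<le> 8 * (q i powr (p/2) / t)" if "i \<in> I" for i
  proof (cases "r i = 0")
    case True
    then show ?thesis using T t by simp
  next
    case False
    then have ri: "0 < r i" using r(1)[of i] by simp
    then have "{w \<in> space M. T < \<bar>X i w\<bar> * r i} = {w \<in> space M. T / r i < \<bar>X i w\<bar>}"
      by (auto simp: field_simps)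
    then have "prob {w \<in> space M. T < \<bar>X i w\<bar> * r i} \<le> 8 * (T / r i) powr (-p)"
      using std_stable_distrD(1)[OF X[OF that] st[OF that] p, of "T / r i"] ri T by simp
    also have "\<dots> = 8 * (q i powr (p/2) / t)"
      unfolding rp using ri T by (simp add: powr_minus powr_divide inverse_eq_divide)
    finally show ?thesis .
  qed
  have "prob {w \<in> space M. t < (\<Sum>j\<in>J. (\<Sum>i\<in>I. X i w * u i j)\<^sup>2) powr (p/2)}
    \<le> (\<Sum>i\<in>I. prob {w \<in> space M. T < \<bar>X i w\<bar> * r i}) + expectation Q / T\<^sup>2"
  proof (rule union_Markov_bound[OF I _ intQ])
    fix w assume w: "w \<in> space M" "t < (\<Sum>j\<in>J. (\<Sum>i\<in>I. X i w * u i j)\<^sup>2) powr (p/2)"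
      "\<forall>i\<in>I. w \<notin> {w \<in> space M. T < \<bar>X i w\<bar> * r i}"
    then have le: "\<bar>X i w\<bar> * r i \<le> T" if "i \<in> I" for i using that by force
    have "X i w * u i j = Y i w * u i j" if "i \<in> I" "j \<in> J" for i j
      using le[OF that(1)] u0[OF _ that(2), of i] r(1)[of i] by (auto simp: Y_def f_def)
    then have "(\<Sum>j\<in>J. (\<Sum>i\<in>I. X i w * u i j)\<^sup>2) = Q w"
      unfolding Q_def by (intro sum.cong refl arg_cong[where f="\<lambda>x. x\<^sup>2"]) auto
    then have "(T\<^sup>2) powr (p/2) < Q w powr (p/2)" using w T p t by (simp add: powr_powr)
    then show "T\<^sup>2 \<le> Q w"
      using p powr_mono2[of "p/2" "Q w" "T\<^sup>2"] by (force simp: Q_def sum_nonneg)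
  qed (use T in \<open>auto simp: Q_def sum_nonneg\<close>)
  also have "\<dots> \<le> (\<Sum>i\<in>I. 8 * (q i powr (p/2) / t)) + 8 * (\<Sum>i\<in>I. q i powr (p/2)) / t"
    using EQ T by (intro add_mono sum_mono PX) (auto simp: divide_le_eq mult.commute)
  \<comment> \<open>One 8 stems from the large coordinates, the other from the truncated second
    moment.\<close>
  also have "\<dots> = 16 * (\<Sum>i\<in>I. q i powr (p/2)) / t"
    by (simp add: sum_distrib_left[symmetric] sum_divide_distrib[symmetric])
  finally show ?thesis unfolding q_def .
qed

text \<open>Stability in the classical sense: characteristic functions of independent summands
  multiply, and the exponents |t|^p |c i|^p add up to |t|^p.\<close>

lemma std_stable_linear_combination:
  assumes c: "(\<Sum>i\<in>I. \<bar>c i\<bar> powr p) = 1"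
  shows "std_stable p (distr M borel (\<lambda>w. \<Sum>i\<in>I. X i w * c i))"
  unfolding std_stable_def
proof (intro conjI allI)
  show "real_distribution (distr M borel (\<lambda>w. \<Sum>i\<in>I. X i w * c i))"
    by (rule real_distribution_distr) measurable
  fix t
  have indc: "indep_vars (\<lambda>_. borel) (\<lambda>i w. X i w * c i) I"
    by (rule indep_vars_compose2[OF ind]) auto
  have ch: "char (distr M borel (\<lambda>w. X i w * c i)) t = of_real (exp (- (\<bar>t\<bar> powr p * \<bar>c i\<bar> powr p)))"
    if "i \<in> I" for i
  proof -
    have "char (distr M borel (\<lambda>w. X i w * c i)) t = char (distr M borel (X i)) (t * c i)"
      unfolding char_def using that by (simp add: integral_distr mult_ac)
    also have "\<dots> = of_real (exp (- (\<bar>t\<bar> powr p * \<bar>c i\<bar> powr p)))"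
      using st[OF that] by (simp add: std_stable_def abs_mult powr_mult)
    finally show ?thesis .
  qed
  have "char (distr M borel (\<lambda>w. \<Sum>i\<in>I. X i w * c i)) t = (\<Prod>i\<in>I. char (distr M borel (\<lambda>w. X i w * c i)) t)"
    by (rule char_distr_sum[OF indc])
  also have "\<dots> = of_real (exp (\<Sum>i\<in>I. - (\<bar>t\<bar> powr p * \<bar>c i\<bar> powr p)))"
    using I by (simp add: ch exp_sum)
  also have "(\<Sum>i\<in>I. - (\<bar>t\<bar> powr p * \<bar>c i\<bar> powr p)) = - (\<bar>t\<bar> powr p)"
    using c by (simp add: sum_negf sum_distrib_left[symmetric])
  finally show "char (distr M borel (\<lambda>w. \<Sum>i\<in>I. X i w * c i)) t = complex_of_real (exp (- (\<bar>t\<bar> powr p)))" .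
qed

lemma stable_sum_laplace:
  assumes u: "0 \<le> u"
  shows "expectation (\<lambda>w. exp (- u * \<bar>\<Sum>i\<in>I. X i w * c i\<bar> powr p))
    \<le> exp (- min (u * (\<Sum>i\<in>I. \<bar>c i\<bar> powr p)) 1 / 5184)"
proof -
  define \<gamma> where "\<gamma> = (\<Sum>i\<in>I. \<bar>c i\<bar> powr p)"
  have "0 \<le> \<gamma>" by (simp add: \<gamma>_def sum_nonneg)
  show ?thesis
  proof (cases "\<gamma> = 0")
    case True
    then have "c i = 0" if "i \<in> I" for i
      using I that by (auto simp: \<gamma>_def sum_nonneg_eq_0_iff)
    then show ?thesis using True u by (simp add: \<gamma>_def[symmetric] prob_space)
  next
    case False
    then have g: "0 < \<gamma>" using \<open>0 \<le> \<gamma>\<close> by simp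
    define \<sigma> where "\<sigma> = \<gamma> powr (1/p)"
    have s: "0 < \<sigma>" "\<sigma> powr p = \<gamma>" using g p by (auto simp: \<sigma>_def powr_powr)
    have sc: "(\<Sum>i\<in>I. \<bar>c i / \<sigma>\<bar> powr p) = 1"
      using s g by (simp add: abs_divide powr_divide sum_divide_distrib[symmetric] \<gamma>_def[symmetric])
    let ?Y = "\<lambda>w. \<Sum>i\<in>I. X i w * (c i / \<sigma>)"
    have Y: "std_stable p (distr M borel ?Y)"
      by (rule std_stable_linear_combination[OF sc])
    have "(\<Sum>i\<in>I. X i w * c i) = \<sigma> * ?Y w" for w
      using s by (simp add: sum_distrib_left)
    then have "\<bar>\<Sum>i\<in>I. X i w * c i\<bar> powr p = \<gamma> * \<bar>?Y w\<bar> powr p" for w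
      using s by (simp add: abs_mult powr_mult)
    then have "expectation (\<lambda>w. exp (- u * \<bar>\<Sum>i\<in>I. X i w * c i\<bar> powr p))
      = expectation (\<lambda>w. exp (- (u * \<gamma>) * \<bar>?Y w\<bar> powr p))" by (simp add: mult_ac)
    also have "\<dots> = (\<integral>x. exp (- (u * \<gamma>) * \<bar>x\<bar> powr p) \<partial>distr M borel ?Y)"
      by (subst integral_distr) auto
    also have "\<dots> \<le> exp (- min (u * \<gamma>) 1 / 5184)"
      using u g by (intro std_stable_laplace[OF Y p]) auto
    finally show ?thesis by (simp add: \<gamma>_def)
  qed
qed

text \<open>Chernoff's method for the lower tail: Markov's inequality for exp (-u Y), whose mean
  factorises because disjoint blocks use disjoint coordinates. The free parameter \<open>u\<close>
  is later set to \<open>K\<close>.\<close>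

lemma stable_block_lower_tail:
  fixes B :: "'k \<Rightarrow> 'i set"
  assumes u: "0 \<le> u"
    and F: "finite F" and B: "\<And>k. k \<in> F \<Longrightarrow> B k \<subseteq> I" "disjoint_family_on B F"
  shows "prob {w \<in> space M. (\<Sum>k\<in>F. \<bar>\<Sum>i\<in>B k. X i w * c i\<bar> powr p) \<le> \<theta>}
    \<le> exp (u * \<theta> - (\<Sum>k\<in>F. min (u * (\<Sum>i\<in>B k. \<bar>c i\<bar> powr p)) 1) / 5184)"
proof -
  define E where "E k w = exp (- u * \<bar>\<Sum>i\<in>B k. X i w * c i\<bar> powr p)" for k w
  have Em[measurable]: "E k \<in> borel_measurable M" if "k \<in> F" for k
  proof -
    have "X i \<in> borel_measurable M" if "i \<in> B k" for i using B(1)[OF \<open>k \<in> F\<close>] that X by auto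
    then show ?thesis unfolding E_def by measurable
  qed
  have "indep_vars (\<lambda>_. borel)
      (\<lambda>k w. (\<lambda>v. exp (- u * \<bar>\<Sum>i\<in>B k. v i * c i\<bar> powr p)) (restrict (\<lambda>i. X i w) (B k))) F"
    by (rule indep_vars_compose2[OF indep_vars_restrict[OF ind B]]) measurable
  then have indE: "indep_vars (\<lambda>_. borel) E F"
    by (simp add: E_def[abs_def])
  have E1: "0 < E k w" "E k w \<le> 1" for k w using u by (auto simp: E_def)
  have intE: "integrable M (E k)" if "k \<in> F" for k
    using that E1 by (intro integrable_const_bound[of _ 1]) (auto simp: abs_of_pos)
  have EE: "expectation (E k) \<le> exp (- min (u * (\<Sum>i\<in>B k. \<bar>c i\<bar> powr p)) 1 / 5184)" if "k \<in> F" for k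
    unfolding E_def by (rule stable_family.stable_sum_laplace[OF subfamily[OF B(1)[OF that]] u])
  have "expectation (\<lambda>w. \<Prod>k\<in>F. E k w) = (\<Prod>k\<in>F. expectation (E k))"
    by (rule indep_vars_lebesgue_integral[OF F indE intE])
  also have "\<dots> \<le> (\<Prod>k\<in>F. exp (- min (u * (\<Sum>i\<in>B k. \<bar>c i\<bar> powr p)) 1 / 5184))"
    by (intro prod_mono conjI EE integral_nonneg_AE AE_I2 less_imp_le[OF E1(1)])
  also have "\<dots> = exp (- ((\<Sum>k\<in>F. min (u * (\<Sum>i\<in>B k. \<bar>c i\<bar> powr p)) 1) / 5184))"
    using F by (simp add: exp_sum[symmetric] sum_negf sum_divide_distrib)
  finally have EP: "expectation (\<lambda>w. \<Prod>k\<in>F. E k w) \<le> exp (- ((\<Sum>k\<in>F. min (u * (\<Sum>i\<in>B k. \<bar>c i\<bar> powr p)) 1) / 5184))" .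
  have intP: "integrable M (\<lambda>w. \<Prod>k\<in>F. E k w)"
    by (rule indep_vars_integrable[OF F indE intE])
  have prodE: "(\<Prod>k\<in>F. E k w) = exp (- u * (\<Sum>k\<in>F. \<bar>\<Sum>i\<in>B k. X i w * c i\<bar> powr p))" for w
    using F by (simp add: E_def exp_sum[symmetric] sum_distrib_left sum_negf)
  have "prob {w \<in> space M. (\<Sum>k\<in>F. \<bar>\<Sum>i\<in>B k. X i w * c i\<bar> powr p) \<le> \<theta>}
      \<le> prob {w \<in> space M. exp (- u * \<theta>) \<le> (\<Prod>k\<in>F. E k w)}"
  proof (rule finite_measure_mono)
    show "{w \<in> space M. exp (- u * \<theta>) \<le> (\<Prod>k\<in>F. E k w)} \<in> events"
      using borel_measurable_integrable[OF intP] by measurable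
  qed (use u in \<open>auto simp: prodE intro!: mult_left_mono\<close>)
  also have "\<dots> \<le> expectation (\<lambda>w. \<Prod>k\<in>F. E k w) / exp (- u * \<theta>)"
    by (intro integral_Markov_inequality_measure[where A="{}"] intP AE_I2 prod_nonneg less_imp_le[OF E1(1)]) auto
  also have "\<dots> \<le> exp (- ((\<Sum>k\<in>F. min (u * (\<Sum>i\<in>B k. \<bar>c i\<bar> powr p)) 1) / 5184)) / exp (- u * \<theta>)"
    using EP by (intro divide_right_mono) auto
  also have "\<dots> = exp (u * \<theta> - (\<Sum>k\<in>F. min (u * (\<Sum>i\<in>B k. \<bar>c i\<bar> powr p)) 1) / 5184)"
    by (simp add: exp_diff[symmetric] del: exp_diff)
  finally show ?thesis .
qed

end

section \<open>Random hashing\<close>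

text \<open>The threshold is half of the load 1 / K allowed in a bucket: if the bucket of a light
  row is overloaded, the other light rows in it carry at least 1 / (2 K).\<close>

definition heavy_rows :: "nat \<Rightarrow> (nat \<Rightarrow> real) \<Rightarrow> real \<Rightarrow> nat set" where
  "heavy_rows n w K = {i. i < n \<and> 1 / (2 * K) < w i}"

definition light_rows :: "nat \<Rightarrow> (nat \<Rightarrow> real) \<Rightarrow> real \<Rightarrow> nat set" where
  "light_rows n w K = {i. i < n \<and> w i \<le> 1 / (2 * K)}"

definition light_load :: "nat \<Rightarrow> (nat \<Rightarrow> real) \<Rightarrow> real \<Rightarrow> (nat \<Rightarrow> nat) \<Rightarrow> nat \<Rightarrow> real" where
  "light_load n w K h i = (\<Sum>j\<in>light_rows n w K. if h j = h i then w j else 0)"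

text \<open>The second clause bounds the mass lost in overloaded buckets; its 1/8 is below the 3/16
  required in \<open>light_grid\<close>, and 1/16 is left. The third clause controls the light noise
  that is added to isolated heavy coordinates.\<close>

definition good_hash :: "nat \<Rightarrow> (nat \<Rightarrow> real) \<Rightarrow> real \<Rightarrow> real \<Rightarrow> (nat \<Rightarrow> nat) \<Rightarrow> bool" where
  "good_hash n w K \<xi> h \<longleftrightarrow>
    (\<forall>i\<in>heavy_rows n w K. \<forall>j\<in>heavy_rows n w K. i \<noteq> j \<longrightarrow> h i \<noteq> h j) \<and>
    (\<Sum>i\<in>light_rows n w K. if 1 / K < light_load n w K h i then w i else 0) \<le> 1 / 8 \<and>
    (\<Sum>i\<in>light_rows n w K. if \<exists>j\<in>heavy_rows n w K. h i = h j then w i else 0) \<le> \<xi>"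

lemma finite_rows [simp]: "finite (heavy_rows n w K)" "finite (light_rows n w K)"
  by (auto simp: heavy_rows_def light_rows_def)

lemma rows_partition:
  "heavy_rows n w K \<union> light_rows n w K = {..<n}" "heavy_rows n w K \<inter> light_rows n w K = {}"
  by (auto simp: heavy_rows_def light_rows_def)

lemma card_heavy_rows:
  assumes "\<And>i. 0 \<le> w i" "0 < K" "(\<Sum>i<n. w i) = D"
  shows "real (card (heavy_rows n w K)) \<le> 2 * K * D"
proof -
  have "real (card (heavy_rows n w K)) * (1 / (2 * K)) = (\<Sum>i\<in>heavy_rows n w K. 1 / (2 * K))" by simp
  also have "\<dots> \<le> (\<Sum>i\<in>heavy_rows n w K. w i)"
    by (intro sum_mono) (auto simp: heavy_rows_def)
  also have "\<dots> \<le> (\<Sum>i<n. w i)"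
    using assms(1) by (intro sum_mono2) (auto simp: heavy_rows_def)
  finally show ?thesis using assms(2,3) by (simp add: field_simps)
qed

text \<open>Meant for total weights lost to individually improbable events: linearity of expectation
  uses only the separate probabilities of the \<open>E i\<close>, whatever their dependence.\<close>

lemma (in prob_space) Markov_finite_sum:
  assumes "finite I" and m: "\<And>i. i \<in> I \<Longrightarrow> E i \<in> events" and c: "\<And>i. i \<in> I \<Longrightarrow> 0 \<le> c i"
    and f[measurable]: "f \<in> borel_measurable M"
    and le: "\<And>v. v \<in> space M \<Longrightarrow> f v \<le> (\<Sum>i\<in>I. c i * indicator (E i) v)"
    and t: "0 < t" and b: "(\<Sum>i\<in>I. c i * prob (E i)) \<le> t * b"
  shows "prob {v \<in> space M. t < f v} \<le> b"
proof -
  let ?g = "\<lambda>v. \<Sum>i\<in>I. c i * indicator (E i) v"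
  have int: "integrable M (\<lambda>v. c i * indicator (E i) v)" if "i \<in> I" for i
    using m[OF that] by (intro integrable_mult_right integrable_const_bound[of _ 1]) auto
  have intg: "integrable M ?g" by (intro Bochner_Integration.integrable_sum int)
  have [measurable]: "?g \<in> borel_measurable M" using intg by simp
  have "prob {v \<in> space M. t < f v} \<le> prob {v \<in> space M. t \<le> ?g v}"
    by (rule finite_measure_mono) (use le in \<open>force\<close>, measurable)
  also have "\<dots> \<le> expectation ?g / t"
    using c t by (intro integral_Markov_inequality_measure[where A="{}"] intg AE_I2 sum_nonneg) auto
  also have "expectation ?g = (\<Sum>i\<in>I. c i * prob (E i))"
    using m int by (subst Bochner_Integration.integral_sum) (auto intro!: sum.cong simp: sets.Int_space_eq2)
  also have "(\<Sum>i\<in>I. c i * prob (E i)) / t \<le> b" using b t by (simp add: divide_le_eq mult.commute)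
  finally show ?thesis .
qed

text \<open>Only pairwise collisions enter, and each clause fails with probability at most 1/16. For
  the first, (2 K D)^2 / s must be at most 1/16, hence 64; for the second, 2 K D^2 / s at most 1/8 *
  1/16, hence 256; for the third, 32 is 2 times the 16 of Markov's inequality.\<close>

lemma (in prob_space) good_hash_prob:
  fixes H :: "'a \<Rightarrow> nat \<Rightarrow> nat"
  assumes H[measurable]: "\<And>i. i < n \<Longrightarrow> (\<lambda>v. H v i) \<in> measurable M (count_space UNIV)"
    and coll: "\<And>i j. i < n \<Longrightarrow> j < n \<Longrightarrow> i \<noteq> j \<Longrightarrow> prob {v \<in> space M. H v i = H v j} \<le> 1 / s"
    and w: "\<And>i. 0 \<le> w i" "(\<Sum>i<n. w i) = D" and D: "0 < D" and k: "0 < K" and s: "0 < s"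
    and s1: "64 * K\<^sup>2 * D\<^sup>2 \<le> s" and s2: "256 * K * D\<^sup>2 \<le> s"
  shows "{v \<in> space M. good_hash n w K (32 * K * D\<^sup>2 / s) (H v)} \<in> events"
    and "13 / 16 \<le> prob {v \<in> space M. good_hash n w K (32 * K * D\<^sup>2 / s) (H v)}"
proof -
  let ?Hv = "heavy_rows n w K" and ?Lt = "light_rows n w K"
  have Hvn: "i < n" if "i \<in> ?Hv" for i using that by (simp add: heavy_rows_def)
  have Ltn: "i < n" if "i \<in> ?Lt" for i using that by (simp add: light_rows_def)
  define E where "E = (\<lambda>(i, j). {v \<in> space M. H v i = H v j})"
  have Hr[measurable]: "(\<lambda>v. real (H v i)) \<in> borel_measurable M" if "i < n" for i
    using H[OF that] by measurable
  have Eset: "{v \<in> space M. H v i = H v j} \<in> events" if "i < n" "j < n" for i j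
  proof -
    have "{v \<in> space M. real (H v i) = real (H v j)} \<in> events" using that by measurable
    then show ?thesis by simp
  qed
  have Em: "E (i, j) \<in> events" if "i < n" "j < n" for i j
    using Eset[OF that] by (simp add: E_def)
  have Ep: "prob (E (i, j)) \<le> 1 / s" if "i < n" "j < n" "i \<noteq> j" for i j
    using coll[OF that] by (simp add: E_def)
  have sumLt: "(\<Sum>i\<in>?Lt. w i) \<le> D"
    unfolding w(2)[symmetric] using w(1) by (intro sum_mono2) (auto simp: light_rows_def)
  have cardHv: "real (card ?Hv) \<le> 2 * K * D" by (rule card_heavy_rows[OF w(1) k w(2)])

  have load_m[measurable]: "(\<lambda>v. light_load n w K (H v) i) \<in> borel_measurable M" if "i < n" for i
    unfolding light_load_def using Eset[OF Ltn that]
    by (intro borel_measurable_sum measurable_If) auto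
  define f2 where "f2 v = (\<Sum>i\<in>?Lt. if 1 / K < light_load n w K (H v) i then w i else 0)" for v
  define f3 where "f3 v = (\<Sum>i\<in>?Lt. if \<exists>j\<in>?Hv. H v i = H v j then w i else 0)" for v
  have f2m[measurable]: "f2 \<in> borel_measurable M"
    unfolding f2_def using Ltn by (intro borel_measurable_sum measurable_If) auto
  have f3m[measurable]: "f3 \<in> borel_measurable M"
  proof -
    have "{v \<in> space M. \<exists>j\<in>?Hv. H v i = H v j} = (\<Union>j\<in>?Hv. {v \<in> space M. H v i = H v j})" for i by auto
    moreover have "(\<Union>j\<in>?Hv. {v \<in> space M. H v i = H v j}) \<in> events" if "i \<in> ?Lt" for i
      using Eset[OF Ltn[OF that] Hvn] by (intro sets.finite_UN) auto
    ultimately show ?thesis unfolding f3_def by (intro borel_measurable_sum measurable_If) auto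
  qed

  let ?P = "{x \<in> ?Hv \<times> ?Hv. fst x \<noteq> snd x}"
  define B1 where "B1 = (\<Union>x\<in>?P. E x)"
  have B1m: "B1 \<in> events" unfolding B1_def using Em Hvn by (intro sets.finite_UN) auto
  have P1: "prob B1 \<le> 1 / 16"
  proof -
    have "prob B1 \<le> (\<Sum>x\<in>?P. prob (E x))"
      unfolding B1_def using Em Hvn by (intro finite_measure_subadditive_finite) auto
    also have "\<dots> \<le> (\<Sum>x\<in>?P. 1 / s)" using Ep Hvn by (intro sum_mono) auto
    also have "\<dots> = real (card ?P) * (1 / s)" by simp
    also have "\<dots> \<le> (real (card ?Hv))\<^sup>2 * (1 / s)"
    proof (intro mult_right_mono)
      have "card ?P \<le> card (?Hv \<times> ?Hv)" by (intro card_mono) auto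
      then have "real (card ?P) \<le> real (card (?Hv \<times> ?Hv))" by (rule of_nat_mono)
      then show "real (card ?P) \<le> (real (card ?Hv))\<^sup>2" by (simp add: card_cartesian_product power2_eq_square)
    qed (use s in auto)
    also have "\<dots> \<le> (2 * K * D)\<^sup>2 * (1 / s)"
      using cardHv s by (intro mult_right_mono power_mono) auto
    also have "\<dots> \<le> 1 / 16" using s s1 by (simp add: power_mult_distrib field_simps)
    finally show ?thesis .
  qed
  have P2: "prob {v \<in> space M. 1/8 < f2 v} \<le> 1 / 16"
  proof (rule Markov_finite_sum)
    let ?I = "{x \<in> ?Lt \<times> ?Lt. fst x \<noteq> snd x}"
    \<comment> \<open>An overloaded bucket of i contains other light rows of total weight at least 1
      / (2 K). So the indicator of overload is at most 2 K times the weight colliding with i, which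
      is linear in the pair events.\<close>
    let ?c = "\<lambda>x. w (fst x) * (2 * K * w (snd x))"
    show "finite ?I" by (rule finite_subset[of _ "?Lt \<times> ?Lt"]) auto
    show "E x \<in> events" if "x \<in> ?I" for x using that Ltn Em by (cases x) auto
    show "0 \<le> ?c x" for x using w k by simp
    have reidx: "(\<Sum>x\<in>?I. g x) = (\<Sum>i\<in>?Lt. \<Sum>j\<in>?Lt - {i}. g (i, j))" for g :: "nat \<times> nat \<Rightarrow> real"
    proof -
      have "?I = Sigma ?Lt (\<lambda>i. ?Lt - {i})" by auto
      then show ?thesis by (simp add: sum.Sigma)
    qed
    fix v assume om: "v \<in> space M"
    show "f2 v \<le> (\<Sum>x\<in>?I. ?c x * indicator (E x) v)"
      unfolding f2_def reidx
    proof (intro sum_mono)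
      fix i assume i: "i \<in> ?Lt"
      let ?S = "\<Sum>j\<in>?Lt - {i}. if H v j = H v i then w j else 0"
      have eq: "(\<Sum>j\<in>?Lt - {i}. ?c (i, j) * indicator (E (i, j)) v) = w i * (2 * K * ?S)"
        unfolding sum_distrib_left by (intro sum.cong refl) (use om in \<open>auto simp: E_def indicator_def\<close>)
      have S0: "0 \<le> ?S" using w by (intro sum_nonneg) auto
      have "light_load n w K (H v) i = w i + ?S"
        using i by (simp add: light_load_def sum.remove[of ?Lt i])
      then have "1 \<le> 2 * K * ?S" if "1 / K < light_load n w K (H v) i"
        using that i k by (simp add: light_rows_def field_simps)
      then show "(if 1 / K < light_load n w K (H v) i then w i else 0)
          \<le> (\<Sum>j\<in>?Lt - {i}. ?c (i, j) * indicator (E (i, j)) v)"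
        unfolding eq using w(1)[of i] S0 k mult_left_mono[of 1 "2 * K * ?S" "w i"] by auto
    qed
  next
    let ?I = "{x \<in> ?Lt \<times> ?Lt. fst x \<noteq> snd x}"
    let ?c = "\<lambda>x. w (fst x) * (2 * K * w (snd x))"
    have "(\<Sum>x\<in>?I. ?c x * prob (E x)) \<le> (\<Sum>x\<in>?I. ?c x * (1 / s))"
      using w k Ltn Ep by (intro sum_mono mult_left_mono) auto
    also have "\<dots> \<le> (\<Sum>x\<in>?Lt \<times> ?Lt. ?c x * (1 / s))"
      using w k s by (intro sum_mono2) auto
    also have "\<dots> = 2 * K / s * ((\<Sum>i\<in>?Lt. w i) * (\<Sum>i\<in>?Lt. w i))"
      by (simp add: sum_product sum_distrib_left sum.cartesian_product split_def mult_ac)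
    also have "\<dots> \<le> 2 * K / s * (D * D)"
      using sumLt w k s D by (intro mult_left_mono mult_mono sum_nonneg) auto
    also have "\<dots> \<le> 1 / 8 * (1 / 16)" using s s2 by (simp add: field_simps power2_eq_square)
    finally show "(\<Sum>x\<in>?I. ?c x * prob (E x)) \<le> 1 / 8 * (1 / 16)" .
  qed (use f2m in auto)
  have P3: "prob {v \<in> space M. 32 * K * D\<^sup>2 / s < f3 v} \<le> 1 / 16"
  proof (rule Markov_finite_sum)
    let ?I = "?Lt \<times> ?Hv"
    show "finite ?I" by simp
    show "E x \<in> events" if "x \<in> ?I" for x using that Ltn Hvn Em by (cases x) auto
    show "0 \<le> w (fst x)" for x :: "nat \<times> nat" using w by simp
    show "0 < 32 * K * D\<^sup>2 / s" using k D s by simp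
    fix v assume om: "v \<in> space M"
    show "f3 v \<le> (\<Sum>x\<in>?I. w (fst x) * indicator (E x) v)"
      unfolding f3_def
    proof -
      have "(if \<exists>j\<in>?Hv. H v i = H v j then w i else 0) \<le> (\<Sum>j\<in>?Hv. w i * indicator (E (i, j)) v)" for i
      proof (cases "\<exists>j\<in>?Hv. H v i = H v j")
        case True
        then obtain j where j: "j \<in> ?Hv" "H v i = H v j" by blast
        have "w i = w i * indicator (E (i, j)) v" using j om by (simp add: E_def)
        also have "\<dots> \<le> (\<Sum>j\<in>?Hv. w i * indicator (E (i, j)) v)"
          using j w by (intro member_le_sum) auto
        finally show ?thesis using True by simp
      qed (use w in \<open>auto intro!: sum_nonneg\<close>)
      then have "(\<Sum>i\<in>?Lt. if \<exists>j\<in>?Hv. H v i = H v j then w i else 0) \<le> (\<Sum>i\<in>?Lt. \<Sum>j\<in>?Hv. w i * indicator (E (i, j)) v)"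
        by (intro sum_mono)
      also have "\<dots> = (\<Sum>x\<in>?I. w (fst x) * indicator (E x) v)"
        by (subst sum.cartesian_product) (intro sum.cong refl, auto)
      finally show "(\<Sum>i\<in>?Lt. if \<exists>j\<in>?Hv. H v i = H v j then w i else 0) \<le> (\<Sum>x\<in>?I. w (fst x) * indicator (E x) v)" .
    qed
  next
    have "(\<Sum>x\<in>?Lt \<times> ?Hv. w (fst x) * prob (E x)) \<le> (\<Sum>x\<in>?Lt \<times> ?Hv. w (fst x) * (1 / s))"
    proof (intro sum_mono mult_left_mono)
      fix x assume x: "x \<in> ?Lt \<times> ?Hv"
      then have "fst x \<noteq> snd x" by (auto simp: light_rows_def heavy_rows_def)
      then show "prob (E x) \<le> 1 / s" using x Ep[of "fst x" "snd x"] Ltn Hvn by auto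
    qed (use w in auto)
    also have "\<dots> = (\<Sum>i\<in>?Lt. \<Sum>j\<in>?Hv. w i * (1 / s))"
      by (subst sum.cartesian_product) (intro sum.cong refl, auto)
    also have "\<dots> = (\<Sum>i\<in>?Lt. w i) * (real (card ?Hv) * (1 / s))"
      by (simp add: sum_distrib_right sum_divide_distrib mult_ac)
    also have "\<dots> \<le> D * (2 * K * D * (1 / s))"
      using sumLt cardHv s D k by (intro mult_mono) auto
    also have "\<dots> = 32 * K * D\<^sup>2 / s * (1 / 16)" by (simp add: power2_eq_square)
    finally show "(\<Sum>x\<in>?Lt \<times> ?Hv. w (fst x) * prob (E x)) \<le> 32 * K * D\<^sup>2 / s * (1 / 16)" .
  qed (use f3m in auto)
  let ?bad = "B1 \<union> {v \<in> space M. 1/8 < f2 v} \<union> {v \<in> space M. 32 * K * D\<^sup>2 / s < f3 v}"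
  have B1sub: "B1 \<subseteq> space M" using B1m sets.sets_into_space by blast
  have eq: "{v \<in> space M. good_hash n w K (32 * K * D\<^sup>2 / s) (H v)} = space M - ?bad"
    by (auto simp: good_hash_def f2_def f3_def B1_def E_def not_less not_le)
  have f2e: "{v \<in> space M. 1/8 < f2 v} \<in> events" by measurable
  have f3e: "{v \<in> space M. 32 * K * D\<^sup>2 / s < f3 v} \<in> events" by measurable
  have badm: "?bad \<in> events" by (intro sets.Un B1m f2e f3e)
  show "{v \<in> space M. good_hash n w K (32 * K * D\<^sup>2 / s) (H v)} \<in> events"
    unfolding eq using badm by auto
  have "prob ?bad \<le> prob (B1 \<union> {v \<in> space M. 1/8 < f2 v}) + prob {v \<in> space M. 32 * K * D\<^sup>2 / s < f3 v}"
    by (intro measure_Un_le sets.Un B1m f2e f3e)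
  also have "prob (B1 \<union> {v \<in> space M. 1/8 < f2 v}) \<le> prob B1 + prob {v \<in> space M. 1/8 < f2 v}"
    by (intro measure_Un_le B1m f2e)
  finally have "prob ?bad \<le> 3 / 16" using P1 P2 P3 by linarith
  then show "13 / 16 \<le> prob {v \<in> space M. good_hash n w K (32 * K * D\<^sup>2 / s) (H v)}"
    unfolding eq prob_compl[OF badm] by simp
qed

section \<open>The sketch in a well-conditioned basis\<close>

lemma square_powr_half:
  fixes x p :: real
  shows "(x\<^sup>2) powr (p/2) = \<bar>x\<bar> powr p"
proof (cases "x = 0")
  case False
  then have "x\<^sup>2 = \<bar>x\<bar> powr 2" by simp
  then show ?thesis by (simp only: powr_powr) simp
qed simp

text \<open>Convexity at the midpoint gives the constant 2^(p - 1), at most 2. Zero arguments are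
  split off because convexity is applied to positive reals.\<close>

lemma abs_add_powr_le:
  fixes a b p :: real
  assumes "1 \<le> p" "p \<le> 2"
  shows "\<bar>a + b\<bar> powr p \<le> 2 * \<bar>a\<bar> powr p + 2 * \<bar>b\<bar> powr p"
proof (cases "a = 0 \<or> b = 0")
  case False
  then have "a \<noteq> 0" "b \<noteq> 0" by auto
  have "((1/2) * \<bar>a\<bar> + (1/2) * \<bar>b\<bar>) powr p \<le> (1/2) * \<bar>a\<bar> powr p + (1/2) * \<bar>b\<bar> powr p"
    using convex_onD[OF powr_convex[OF assms(1)], of "1/2" "\<bar>a\<bar>" "\<bar>b\<bar>"] \<open>a \<noteq> 0\<close> \<open>b \<noteq> 0\<close> by simp
  then have "2 powr p * ((\<bar>a\<bar> + \<bar>b\<bar>) / 2) powr p \<le> 2 powr p * ((\<bar>a\<bar> powr p + \<bar>b\<bar> powr p) / 2)"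
    by (intro mult_left_mono) (auto simp: add_divide_distrib)
  also have "2 powr p * ((\<bar>a\<bar> + \<bar>b\<bar>) / 2) powr p = (\<bar>a\<bar> + \<bar>b\<bar>) powr p"
  proof -
    have "2 * (x / 2) = x" for x :: real by simp
    then show ?thesis by (simp only: powr_mult[symmetric])
  qed
  also have "2 powr p * ((\<bar>a\<bar> powr p + \<bar>b\<bar> powr p) / 2) \<le> 2 powr 2 * ((\<bar>a\<bar> powr p + \<bar>b\<bar> powr p) / 2)"
    using assms by (intro mult_right_mono powr_mono) auto
  finally have "(\<bar>a\<bar> + \<bar>b\<bar>) powr p \<le> 2 * \<bar>a\<bar> powr p + 2 * \<bar>b\<bar> powr p" by simp
  moreover have "\<bar>a + b\<bar> powr p \<le> (\<bar>a\<bar> + \<bar>b\<bar>) powr p" using assms by (intro powr_mono2) auto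
  ultimately show ?thesis by linarith
qed auto

lemma abs_inner_powr_le:
  fixes a b :: "'j \<Rightarrow> real"
  assumes "0 < p"
  shows "\<bar>\<Sum>j\<in>J. a j * b j\<bar> powr p \<le> (\<Sum>j\<in>J. (a j)\<^sup>2) powr (p/2) * (\<Sum>j\<in>J. (b j)\<^sup>2) powr (p/2)"
proof -
  have "\<bar>\<Sum>j\<in>J. a j * b j\<bar> powr p = ((\<Sum>j\<in>J. a j * b j)\<^sup>2) powr (p/2)" by (simp only: square_powr_half)
  also have "\<dots> \<le> ((\<Sum>j\<in>J. (a j)\<^sup>2) * (\<Sum>j\<in>J. (b j)\<^sup>2)) powr (p/2)"
    using assms by (intro powr_mono2 Cauchy_Schwarz_ineq_sum) auto
  also have "\<dots> = (\<Sum>j\<in>J. (a j)\<^sup>2) powr (p/2) * (\<Sum>j\<in>J. (b j)\<^sup>2) powr (p/2)"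
    by (intro powr_mult)
  finally show ?thesis .
qed

lemma grid_approximation:
  fixes x :: real and N :: nat
  assumes "0 < N" "\<bar>x\<bar> \<le> 1"
  obtains e :: int where "e \<in> {- int N..int N}" "\<bar>of_int e / real N\<bar> \<le> \<bar>x\<bar>" "\<bar>x - of_int e / real N\<bar> \<le> 1 / real N"
proof -
  define f where "f = \<lfloor>real N * \<bar>x\<bar>\<rfloor>"
  define e where "e = (if 0 \<le> x then f else - f)"
  have N: "0 < real N" using assms by simp
  have f: "0 \<le> f" "of_int f \<le> real N * \<bar>x\<bar>" "real N * \<bar>x\<bar> < of_int f + 1"
    by (auto simp: f_def zero_le_floor)
  have "real N * \<bar>x\<bar> \<le> real N * 1" using assms by (intro mult_left_mono) auto
  then have "of_int f \<le> real N" using f by linarith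
  then have "f \<le> int N" by linarith
  then have "e \<in> {- int N..int N}" using f by (auto simp: e_def)
  moreover have f1: "of_int f / real N \<le> \<bar>x\<bar>" "\<bar>x\<bar> - of_int f / real N \<le> 1 / real N"
  proof -
    show "of_int f / real N \<le> \<bar>x\<bar>" using f N by (simp add: pos_divide_le_eq mult.commute)
    have "\<bar>x\<bar> \<le> (of_int f + 1) / real N" using f N by (simp add: pos_le_divide_eq mult.commute)
    then show "\<bar>x\<bar> - of_int f / real N \<le> 1 / real N" by (simp add: add_divide_distrib)
  qed
  moreover have "0 \<le> of_int f / real N" using f N by simp
  ultimately show ?thesis using that[of e] by (auto simp: e_def abs_if split: if_splits)
qed

section \<open>Deterministic bounds in a Lewis basis\<close>

locale lewis_rows =
  fixes p :: real and n d :: nat and u :: "nat \<Rightarrow> nat \<Rightarrow> real"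
  assumes p1: "1 < p" and p2: "p < 2" and d0: "0 < d"
    and size: "(\<Sum>i<n. (\<Sum>j<d. (u i j)\<^sup>2) powr (p/2)) = real d"
    and norm_le: "(\<Sum>j<d. (z j)\<^sup>2) powr (p/2) \<le> (\<Sum>i<n. \<bar>\<Sum>j<d. u i j * z j\<bar> powr p)"
begin

definition weight :: "nat \<Rightarrow> real" where
  "weight i = (\<Sum>j<d. (u i j)\<^sup>2) powr (p/2)"

definition col_comb :: "(nat \<Rightarrow> real) \<Rightarrow> nat \<Rightarrow> real" where
  "col_comb z i = (\<Sum>j<d. u i j * z j)"

text \<open>The p-th power of the Euclidean norm of the combined rows. By Cauchy-Schwarz it bounds
  the contribution of the block for all z in the unit ball simultaneously, so no grid is
  involved.\<close>

definition block_norm :: "(nat \<Rightarrow> real) \<Rightarrow> nat set \<Rightarrow> real" where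
  "block_norm g I = (\<Sum>j<d. (\<Sum>i\<in>I. g i * u i j)\<^sup>2) powr (p/2)"

lemma weight_nonneg: "0 \<le> weight i" by (simp add: weight_def)

lemma sum_weight: "(\<Sum>i<n. weight i) = real d" using size by (simp add: weight_def)

lemma abs_col_comb_le: "\<bar>col_comb z i\<bar> powr p \<le> weight i * (\<Sum>j<d. (z j)\<^sup>2) powr (p/2)"
  unfolding col_comb_def weight_def using p1 by (intro abs_inner_powr_le) auto

lemma abs_block_le:
  "\<bar>\<Sum>i\<in>I. g i * col_comb z i\<bar> powr p \<le> block_norm g I * (\<Sum>j<d. (z j)\<^sup>2) powr (p/2)"
proof -
  have "(\<Sum>i\<in>I. g i * col_comb z i) = (\<Sum>j<d. (\<Sum>i\<in>I. g i * u i j) * z j)"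
    unfolding col_comb_def sum_distrib_left sum_distrib_right by (subst sum.swap) (simp add: mult_ac)
  then show ?thesis unfolding block_norm_def using p1 by (simp add: abs_inner_powr_le)
qed

lemma col_comb_diff: "col_comb (\<lambda>j. z j - z' j) i = col_comb z i - col_comb z' i"
  by (simp add: col_comb_def algebra_simps sum_subtractf)

lemma unit_ball_powr:
  assumes "(\<Sum>j<d. (z j)\<^sup>2) \<le> 1"
  shows "(\<Sum>j<d. (z j)\<^sup>2) powr (p/2) \<le> 1"
  using assms p1 powr_mono2[of "p/2" "\<Sum>j<d. (z j)\<^sup>2" 1] by (simp add: sum_nonneg)

lemma sphere_in_unit_ball:
  assumes "(\<Sum>i<n. \<bar>col_comb z i\<bar> powr p) = 1"
  shows "(\<Sum>j<d. (z j)\<^sup>2) \<le> 1"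
proof (rule ccontr)
  assume "\<not> (\<Sum>j<d. (z j)\<^sup>2) \<le> 1"
  then have "1 powr (p/2) < (\<Sum>j<d. (z j)\<^sup>2) powr (p/2)"
    using p1 by (intro powr_less_mono2) auto
  moreover have "(\<Sum>j<d. (z j)\<^sup>2) powr (p/2) \<le> 1" using norm_le[of z] assms by (simp add: col_comb_def)
  ultimately show False by simp
qed

abbreviation heavy :: "real \<Rightarrow> nat set" where
  "heavy \<equiv> heavy_rows n weight"

abbreviation light :: "real \<Rightarrow> nat set" where
  "light \<equiv> light_rows n weight"

definition bucket :: "(nat \<Rightarrow> nat) \<Rightarrow> nat \<Rightarrow> nat set" where
  "bucket h k = {i. i < n \<and> h i = k}"

lemma finite_bucket [simp]: "finite (bucket h k)"
  by (simp add: bucket_def)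

definition grid_point :: "nat \<Rightarrow> (nat \<Rightarrow> int) \<Rightarrow> nat \<Rightarrow> real" where
  "grid_point N e j = of_int (e j) / real N"

definition grid :: "nat \<Rightarrow> (nat \<Rightarrow> int) set" where
  "grid N = ({..<d} \<rightarrow>\<^sub>E {- int N..int N})"

text \<open>The grid depends neither on the hash nor on the scalars, so a union bound over it is
  legitimate. Rounding changes a light mass of 1/2 into some x with 1/2 \<le> 2 x + 2/16, that is x
  \<ge> 3/16.\<close>

definition light_grid :: "real \<Rightarrow> nat \<Rightarrow> (nat \<Rightarrow> int) set" where
  "light_grid K N = {e \<in> grid N. (\<Sum>j<d. (grid_point N e j)\<^sup>2) \<le> 1 \<and>
     3 / 16 \<le> (\<Sum>i\<in>light K. \<bar>col_comb (grid_point N e) i\<bar> powr p)}"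

text \<open>This is the p-th power of the norm of the sketched vector; p-th powers turn the sum over
  buckets into a sum of functions of independent blocks.\<close>

definition sketch_power :: "nat \<Rightarrow> (nat \<Rightarrow> nat) \<Rightarrow> (nat \<Rightarrow> real) \<Rightarrow> (nat \<Rightarrow> real) \<Rightarrow> real" where
  "sketch_power s h g z = (\<Sum>k<s. \<bar>\<Sum>i\<in>bucket h k. g i * col_comb z i\<bar> powr p)"

text \<open>Only the last clause speaks of individual vectors. The others are uniform in z: total
  size, weight of the rows with small scalars, and light noise in heavy buckets.\<close>

definition good_scaling :: "nat \<Rightarrow> real \<Rightarrow> nat \<Rightarrow> real \<Rightarrow> real \<Rightarrow> real \<Rightarrow> (nat \<Rightarrow> nat) \<Rightarrow> (nat \<Rightarrow> real) \<Rightarrow> bool" where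
  "good_scaling s K N a R R' h g \<longleftrightarrow>
    (\<Sum>k<s. block_norm g (bucket h k)) \<le> R \<and>
    (\<Sum>i<n. if \<bar>g i\<bar> \<le> a then weight i else 0) \<le> 1 / 8 \<and>
    (\<Sum>k\<in>h ` heavy K. block_norm g (bucket h k \<inter> light K)) \<le> R' \<and>
    (\<forall>e\<in>light_grid K N. 1 / 165888 < sketch_power s h g (grid_point N e))"

lemma sketch_power_upper:
  assumes "(\<Sum>k<s. block_norm g (bucket h k)) \<le> R" "(\<Sum>j<d. (z j)\<^sup>2) powr (p/2) \<le> b"
  shows "sketch_power s h g z \<le> R * b"
proof -
  have bn: "0 \<le> block_norm g I" for I by (simp add: block_norm_def)
  have "sketch_power s h g z \<le> (\<Sum>k<s. block_norm g (bucket h k) * b)"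
    unfolding sketch_power_def
    using bn assms(2) by (intro sum_mono order_trans[OF abs_block_le] mult_left_mono) auto
  also have "\<dots> = (\<Sum>k<s. block_norm g (bucket h k)) * b" by (simp add: sum_distrib_right)
  also have "\<dots> \<le> R * b" using assms order_trans[OF powr_ge_zero assms(2)] by (intro mult_right_mono) auto
  finally show ?thesis .
qed

lemma sketch_power_diff:
  "sketch_power s h g z \<le> 2 * sketch_power s h g z' + 2 * sketch_power s h g (\<lambda>j. z j - z' j)"
proof -
  have "sketch_power s h g z \<le> (\<Sum>k<s. 2 * \<bar>\<Sum>i\<in>bucket h k. g i * col_comb z' i\<bar> powr p
      + 2 * \<bar>\<Sum>i\<in>bucket h k. g i * col_comb (\<lambda>j. z j - z' j) i\<bar> powr p)"
    unfolding sketch_power_def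
  proof (intro sum_mono)
    fix k
    have "(\<Sum>i\<in>bucket h k. g i * col_comb z i) = (\<Sum>i\<in>bucket h k. g i * col_comb z' i) + (\<Sum>i\<in>bucket h k. g i * col_comb (\<lambda>j. z j - z' j) i)"
      by (simp add: col_comb_diff algebra_simps sum_subtractf)
    then show "\<bar>\<Sum>i\<in>bucket h k. g i * col_comb z i\<bar> powr p \<le> 2 * \<bar>\<Sum>i\<in>bucket h k. g i * col_comb z' i\<bar> powr p
        + 2 * \<bar>\<Sum>i\<in>bucket h k. g i * col_comb (\<lambda>j. z j - z' j) i\<bar> powr p"
      using p1 p2 abs_add_powr_le[of p] by simp
  qed
  then show ?thesis by (simp add: sketch_power_def sum.distrib sum_distrib_left)
qed

text \<open>A heavy bucket holds a single heavy row plus light noise, so the triangle inequality for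
  p-th powers recovers |g i y i|^p from the bucket. Altogether 3/8 a^p is at most twice the sketch
  plus twice the noise, and the noise is at most a^p / 16.\<close>

lemma sketch_power_heavy:
  assumes h: "\<And>i. i < n \<Longrightarrow> h i < s"
    and inj: "\<And>i j. i \<in> heavy K \<Longrightarrow> j \<in> heavy K \<Longrightarrow> i \<noteq> j \<Longrightarrow> h i \<noteq> h j"
    and g: "(\<Sum>i<n. if \<bar>g i\<bar> \<le> a then weight i else 0) \<le> 1 / 8"
      "(\<Sum>k\<in>h ` heavy K. block_norm g (bucket h k \<inter> light K)) \<le> R'"
    and a: "0 < a" and R': "R' \<le> a powr p / 16"
    and z: "(\<Sum>j<d. (z j)\<^sup>2) \<le> 1"
    and mass: "1 / 2 \<le> (\<Sum>i\<in>heavy K. \<bar>col_comb z i\<bar> powr p)"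
  shows "a powr p / 16 \<le> sketch_power s h g z"
proof -
  let ?Hv = "heavy K" and ?Lt = "light K"
  have yw: "\<bar>col_comb z i\<bar> powr p \<le> weight i" for i
    using abs_col_comb_le[of z i] mult_left_mono[OF unit_ball_powr[OF z] weight_nonneg[of i]] by linarith
  define b where "b k = (\<Sum>i\<in>bucket h k. g i * col_comb z i)" for k
  define v where "v k = (\<Sum>i\<in>bucket h k \<inter> ?Lt. g i * col_comb z i)" for k
  have split: "b (h i) = g i * col_comb z i + v (h i)" if "i \<in> ?Hv" for i
  proof -
    have "bucket h (h i) = insert i (bucket h (h i) \<inter> ?Lt)" "i \<notin> bucket h (h i) \<inter> ?Lt"
    proof -
      have "x \<in> ?Lt" if "x \<in> bucket h (h i)" "x \<noteq> i" for x
      proof -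
        have "x \<notin> ?Hv" using inj[OF \<open>i \<in> ?Hv\<close>, of x] that by (auto simp: bucket_def)
        then show ?thesis using that rows_partition(1)[of n weight K] by (auto simp: bucket_def)
      qed
      then show "bucket h (h i) = insert i (bucket h (h i) \<inter> ?Lt)" "i \<notin> bucket h (h i) \<inter> ?Lt"
        using that by (auto simp: bucket_def heavy_rows_def light_rows_def)
    qed
    then show ?thesis unfolding b_def v_def by (metis (no_types, lifting) finite_Int finite_bucket sum.insert)
  qed
  have injh: "inj_on h ?Hv" using inj by (auto simp: inj_on_def)
  \<comment> \<open>Which scalars are small must not depend on z. The rows concerned are therefore
    charged with their full weights, which bound the coordinates of every admissible z.\<close>
  have "a powr p * (1 / 2 - 1 / 8) \<le> a powr p * ((\<Sum>i\<in>?Hv. \<bar>col_comb z i\<bar> powr p) - (\<Sum>i<n. if \<bar>g i\<bar> \<le> a then weight i else 0))"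
    using mass g(1) by (intro mult_left_mono) auto
  also have "\<dots> \<le> a powr p * ((\<Sum>i\<in>?Hv. \<bar>col_comb z i\<bar> powr p) - (\<Sum>i\<in>?Hv. if \<bar>g i\<bar> \<le> a then weight i else 0))"
    using weight_nonneg by (intro mult_left_mono diff_left_mono sum_mono2) (auto simp: heavy_rows_def)
  also have "\<dots> = (\<Sum>i\<in>?Hv. a powr p * (\<bar>col_comb z i\<bar> powr p - (if \<bar>g i\<bar> \<le> a then weight i else 0)))"
    by (simp only: sum_subtractf[symmetric] sum_distrib_left)
  also have "\<dots> \<le> (\<Sum>i\<in>?Hv. \<bar>g i * col_comb z i\<bar> powr p)"
  proof (intro sum_mono)
    fix i
    show "a powr p * (\<bar>col_comb z i\<bar> powr p - (if \<bar>g i\<bar> \<le> a then weight i else 0)) \<le> \<bar>g i * col_comb z i\<bar> powr p"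
    proof (cases "\<bar>g i\<bar> \<le> a")
      case True
      then have "a powr p * (\<bar>col_comb z i\<bar> powr p - (if \<bar>g i\<bar> \<le> a then weight i else 0)) \<le> 0"
        using yw[of i] by (simp add: mult_nonneg_nonpos)
      then show ?thesis using powr_ge_zero[of "\<bar>g i * col_comb z i\<bar>" p] by linarith
    next
      case False
      then have "a powr p \<le> \<bar>g i\<bar> powr p" using a p1 by (intro powr_mono2) auto
      then show ?thesis using False by (simp add: abs_mult powr_mult mult_right_mono)
    qed
  qed
  also have "\<dots> \<le> (\<Sum>i\<in>?Hv. 2 * \<bar>b (h i)\<bar> powr p + 2 * \<bar>v (h i)\<bar> powr p)"
  proof (intro sum_mono)
    fix i assume "i \<in> ?Hv"
    then have "g i * col_comb z i = b (h i) + (- v (h i))" by (simp add: split)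
    then show "\<bar>g i * col_comb z i\<bar> powr p \<le> 2 * \<bar>b (h i)\<bar> powr p + 2 * \<bar>v (h i)\<bar> powr p"
      using abs_add_powr_le[of p "b (h i)" "- v (h i)"] p1 p2 by simp
  qed
  also have "\<dots> = 2 * (\<Sum>k\<in>h ` ?Hv. \<bar>b k\<bar> powr p) + 2 * (\<Sum>k\<in>h ` ?Hv. \<bar>v k\<bar> powr p)"
    using injh by (simp add: sum.distrib sum_distrib_left sum.reindex)
  also have "(\<Sum>k\<in>h ` ?Hv. \<bar>b k\<bar> powr p) \<le> sketch_power s h g z"
    unfolding sketch_power_def b_def using h by (intro sum_mono2) (auto simp: heavy_rows_def)
  also have "(\<Sum>k\<in>h ` ?Hv. \<bar>v k\<bar> powr p) \<le> (\<Sum>k\<in>h ` ?Hv. block_norm g (bucket h k \<inter> ?Lt))"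
  proof (intro sum_mono)
    fix k
    have "\<bar>v k\<bar> powr p \<le> block_norm g (bucket h k \<inter> ?Lt) * (\<Sum>j<d. (z j)\<^sup>2) powr (p/2)"
      unfolding v_def by (rule abs_block_le)
    also have "\<dots> \<le> block_norm g (bucket h k \<inter> ?Lt) * 1"
      using unit_ball_powr[OF z] by (intro mult_left_mono) (auto simp: block_norm_def)
    finally show "\<bar>v k\<bar> powr p \<le> block_norm g (bucket h k \<inter> ?Lt)" by simp
  qed
  finally have "a powr p * (1 / 2 - 1 / 8) \<le> 2 * sketch_power s h g z + 2 * R'"
    using g(2) by simp
  moreover have "a powr p * (1 / 2 - 1 / 8) = 3 / 8 * a powr p" by simp
  ultimately show ?thesis using R' powr_ge_zero[of a p] by linarith
qed

text \<open>Rounding the coordinates towards zero keeps the grid point in the unit ball.\<close>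
lemma sketch_power_light:
  assumes N: "16 * (real d)\<^sup>2 \<le> real N" "663552 * real d * R \<le> real N"
    and g: "(\<Sum>k<s. block_norm g (bucket h k)) \<le> R"
      "\<And>e. e \<in> light_grid K N \<Longrightarrow> 1 / 165888 < sketch_power s h g (grid_point N e)"
    and z: "(\<Sum>j<d. (z j)\<^sup>2) \<le> 1"
    and mass: "1 / 2 \<le> (\<Sum>i\<in>light K. \<bar>col_comb z i\<bar> powr p)"
  shows "1 / 663552 \<le> sketch_power s h g z"
proof -
  let ?Lt = "light K"
  have "16 * 1 \<le> 16 * (real d)\<^sup>2" using d0 by simp
  then have N0: "0 < N" using N by (cases "N = 0") auto
  have R0: "0 \<le> R" using g(1) by (intro order_trans[OF _ g(1)] sum_nonneg) (auto simp: block_norm_def)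
  have dN: "real d \<le> real N"
  proof -
    have "real d * 1 \<le> real d * (16 * real d)" using d0 by (intro mult_left_mono) auto
    then show ?thesis using N by (simp add: power2_eq_square)
  qed
  have zj: "\<bar>z j\<bar> \<le> 1" if "j < d" for j
  proof -
    have "(z j)\<^sup>2 \<le> (\<Sum>j<d. (z j)\<^sup>2)" using that by (intro member_le_sum) auto
    then have "(z j)\<^sup>2 \<le> 1" using z by linarith
    then show ?thesis by (simp add: abs_square_le_1)
  qed
  have "\<exists>e. e \<in> {- int N..int N} \<and> \<bar>of_int e / real N\<bar> \<le> \<bar>z j\<bar> \<and> \<bar>z j - of_int e / real N\<bar> \<le> 1 / real N"
    if "j < d" for j
    using grid_approximation[OF N0 zj[OF that]] by metis
  then obtain e0 where e0: "\<And>j. j < d \<Longrightarrow> e0 j \<in> {- int N..int N} \<and> \<bar>of_int (e0 j) / real N\<bar> \<le> \<bar>z j\<bar>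
      \<and> \<bar>z j - of_int (e0 j) / real N\<bar> \<le> 1 / real N"
    by metis
  define e where "e = restrict e0 {..<d}"
  define z' where "z' = grid_point N e"
  have z': "\<bar>z' j\<bar> \<le> \<bar>z j\<bar>" "\<bar>z j - z' j\<bar> \<le> 1 / real N" if "j < d" for j
    using e0[OF that] that by (auto simp: z'_def grid_point_def e_def)
  have eg: "e \<in> grid N" using e0 by (auto simp: grid_def e_def)
  have z'1: "(\<Sum>j<d. (z' j)\<^sup>2) \<le> 1"
  proof (rule order_trans[OF sum_mono z])
    show "(z' j)\<^sup>2 \<le> (z j)\<^sup>2" if "j \<in> {..<d}" for j using z'(1)[of j] that by (simp add: abs_le_square_iff)
  qed
  define D where "D = (\<Sum>j<d. (z j - z' j)\<^sup>2) powr (p/2)"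
  have D: "D \<le> real d / real N"
  proof -
    have "(\<Sum>j<d. (z j - z' j)\<^sup>2) \<le> (\<Sum>j<d. (1 / real N)\<^sup>2)"
      using z'(2) by (intro sum_mono) (auto simp: abs_le_square_iff[symmetric])
    also have "\<dots> = real d * (1 / real N)\<^sup>2" by simp
    \<comment> \<open>Enlarging d to d^2 produces a perfect square, whose power p/2 is (d /
      N)^p.\<close>
    also have "\<dots> \<le> (real d)\<^sup>2 * (1 / real N)\<^sup>2" using d0 by (intro mult_right_mono) (auto simp: power2_eq_square)
    also have "\<dots> = (real d / real N)\<^sup>2" by (simp add: power_divide)
    finally have "D \<le> ((real d / real N)\<^sup>2) powr (p/2)"
      unfolding D_def using p1 by (intro powr_mono2) (auto simp: sum_nonneg)
    also have "\<dots> = (real d / real N) powr p" by (subst square_powr_half) simp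
    also have "\<dots> \<le> (real d / real N) powr 1" using p1 dN N0 d0 by (intro powr_mono') auto
    finally show ?thesis using N0 d0 by simp
  qed
  have "(\<Sum>i\<in>?Lt. \<bar>col_comb z i\<bar> powr p) \<le> (\<Sum>i\<in>?Lt. 2 * \<bar>col_comb z' i\<bar> powr p + 2 * (weight i * D))"
  proof (intro sum_mono)
    fix i
    have "\<bar>col_comb (\<lambda>j. z j - z' j) i\<bar> powr p \<le> weight i * D" unfolding D_def by (rule abs_col_comb_le)
    then show "\<bar>col_comb z i\<bar> powr p \<le> 2 * \<bar>col_comb z' i\<bar> powr p + 2 * (weight i * D)"
      using abs_add_powr_le[of p "col_comb z' i" "col_comb (\<lambda>j. z j - z' j) i"] p1 p2 by (simp add: col_comb_diff)
  qed
  also have "\<dots> = 2 * (\<Sum>i\<in>?Lt. \<bar>col_comb z' i\<bar> powr p) + 2 * ((\<Sum>i\<in>?Lt. weight i) * D)"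
    by (simp add: sum.distrib sum_distrib_left sum_distrib_right)
  also have "(\<Sum>i\<in>?Lt. weight i) * D \<le> real d * (real d / real N)"
  proof (intro mult_mono D)
    show "(\<Sum>i\<in>?Lt. weight i) \<le> real d"
      unfolding sum_weight[symmetric] using weight_nonneg by (intro sum_mono2) (auto simp: light_rows_def)
  qed (auto simp: D_def)
  also have "real d * (real d / real N) \<le> 1 / 16" using N N0 by (simp add: field_simps power2_eq_square)
  finally have "3 / 16 \<le> (\<Sum>i\<in>?Lt. \<bar>col_comb z' i\<bar> powr p)" using mass by linarith
  then have "e \<in> light_grid K N" using eg z'1 by (simp add: light_grid_def z'_def)
  then have "1 / 165888 < sketch_power s h g z'" using g(2) by (simp add: z'_def)
  also have "\<dots> \<le> 2 * sketch_power s h g z + 2 * sketch_power s h g (\<lambda>j. z' j - z j)"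
    by (rule sketch_power_diff)
  also have "sketch_power s h g (\<lambda>j. z' j - z j) \<le> R * (real d / real N)"
    using D by (intro sketch_power_upper[OF g(1)]) (simp add: D_def power2_commute)
  \<comment> \<open>With 663552 = 4 * 165888, half of the grid value is lost to rounding and another
    factor 2 to the triangle inequality.\<close>
  also have "R * (real d / real N) \<le> 1 / 663552" using N N0 by (simp add: field_simps)
  finally show ?thesis by simp
qed

lemma sketch_power_bounds:
  assumes h: "\<And>i. i < n \<Longrightarrow> h i < s" and gh: "good_hash n weight K \<xi> h"
    and gs: "good_scaling s K N a R R' h g"
    and a: "0 < a" and R': "R' \<le> a powr p / 16"
    and N: "16 * (real d)\<^sup>2 \<le> real N" "663552 * real d * R \<le> real N"
    and z: "(\<Sum>i<n. \<bar>col_comb z i\<bar> powr p) = 1"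
  shows "sketch_power s h g z \<le> R" "min (a powr p / 16) (1 / 663552) \<le> sketch_power s h g z"
proof -
  have z1: "(\<Sum>j<d. (z j)\<^sup>2) \<le> 1" by (rule sphere_in_unit_ball[OF z])
  show "sketch_power s h g z \<le> R"
    using sketch_power_upper[where R=R and b=1 and z=z and g=g and h=h and s=s] unit_ball_powr[OF z1] gs by (simp add: good_scaling_def)
  have "(\<Sum>i\<in>heavy K. \<bar>col_comb z i\<bar> powr p) + (\<Sum>i\<in>light K. \<bar>col_comb z i\<bar> powr p) = 1"
    using z rows_partition[of n weight K] by (simp add: sum.union_disjoint[symmetric])
  then consider "1 / 2 \<le> (\<Sum>i\<in>heavy K. \<bar>col_comb z i\<bar> powr p)" | "1 / 2 \<le> (\<Sum>i\<in>light K. \<bar>col_comb z i\<bar> powr p)"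
    by linarith
  then show "min (a powr p / 16) (1 / 663552) \<le> sketch_power s h g z"
  proof cases
    case 1
    then have "a powr p / 16 \<le> sketch_power s h g z"
      using gh gs h by (intro sketch_power_heavy[OF _ _ _ _ a R' z1]) (auto simp: good_hash_def good_scaling_def)
    then show ?thesis by simp
  next
    case 2
    then have "1 / 663552 \<le> sketch_power s h g z"
      using gs by (intro sketch_power_light[OF N _ _ z1]) (auto simp: good_scaling_def)
    then show ?thesis by simp
  qed
qed

end

lemma (in prob_space) prob_Un4:
  assumes "A \<in> events" "B \<in> events" "C \<in> events" "D \<in> events"
  shows "prob (A \<union> B \<union> C \<union> D) \<le> prob A + prob B + prob C + prob D"
proof -
  have "prob (A \<union> B \<union> C \<union> D) \<le> prob (A \<union> B \<union> C) + prob D"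
    using assms by (intro measure_Un_le sets.Un)
  also have "prob (A \<union> B \<union> C) \<le> prob (A \<union> B) + prob C"
    using assms by (intro measure_Un_le sets.Un)
  also have "prob (A \<union> B) \<le> prob A + prob B"
    using assms by (intro measure_Un_le sets.Un)
  finally show ?thesis by simp
qed

section \<open>Probability of a good scaling for a fixed hash\<close>

context lewis_rows
begin

lemma disjoint_buckets: "disjoint_family_on (bucket h) F"
  by (auto simp: disjoint_family_on_def bucket_def)

lemma sum_buckets:
  assumes "\<And>i. i \<in> I \<Longrightarrow> h i \<in> F" "I \<subseteq> {..<n}" "finite F"
  shows "(\<Sum>k\<in>F. \<Sum>i\<in>bucket h k \<inter> I. f i) = (\<Sum>i\<in>I. f i)"
proof -
  have fin: "finite I" using assms(2) finite_subset by blast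
  have "bucket h k \<inter> I = {i \<in> I. h i = k}" for k using assms(2) by (auto simp: bucket_def)
  then show ?thesis using sum.group[OF fin assms(3), of h f] assms(1) by (auto simp: image_subset_iff)
qed

lemma card_grid: "real (card (grid N)) = (2 * real N + 1) ^ d" "finite (grid N)"
proof -
  have "card (grid N) = (\<Prod>j\<in>{..<d}. card {- int N..int N})"
    unfolding grid_def by (rule card_PiE) simp
  then show "real (card (grid N)) = (2 * real N + 1) ^ d" by simp
  show "finite (grid N)" unfolding grid_def by (intro finite_PiE) auto
qed

text \<open>A bucket can contribute only a bounded amount to the Laplace exponent. Where the light
  load is at most 1 / K, K times the light mass stays below the cap and counts in full, and such
  rows retain mass 3/16 - 1/8. Heavy rows in the same bucket only increase the capped term.\<close>

lemma capped_bucket_mass: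
  assumes k: "0 < K" and h: "\<And>i. i < n \<Longrightarrow> h i < s" and gh: "good_hash n weight K \<xi> h"
    and z: "(\<Sum>j<d. (z j)\<^sup>2) \<le> 1" and mass: "3 / 16 \<le> (\<Sum>i\<in>light K. \<bar>col_comb z i\<bar> powr p)"
  shows "K / 16 \<le> (\<Sum>k<s. min (K * (\<Sum>i\<in>bucket h k. \<bar>col_comb z i\<bar> powr p)) 1)"
proof -
  let ?Lt = "light K"
  define I where "I = {i \<in> ?Lt. light_load n weight K h i \<le> 1 / K}"
  have yw: "\<bar>col_comb z i\<bar> powr p \<le> weight i" for i
    using abs_col_comb_le[of z i] mult_left_mono[OF unit_ball_powr[OF z] weight_nonneg[of i]] by linarith
  have I: "I \<subseteq> ?Lt" "I \<subseteq> {..<n}" by (auto simp: I_def light_rows_def)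
  have "(\<Sum>i\<in>?Lt. \<bar>col_comb z i\<bar> powr p) \<le> (\<Sum>i\<in>I. \<bar>col_comb z i\<bar> powr p) + 1 / 8"
  proof -
    have "(\<Sum>i\<in>?Lt - I. \<bar>col_comb z i\<bar> powr p) \<le> (\<Sum>i\<in>?Lt - I. if 1 / K < light_load n weight K h i then weight i else 0)"
      using yw by (intro sum_mono) (auto simp: I_def)
    also have "\<dots> \<le> (\<Sum>i\<in>?Lt. if 1 / K < light_load n weight K h i then weight i else 0)"
      using weight_nonneg by (intro sum_mono2) auto
    also have "\<dots> \<le> 1 / 8" using gh by (simp add: good_hash_def)
    finally show ?thesis using sum.subset_diff[OF I(1), of "\<lambda>i. \<bar>col_comb z i\<bar> powr p"] by simp
  qed
  then have "K * (1 / 16) \<le> K * (\<Sum>i\<in>I. \<bar>col_comb z i\<bar> powr p)"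
    using mass k by (intro mult_left_mono) auto
  also have "\<dots> = (\<Sum>k<s. K * (\<Sum>i\<in>bucket h k \<inter> I. \<bar>col_comb z i\<bar> powr p))"
    using h I by (subst sum_buckets[symmetric, of I h "{..<s}"]) (auto simp: sum_distrib_left)
  also have "\<dots> \<le> (\<Sum>k<s. min (K * (\<Sum>i\<in>bucket h k. \<bar>col_comb z i\<bar> powr p)) 1)"
  proof (intro sum_mono min.boundedI)
    fix k
    show "K * (\<Sum>i\<in>bucket h k \<inter> I. \<bar>col_comb z i\<bar> powr p) \<le> K * (\<Sum>i\<in>bucket h k. \<bar>col_comb z i\<bar> powr p)"
      using k by (intro mult_left_mono sum_mono2) auto
    show "K * (\<Sum>i\<in>bucket h k \<inter> I. \<bar>col_comb z i\<bar> powr p) \<le> 1"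
    proof (cases "bucket h k \<inter> I = {}")
      case False
      then obtain i where i: "i \<in> I" "h i = k" by (auto simp: bucket_def)
      have "(\<Sum>j\<in>bucket h k \<inter> I. \<bar>col_comb z j\<bar> powr p) \<le> (\<Sum>j\<in>bucket h k \<inter> I. weight j)"
        using yw by (intro sum_mono)
      also have "\<dots> \<le> (\<Sum>j\<in>{j \<in> ?Lt. h j = h i}. weight j)"
        using I i weight_nonneg by (intro sum_mono2) (auto simp: bucket_def)
      also have "\<dots> = light_load n weight K h i" by (simp add: light_load_def sum.inter_filter)
      also have "\<dots> \<le> 1 / K" using i by (simp add: I_def)
      finally show ?thesis using k by (simp add: field_simps)
    qed simp
  qed
  finally show ?thesis by simp
qed

text \<open>The clauses fail with probabilities at most 1/8, 1/16, 1/8 and 1/16, in total 3/8. In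
  the two weak type bounds one 1/16 pays for truncation (\<open>16 * real s \<le> 2 ^ L\<close>) and
  one for the mean.\<close>

lemma good_scaling_prob:
  fixes X :: "nat \<Rightarrow> 'a \<Rightarrow> real"
  assumes F: "stable_family M X {..<n} p"
    and h: "\<And>i. i < n \<Longrightarrow> h i < s" and s: "0 < s"
    and k: "0 < K" and gh: "good_hash n weight K (32 * K * (real d)\<^sup>2 / real s) h"
    and L: "16 * real s \<le> 2 ^ L" and N: "0 < N"
    and R: "R = 512 * real d * (1 + real L)" and R': "R' = 8704 * K * (real d)\<^sup>2 * (1 + real L) / real s"
    and a: "a = 1 / (2304 * real d)"
    and net: "(2 * real N + 1) ^ d * exp (- K / 165888) \<le> 1 / 16"
  shows "{w \<in> space M. good_scaling s K N a R R' h (\<lambda>i. X i w)} \<in> sets M"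
    and "5 / 8 \<le> measure M {w \<in> space M. good_scaling s K N a R R' h (\<lambda>i. X i w)}"
proof -
  interpret prob_space M using F by (rule stable_family.axioms(1))
  interpret F: stable_family M X "{..<n}" p by (rule F)
  let ?Hv = "heavy K" and ?Lt = "light K"
  have X: "X i \<in> borel_measurable M" if "i < n" for i using that F.X by simp
  have LtF: "?Lt \<subseteq> {..<n}" "?Hv \<subseteq> {..<n}" by (auto simp: light_rows_def heavy_rows_def)
  have bF: "bucket h k \<subseteq> {..<n}" for k by (auto simp: bucket_def)
  define Z where "Z I w = block_norm (\<lambda>i. X i w) I" for I w
  have Zm: "Z I \<in> borel_measurable M" if "I \<subseteq> {..<n}" for I
  proof -
    have "X i \<in> borel_measurable M" if "i \<in> I" for i using that \<open>I \<subseteq> {..<n}\<close> X by auto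
    then show ?thesis unfolding Z_def block_norm_def by measurable
  qed
  have Z0: "0 \<le> Z I w" for I w by (simp add: Z_def block_norm_def)
  \<comment> \<open>The padding d / s makes the scales of empty buckets positive, as
    \<open>sum_weak_type_tail\<close> demands. Over all s buckets it adds d, which only doubles the
    total weight.\<close>
  have Ztail: "prob {w \<in> space M. t < Z I w} \<le> 16 * ((\<Sum>i\<in>I. weight i) + real d / real s) / t"
    if "I \<subseteq> {..<n}" "0 < t" for I t
  proof -
    have "prob {w \<in> space M. t < Z I w} \<le> 16 * (\<Sum>i\<in>I. weight i) / t"
      unfolding Z_def block_norm_def weight_def
      by (rule stable_family.stable_vector_tail[OF F.subfamily[OF that(1)] that(2)])
    also have "\<dots> \<le> 16 * ((\<Sum>i\<in>I. weight i) + real d / real s) / t"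
      using that by (intro divide_right_mono) auto
    finally show ?thesis .
  qed
  have ds: "0 < real d / real s" using d0 s by simp
  have apos: "0 < 16 * ((\<Sum>i\<in>I. weight i) + real d / real s)" for I
    using ds weight_nonneg by (intro mult_pos_pos add_nonneg_pos sum_nonneg) auto
  have sL: "real s / 2 ^ L \<le> 1 / 16" using L by (simp add: field_simps)

  let ?F1 = "{w \<in> space M. R < (\<Sum>k<s. Z (bucket h k) w)}"
  have R0: "0 < R" using d0 R by simp
  have P1: "prob ?F1 \<le> 1 / 8"
  proof -
    have "prob ?F1 \<le> real (card {..<s}) / 2 ^ L
        + (\<Sum>k<s. 16 * ((\<Sum>i\<in>bucket h k. weight i) + real d / real s)) * (1 + real L) / R"
      using Zm[OF bF] Z0 apos Ztail[OF bF] R0 by (intro sum_weak_type_tail) auto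
    also have "(\<Sum>k<s. 16 * ((\<Sum>i\<in>bucket h k. weight i) + real d / real s)) = 32 * real d"
    proof -
      have "(\<Sum>k<s. \<Sum>i\<in>bucket h k. weight i) = (\<Sum>i<n. weight i)"
        using sum_buckets[of "{..<n}" h "{..<s}" weight] h bF by (simp add: Int_absorb2)
      then show ?thesis using s sum_weight by (simp add: sum_distrib_left[symmetric] sum.distrib)
    qed
    also have "32 * real d * (1 + real L) / R = 1 / 16" using d0 by (simp add: R)
    finally have "prob ?F1 \<le> real s / 2 ^ L + 1 / 16" by simp
    then show ?thesis using sL by linarith
  qed

  let ?F2 = "{w \<in> space M. 1 / 8 < (\<Sum>i<n. if \<bar>X i w\<bar> \<le> a then weight i else 0)}"
  have f2m: "(\<lambda>w. \<Sum>i<n. if \<bar>X i w\<bar> \<le> a then weight i else 0) \<in> borel_measurable M"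
    using X by (intro borel_measurable_sum measurable_If) auto
  have P2: "prob ?F2 \<le> 1 / 16"
  proof (rule Markov_finite_sum[where I="{..<n}" and c=weight and E="\<lambda>i. {w \<in> space M. \<bar>X i w\<bar> \<le> a}"])
    show "{w \<in> space M. \<bar>X i w\<bar> \<le> a} \<in> events" if "i \<in> {..<n}" for i using X that by auto
    show "(\<Sum>i<n. if \<bar>X i w\<bar> \<le> a then weight i else 0)
        \<le> (\<Sum>i<n. weight i * indicator {w \<in> space M. \<bar>X i w\<bar> \<le> a} w)" if "w \<in> space M" for w
      using that by (intro sum_mono) (auto simp: indicator_def)
    have a0: "0 < a" using d0 by (simp add: a)
    have "(\<Sum>i<n. weight i * prob {w \<in> space M. \<bar>X i w\<bar> \<le> a}) \<le> (\<Sum>i<n. weight i * (18 * a))"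
      using weight_nonneg X F.st p1 p2 a0
      by (intro sum_mono mult_left_mono std_stable_distrD(3)) auto
    also have "\<dots> = real d * (18 * a)" by (simp add: sum_distrib_right[symmetric] sum_weight)
    \<comment> \<open>The level \<open>a\<close> is chosen for this: 18 / 2304 = 1 / 128.\<close>
    also have "\<dots> = 1 / 8 * (1 / 16)" using d0 by (simp add: a)
    finally show "(\<Sum>i<n. weight i * prob {w \<in> space M. \<bar>X i w\<bar> \<le> a}) \<le> 1 / 8 * (1 / 16)" .
  qed (use f2m weight_nonneg in auto)

  let ?F3 = "{w \<in> space M. R' < (\<Sum>k\<in>h ` ?Hv. Z (bucket h k \<inter> ?Lt) w)}"
  have R'0: "0 < R'" using d0 k s by (simp add: R')
  have bLt: "bucket h k \<inter> ?Lt \<subseteq> {..<n}" for k using bF by auto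
  have hHv: "h ` ?Hv \<subseteq> {..<s}" using h by (auto simp: heavy_rows_def)
  have P3: "prob ?F3 \<le> 1 / 8"
  proof -
    have "prob ?F3 \<le> real (card (h ` ?Hv)) / 2 ^ L
        + (\<Sum>k\<in>h ` ?Hv. 16 * ((\<Sum>i\<in>bucket h k \<inter> ?Lt. weight i) + real d / real s)) * (1 + real L) / R'"
      by (intro sum_weak_type_tail Zm[OF bLt] Z0 apos Ztail[OF bLt] R'0) auto
    also have "\<dots> \<le> real s / 2 ^ L + (544 * K * (real d)\<^sup>2 / real s) * (1 + real L) / R'"
    proof (intro add_mono divide_right_mono mult_right_mono)
      have "card (h ` ?Hv) \<le> card {..<s}" using hHv by (intro card_mono) auto
      then show "real (card (h ` ?Hv)) \<le> real s" by simp
      have "(\<Sum>k\<in>h ` ?Hv. \<Sum>i\<in>bucket h k \<inter> ?Lt. weight i)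
          = (\<Sum>k\<in>h ` ?Hv. \<Sum>i\<in>bucket h k \<inter> {i \<in> ?Lt. h i \<in> h ` ?Hv}. weight i)"
        by (intro sum.cong refl) (auto simp: bucket_def)
      also have "\<dots> = (\<Sum>i\<in>{i \<in> ?Lt. h i \<in> h ` ?Hv}. weight i)"
        using LtF by (intro sum_buckets) auto
      also have "\<dots> = (\<Sum>i\<in>?Lt. if \<exists>j\<in>?Hv. h i = h j then weight i else 0)"
        by (subst sum.inter_filter) (auto intro!: sum.cong simp: image_iff)
      also have "\<dots> \<le> 32 * K * (real d)\<^sup>2 / real s" using gh by (simp add: good_hash_def)
      finally have light: "(\<Sum>k\<in>h ` ?Hv. \<Sum>i\<in>bucket h k \<inter> ?Lt. weight i) \<le> 32 * K * (real d)\<^sup>2 / real s" .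
      have "real (card (h ` ?Hv)) \<le> real (card ?Hv)" by (simp add: card_image_le)
      also have "\<dots> \<le> 2 * K * real d" by (rule card_heavy_rows[OF weight_nonneg k sum_weight])
      finally have "real (card (h ` ?Hv)) * (real d / real s) \<le> 2 * K * real d * (real d / real s)"
        by (intro mult_right_mono) auto
      then have "(\<Sum>k\<in>h ` ?Hv. (\<Sum>i\<in>bucket h k \<inter> ?Lt. weight i) + real d / real s)
          \<le> 32 * K * (real d)\<^sup>2 / real s + 2 * K * real d * (real d / real s)"
        using light by (simp add: sum.distrib)
      \<comment> \<open>Here 32 is the light weight in heavy buckets and 2 the padding of at most 2
        K d buckets; 544 = 16 * 34.\<close>
      also have "\<dots> = 34 * K * (real d)\<^sup>2 / real s" by (simp add: power2_eq_square add_divide_distrib[symmetric])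
      finally have "16 * (\<Sum>k\<in>h ` ?Hv. (\<Sum>i\<in>bucket h k \<inter> ?Lt. weight i) + real d / real s)
          \<le> 16 * (34 * K * (real d)\<^sup>2 / real s)"
        by (intro mult_left_mono) auto
      also have "\<dots> = 544 * K * (real d)\<^sup>2 / real s" by simp
      finally show "(\<Sum>k\<in>h ` ?Hv. 16 * ((\<Sum>i\<in>bucket h k \<inter> ?Lt. weight i) + real d / real s))
          \<le> 544 * K * (real d)\<^sup>2 / real s"
        by (simp only: sum_distrib_left)
    qed (use R'0 in auto)
    also have "(544 * K * (real d)\<^sup>2 / real s) * (1 + real L) / R' = 1 / 16"
    proof -
      have quot: "Y / R' = 1 / 16" if "R' = 16 * Y" for Y using that R'0 by auto
      show ?thesis by (rule quot) (simp add: R')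
    qed
    finally show ?thesis using sL by linarith
  qed

  let ?B = "\<lambda>e. {w \<in> space M. sketch_power s h (\<lambda>i. X i w) (grid_point N e) \<le> 1 / 165888}"
  let ?F4 = "\<Union>e\<in>light_grid K N. ?B e"
  have spm: "(\<lambda>w. sketch_power s h (\<lambda>i. X i w) z) \<in> borel_measurable M" for z
  proof -
    have "(\<lambda>w. \<bar>\<Sum>i\<in>bucket h k. X i w * col_comb z i\<bar> powr p) \<in> borel_measurable M" for k
    proof -
      have "X i \<in> borel_measurable M" if "i \<in> bucket h k" for i using that bF X by blast
      then show ?thesis by measurable
    qed
    then show ?thesis unfolding sketch_power_def by measurable
  qed
  have Bm: "?B e \<in> events" for e using spm by measurable
  have fin: "light_grid K N \<subseteq> grid N" "finite (light_grid K N)"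
    using card_grid(2) by (auto simp: light_grid_def)
  have F4m: "?F4 \<in> events" using fin Bm by (intro sets.finite_UN) auto
  have P4: "prob ?F4 \<le> 1 / 16"
  proof -
    have "prob ?F4 \<le> (\<Sum>e\<in>light_grid K N. prob (?B e))"
      using fin Bm by (intro finite_measure_subadditive_finite) auto
    also have "\<dots> \<le> (\<Sum>e\<in>light_grid K N. exp (- K / 165888))"
    proof (intro sum_mono)
      fix e assume e: "e \<in> light_grid K N"
      let ?S = "\<Sum>k<s. min (K * (\<Sum>i\<in>bucket h k. \<bar>col_comb (grid_point N e) i\<bar> powr p)) 1"
      \<comment> \<open>At Laplace parameter \<open>K\<close> a bucket of load 1 / K just reaches
        the cap. The gain K / (16 * 5184) is twice K / 165888, so the threshold 1 / 165888 consumes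
        half of it.\<close>
      have "prob (?B e) \<le> exp (K * (1 / 165888) - ?S / 5184)"
        unfolding sketch_power_def
        by (rule F.stable_block_lower_tail[OF _ _ bF disjoint_buckets]) (use k in auto)
      also have "K / 16 \<le> ?S"
        using e by (intro capped_bucket_mass[OF k h gh]) (auto simp: light_grid_def)
      then have "K * (1 / 165888) - ?S / 5184 \<le> - K / 165888" by simp
      finally show "prob (?B e) \<le> exp (- K / 165888)" by simp
    qed
    also have "\<dots> = real (card (light_grid K N)) * exp (- K / 165888)" by simp
    also have "\<dots> \<le> (2 * real N + 1) ^ d * exp (- K / 165888)"
      unfolding card_grid(1)[symmetric] using fin card_grid(2)
      by (intro mult_right_mono of_nat_mono card_mono) auto
    finally show ?thesis using net by simp
  qed
  have F1m: "?F1 \<in> events" using Zm[OF bF] by measurable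
  have F2m: "?F2 \<in> events" using f2m by measurable
  have F3m: "?F3 \<in> events"
  proof -
    have "Z (bucket h k \<inter> ?Lt) \<in> borel_measurable M" for k using bF by (intro Zm) auto
    then show ?thesis by measurable
  qed
  let ?bad = "?F1 \<union> ?F2 \<union> ?F3 \<union> ?F4"
  have badm: "?bad \<in> events" using F1m F2m F3m F4m by (intro sets.Un)
  have eq: "{w \<in> space M. good_scaling s K N a R R' h (\<lambda>i. X i w)} = space M - ?bad"
    by (auto simp: good_scaling_def Z_def not_less not_le)
  show "{w \<in> space M. good_scaling s K N a R R' h (\<lambda>i. X i w)} \<in> sets M"
    unfolding eq using badm by auto
  have "prob ?bad \<le> 3 / 8"
    using prob_Un4[OF F1m F2m F3m F4m] P1 P2 P3 P4 by linarith
  then show "5 / 8 \<le> measure M {w \<in> space M. good_scaling s K N a R R' h (\<lambda>i. X i w)}"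
    unfolding eq prob_compl[OF badm] by simp
qed

end

section \<open>Existence of a well-conditioned basis\<close>

lemma nonzero_det_right_inverse:
  assumes M: "(M :: real mat) \<in> carrier_mat n n" and det: "det M \<noteq> 0"
  obtains N where "N \<in> carrier_mat n n" "M * N = 1\<^sub>m n" "N * M = 1\<^sub>m n"
proof -
  have "M \<in> Units (ring_mat TYPE(real) n ())" by (rule det_non_zero_imp_unit[OF M det])
  then show ?thesis using that by (auto simp: Units_def ring_mat_def)
qed

lemma scalar_prod_self_eq_0:
  fixes w :: "real Matrix.vec"
  assumes w: "w \<in> carrier_vec n" "w \<bullet> w = 0"
  shows "w = 0\<^sub>v n"
proof -
  have "(\<Sum>i\<in>{0..<n}. w $ i * w $ i) = 0" using w by (simp add: scalar_prod_def)
  then have "\<forall>i\<in>{0..<n}. w $ i * w $ i = 0" by (subst (asm) sum_nonneg_eq_0_iff) auto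
  then show ?thesis using w by (intro eq_vecI) auto
qed

text \<open>Injectivity makes the Gram matrix A^T A invertible, and the left inverse is (A^T A)^-1
  A^T.\<close>

lemma injective_left_inverse:
  assumes A: "(A :: real mat) \<in> carrier_mat n d"
    and inj: "\<And>v. v \<in> carrier_vec d \<Longrightarrow> A *\<^sub>v v = 0\<^sub>v n \<Longrightarrow> v = 0\<^sub>v d"
  obtains B where "B \<in> carrier_mat d n" "B * A = 1\<^sub>m d"
proof -
  let ?G = "transpose_mat A * A"
  have G: "?G \<in> carrier_mat d d" using A by auto
  have "det ?G \<noteq> 0"
  proof
    assume "det ?G = 0"
    then obtain v where v: "v \<in> carrier_vec d" "v \<noteq> 0\<^sub>v d" "?G *\<^sub>v v = 0\<^sub>v d"
      using det_0_iff_vec_prod_zero[OF G] by auto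
    have Av: "A *\<^sub>v v \<in> carrier_vec n" using A v by auto
    have "(A *\<^sub>v v) \<bullet> (A *\<^sub>v v) = (transpose_mat A *\<^sub>v (A *\<^sub>v v)) \<bullet> v"
      by (rule transpose_vec_mult_scalar[OF A v(1) Av, symmetric])
    also have "transpose_mat A *\<^sub>v (A *\<^sub>v v) = ?G *\<^sub>v v"
      by (rule assoc_mult_mat_vec[symmetric]) (use A v in auto)
    also have "(?G *\<^sub>v v) \<bullet> v = 0" using v by simp
    finally have "A *\<^sub>v v = 0\<^sub>v n" by (rule scalar_prod_self_eq_0[OF Av])
    then show False using inj v by simp
  qed
  then obtain N where N: "N \<in> carrier_mat d d" "N * ?G = 1\<^sub>m d"
    using nonzero_det_right_inverse[OF G] by metis
  show ?thesis
  proof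
    show "N * transpose_mat A \<in> carrier_mat d n" using N A by auto
    show "N * transpose_mat A * A = 1\<^sub>m d" using N A by (simp add: assoc_mult_mat[of _ d d _ n _ d])
  qed
qed

section \<open>A basis of maximal determinant\<close>

lemma continuous_on_coordinate [continuous_intros]:
  "continuous_on S (\<lambda>T :: 'a \<Rightarrow> real. T x)"
  by (rule continuous_on_subset[OF continuous_on_product_coordinates]) auto

text \<open>Tychonoff's theorem. Matrices are encoded as functions on all pairs of indices; a bound
  \<open>R x = 0\<close> outside the d by d square makes the relevant set compact in the product
  topology.\<close>

lemma compact_box:
  fixes R :: "'a \<Rightarrow> real"
  shows "compact {T. \<forall>x. \<bar>T x\<bar> \<le> R x}"
proof -
  have "compactin (product_topology (\<lambda>_. euclidean) UNIV) (PiE UNIV (\<lambda>x. {- R x..R x}))"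
    by (subst compactin_PiE) auto
  then have "compact (PiE UNIV (\<lambda>x. {- R x..R x}))"
    by (simp add: euclidean_product_topology)
  also have "PiE UNIV (\<lambda>x. {- R x..R x}) = {T. \<forall>x. \<bar>T x\<bar> \<le> R x}"
    by (auto simp: PiE_def Pi_def abs_le_iff) (smt (verit))+
  finally show ?thesis .
qed

definition row_lp_size :: "real \<Rightarrow> nat \<Rightarrow> nat \<Rightarrow> (nat \<Rightarrow> nat \<Rightarrow> real) \<Rightarrow> real" where
  "row_lp_size p n d u = (\<Sum>i<n. (\<Sum>j<d. (u i j)\<^sup>2) powr (p/2))"

text \<open>The matrix \<open>A * transpose T\<close>, with \<open>T\<close> given by its entries.\<close>
definition change_basis :: "nat \<Rightarrow> real mat \<Rightarrow> (nat \<times> nat \<Rightarrow> real) \<Rightarrow> nat \<Rightarrow> nat \<Rightarrow> real" where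
  "change_basis d A T i j = (\<Sum>l<d. A $$ (i, l) * T (j, l))"

lemma continuous_on_row_lp_size:
  assumes "0 < p"
  shows "continuous_on UNIV (\<lambda>T. row_lp_size p n d (change_basis d A T))"
  unfolding row_lp_size_def change_basis_def
  using assms by (intro continuous_intros continuous_on_powr') (auto intro: sum_nonneg)

lemma continuous_on_det:
  "continuous_on UNIV (\<lambda>T. det (mat d d T) :: real)"
proof -
  have "det (mat d d T) = (\<Sum>\<pi> | \<pi> permutes {0..<d}. signof \<pi> * (\<Prod>i=0..<d. T (i, \<pi> i)))"
    for T :: "nat \<times> nat \<Rightarrow> real"
  proof -
    have "(\<Prod>i=0..<d. mat d d T $$ (i, \<pi> i)) = (\<Prod>i=0..<d. T (i, \<pi> i))"
      if "\<pi> permutes {0..<d}" for \<pi>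
      using permutes_in_image[OF that] by (intro prod.cong) auto
    then show ?thesis by (subst det_def'[of _ d]) auto
  qed
  then show ?thesis by (simp only:) (intro continuous_intros)
qed

lemma row_lp_size_scale:
  assumes "0 < p"
  shows "row_lp_size p n d (change_basis d A (\<lambda>x. c * T x)) = \<bar>c\<bar> powr p * row_lp_size p n d (change_basis d A T)"
proof -
  have "(\<Sum>j<d. (change_basis d A (\<lambda>x. c * T x) i j)\<^sup>2) powr (p/2)
      = \<bar>c\<bar> powr p * (\<Sum>j<d. (change_basis d A T i j)\<^sup>2) powr (p/2)" for i
  proof -
    have "change_basis d A (\<lambda>x. c * T x) i j = c * change_basis d A T i j" for j
      by (simp add: change_basis_def sum_distrib_left mult_ac)
    then have "(\<Sum>j<d. (change_basis d A (\<lambda>x. c * T x) i j)\<^sup>2) = c\<^sup>2 * (\<Sum>j<d. (change_basis d A T i j)\<^sup>2)"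
      by (simp add: power_mult_distrib sum_distrib_left)
    moreover have "(c\<^sup>2) powr (p/2) = \<bar>c\<bar> powr p"
      by (rule square_powr_half)
    ultimately show ?thesis by (simp add: powr_mult sum_nonneg)
  qed
  then show ?thesis by (simp add: row_lp_size_def sum_distrib_left)
qed

text \<open>The maximizer of the determinant under the constraint \<open>row_lp_size \<le> d\<close>; by homogeneity the
  constraint becomes the factor on the right.\<close>
lemma max_det_basis:
  assumes A: "A \<in> carrier_mat n d" and full: "B \<in> carrier_mat d n" "B * A = 1\<^sub>m d"
    and p: "0 < p" and d: "0 < d"
  obtains T where "det (mat d d T) \<noteq> (0::real)"
    "row_lp_size p n d (change_basis d A T) = real d"
    "\<And>T'. \<bar>det (mat d d T')\<bar> \<le> \<bar>det (mat d d T)\<bar> * (row_lp_size p n d (change_basis d A T') / real d) powr (real d / p)"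
proof -
  define S where "S = {..<d} \<times> {..<d}"
  define f where "f T = row_lp_size p n d (change_basis d A T)" for T
  \<comment> \<open>Neither \<open>f\<close> nor the determinant sees entries outside the square, so
    they can be set to 0 to enter the compact box.\<close>
  define restr where "restr T = (\<lambda>x. if x \<in> S then T x else 0)" for T :: "nat \<times> nat \<Rightarrow> real"
  have f_restr: "f (restr T) = f T" for T
    unfolding f_def row_lp_size_def change_basis_def restr_def S_def
    by (intro sum.cong refl arg_cong2[where f="(powr)"] arg_cong[where f="\<lambda>x. x\<^sup>2"]) auto
  have det_restr: "det (mat d d (restr T)) = det (mat d d T)" for T
    by (rule arg_cong[where f=det]) (auto simp: restr_def S_def)
  have f_nonneg: "0 \<le> f T" for T by (simp add: f_def row_lp_size_def sum_nonneg)
  define b where "b = (\<Sum>l<d. \<Sum>i<n. \<bar>B $$ (l, i)\<bar>)"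
  \<comment> \<open>Coercivity: multiplying A T^T by the left inverse \<open>B\<close> returns T^T,
    so the entries of T are controlled by the row sizes.\<close>
  have entry: "\<bar>T (j, l)\<bar> \<le> b * f T powr (1/p)" if "j < d" "l < d" for T j l
  proof -
    have BA: "(\<Sum>i<n. B $$ (l, i) * A $$ (i, l')) = (if l = l' then 1 else 0)" if "l' < d" for l'
    proof -
      have "(B * A) $$ (l, l') = (\<Sum>i<n. B $$ (l, i) * A $$ (i, l'))"
        using A full(1) \<open>l < d\<close> that by (auto simp: scalar_prod_def atLeast0LessThan intro!: sum.cong)
      then show ?thesis using full \<open>l < d\<close> that by simp
    qed
    have "(\<Sum>i<n. B $$ (l, i) * change_basis d A T i j) = (\<Sum>l'<d. (\<Sum>i<n. B $$ (l, i) * A $$ (i, l')) * T (j, l'))"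
      unfolding change_basis_def sum_distrib_left sum_distrib_right
      by (subst sum.swap) (simp add: mult_ac)
    also have "\<dots> = (\<Sum>l'<d. if l' = l then T (j, l') else 0)"
      by (intro sum.cong refl) (auto simp: BA)
    also have "\<dots> = T (j, l)" using that by simp
    finally have "\<bar>T (j, l)\<bar> \<le> (\<Sum>i<n. \<bar>B $$ (l, i)\<bar> * \<bar>change_basis d A T i j\<bar>)"
      by (metis (no_types, lifting) abs_mult sum.cong sum_abs)
    also have "\<dots> \<le> (\<Sum>i<n. \<bar>B $$ (l, i)\<bar> * f T powr (1/p))"
    proof (intro sum_mono mult_left_mono)
      fix i assume i: "i \<in> {..<n}"
      let ?r = "\<Sum>j<d. (change_basis d A T i j)\<^sup>2"
      have r0: "0 \<le> ?r" by (simp add: sum_nonneg)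
      have "(change_basis d A T i j)\<^sup>2 \<le> ?r"
        using that by (intro member_le_sum) auto
      then have "\<bar>change_basis d A T i j\<bar> \<le> sqrt ?r" by (simp add: real_le_rsqrt)
      also have "\<dots> = (?r powr (p/2)) powr (1/p)"
        using p r0 by (simp add: powr_powr powr_half_sqrt)
      also have "\<dots> \<le> f T powr (1/p)"
        unfolding f_def row_lp_size_def using p i
        by (intro powr_mono2 member_le_sum) auto
      finally show "\<bar>change_basis d A T i j\<bar> \<le> f T powr (1/p)" .
    qed auto
    also have "\<dots> = (\<Sum>i<n. \<bar>B $$ (l, i)\<bar>) * f T powr (1/p)" by (simp add: sum_distrib_right)
    also have "\<dots> \<le> b * f T powr (1/p)"
      unfolding b_def using that by (intro mult_right_mono member_le_sum) (auto simp: sum_nonneg)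
    finally show ?thesis .
  qed
  have f_zero: "det (mat d d T) = (0::real)" if "f T = 0" for T
  proof -
    have "mat d d T = 0\<^sub>m d d" using entry[of _ _ T] that by (intro eq_matI) auto
    then show ?thesis using d by simp
  qed
  define R where "R x = (if x \<in> S then b * real d powr (1/p) else 0)" for x
  define K where "K = {T. \<forall>x. \<bar>T x\<bar> \<le> R x} \<inter> {T. f T \<le> real d}"
  have "closed {T. f T \<le> real d}"
    using continuous_on_row_lp_size[OF p] unfolding f_def by (intro closed_Collect_le continuous_on_const) auto
  then have cK: "compact K" unfolding K_def by (intro compact_Int_closed compact_box)
  have in_K: "restr T \<in> K" if "f T \<le> real d" for T
  proof -
    have "\<bar>T (j, l)\<bar> \<le> b * real d powr (1/p)" if "j < d" "l < d" for j l
    proof -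
      have "b * f T powr (1/p) \<le> b * real d powr (1/p)"
        using p f_nonneg \<open>f T \<le> real d\<close> by (intro mult_left_mono powr_mono2) (auto simp: b_def sum_nonneg)
      then show ?thesis using entry[OF that, of T] by linarith
    qed
    then show ?thesis using that f_restr[of T] by (auto simp: K_def R_def restr_def S_def)
  qed
  define zero :: "nat \<times> nat \<Rightarrow> real" where "zero = (\<lambda>_. 0)"
  have "f zero = 0" by (simp add: f_def row_lp_size_def change_basis_def zero_def)
  then have "K \<noteq> {}" using in_K[of zero] by auto
  moreover have "continuous_on K (\<lambda>T. \<bar>det (mat d d T)\<bar>)"
    by (intro continuous_intros continuous_on_subset[OF continuous_on_det]) auto
  ultimately obtain T where T: "T \<in> K" "\<And>T'. T' \<in> K \<Longrightarrow> \<bar>det (mat d d T')\<bar> \<le> \<bar>det (mat d d T)\<bar>"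
    using continuous_attains_sup[OF cK] by metis
  have max: "\<bar>det (mat d d T')\<bar> \<le> \<bar>det (mat d d T)\<bar> * (f T' / real d) powr (real d / p)" for T'
  proof (cases "f T' = 0")
    case True
    then show ?thesis using f_zero by simp
  next
    case False
    then have pos: "0 < f T'" using f_nonneg[of T'] by simp
    define c where "c = (real d / f T') powr (1/p)"
    have c: "0 < c" "c powr p = real d / f T'" using pos d p by (auto simp: c_def powr_powr)
    have "f (\<lambda>x. c * T' x) = real d"
      using c pos p unfolding f_def by (simp add: row_lp_size_scale)
    then have "\<bar>det (mat d d (\<lambda>x. c * T' x))\<bar> \<le> \<bar>det (mat d d T)\<bar>"
      using T(2)[OF in_K, of "\<lambda>x. c * T' x"] det_restr by simp
    moreover have "mat d d (\<lambda>x. c * T' x) = c \<cdot>\<^sub>m mat d d T'" by (intro eq_matI) auto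
    ultimately have "c ^ d * \<bar>det (mat d d T')\<bar> \<le> \<bar>det (mat d d T)\<bar>"
      using c by (simp add: abs_mult)
    moreover have "c ^ d * (f T' / real d) powr (real d / p) = 1"
    proof -
      have "c ^ d = c powr real d" using c by (simp add: powr_realpow)
      also have "\<dots> = (real d / f T') powr (real d / p)" by (simp add: c_def powr_powr)
      finally show ?thesis using pos d by (simp add: powr_mult[symmetric])
    qed
    moreover have "0 \<le> (f T' / real d) powr (real d / p)" by simp
    ultimately show ?thesis
      using mult_right_mono[of "c ^ d * \<bar>det (mat d d T')\<bar>" "\<bar>det (mat d d T)\<bar>" "(f T' / real d) powr (real d / p)"]
      by (simp add: mult_ac) (metis (no_types, lifting) mult.assoc mult.commute mult_1)
  qed
  have det: "det (mat d d T) \<noteq> 0"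
  proof
    assume "det (mat d d T) = 0"
    \<comment> \<open>The identity matrix is a competitor; it would inherit determinant 0.\<close>
    then have "det (mat d d (\<lambda>(i, j). if i = j then 1 else 0)) = (0::real)" using max by fastforce
    moreover have "mat d d (\<lambda>(i, j). if i = j then 1 else 0) = (1\<^sub>m d :: real mat)" by (intro eq_matI) auto
    ultimately show False by simp
  qed
  have "f T = real d"
  proof (rule antisym)
    show "f T \<le> real d" using T by (simp add: K_def)
    \<comment> \<open>The maximizer competes with itself: slack in the constraint would allow
      scaling it up.\<close>
    have "1 \<le> (f T / real d) powr (real d / p)" using max[of T] det by simp
    then have "\<not> f T / real d < 1"
      using powr_less_mono2[of "real d / p" "f T / real d" 1] f_nonneg[of T] d p by auto
    then show "real d \<le> f T" using d by (simp add: field_simps)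
  qed
  then show ?thesis using that[OF det _ max[unfolded f_def]] by (simp add: f_def)
qed

text \<open>One family of perturbations for both kinds of test: for \<open>j = k\<close> it scales a
  row by 1 + e, otherwise it is a shear, which leaves the determinant unchanged.\<close>

definition row_addition :: "nat \<Rightarrow> nat \<Rightarrow> real \<Rightarrow> (nat \<times> nat \<Rightarrow> real) \<Rightarrow> nat \<times> nat \<Rightarrow> real" where
  "row_addition j k e T = (\<lambda>x. T x + (if fst x = j then e * T (k, snd x) else 0))"

lemma det_row_addition:
  assumes "j < d" "k < d"
  shows "det (mat d d (row_addition j k e T)) = (if j = k then 1 + e else 1) * det (mat d d T)"
proof (cases "j = k")
  case True
  have "mat d d (row_addition j k e T) = multrow j (1 + e) (mat d d T)"
    using assms True by (intro eq_matI) (auto simp: row_addition_def algebra_simps)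
  then show ?thesis using assms True by (simp add: det_multrow[of _ d])
next
  case False
  have "mat d d (row_addition j k e T) = addrow e j k (mat d d T)"
    using assms False by (intro eq_matI) (auto simp: row_addition_def)
  then show ?thesis using assms False by (simp add: det_addrow[of k d j])
qed

lemma change_basis_row_addition:
  "change_basis d A (row_addition j k e T) i l
    = change_basis d A T i l + (if l = j then e * change_basis d A T i k else 0)"
  by (cases "l = j") (simp_all add: change_basis_def row_addition_def distrib_left sum.distrib sum_distrib_left mult_ac)

lemma row_lp_size_row_addition_deriv:
  fixes u :: "nat \<Rightarrow> nat \<Rightarrow> real"
  assumes j: "j < d" and k: "k < d" and p: "0 < p"
  shows "((\<lambda>e. row_lp_size p n d (\<lambda>i l. u i l + (if l = j then e * u i k else 0))) has_field_derivative
    p * (\<Sum>i<n. (\<Sum>l<d. (u i l)\<^sup>2) powr (p/2 - 1) * u i j * u i k)) (at 0)"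
proof -
  define r where "r i = (\<Sum>l<d. (u i l)\<^sup>2)" for i
  have rsum: "(\<Sum>l<d. (u i l + (if l = j then e * u i k else 0))\<^sup>2) = r i + 2 * e * u i j * u i k + e\<^sup>2 * (u i k)\<^sup>2" for i e
  proof -
    have "(\<Sum>l<d. (u i l + (if l = j then e * u i k else 0))\<^sup>2)
        = (\<Sum>l<d. (u i l)\<^sup>2 + (if l = j then 2 * e * u i j * u i k + e\<^sup>2 * (u i k)\<^sup>2 else 0))"
      by (intro sum.cong refl) (auto simp: power2_eq_square algebra_simps)
    then show ?thesis using j by (simp add: sum.distrib r_def)
  qed
  have "((\<lambda>e. (r i + 2 * e * u i j * u i k + e\<^sup>2 * (u i k)\<^sup>2) powr (p/2)) has_field_derivative
    p * (r i powr (p/2 - 1) * u i j * u i k)) (at 0)" for i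
  \<comment> \<open>The chain rule does not apply to \<open>powr\<close> at 0, but a zero row stays
    zero under the perturbation.\<close>
  proof (cases "r i = 0")
    case True
    then have "u i l = 0" if "l < d" for l
      using that by (auto simp: r_def sum_nonneg_eq_0_iff)
    then show ?thesis using True j k by simp
  next
    case False
    moreover have "0 \<le> r i" by (simp add: r_def sum_nonneg)
    ultimately have "0 < r i" by simp
    then show ?thesis
      by (auto intro!: derivative_eq_intros simp: powr_diff)
  qed
  then have "((\<lambda>e. \<Sum>i<n. (r i + 2 * e * u i j * u i k + e\<^sup>2 * (u i k)\<^sup>2) powr (p/2)) has_field_derivative
    (\<Sum>i<n. p * (r i powr (p/2 - 1) * u i j * u i k))) (at 0)"
    by (intro DERIV_sum)
  then show ?thesis unfolding row_lp_size_def rsum r_def[symmetric] by (simp add: sum_distrib_left)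
qed

text \<open>The first-order condition at the maximizer. A shear keeps the determinant, so the size
  has a minimum at e = 0 and its derivative vanishes. Scaling a row multiplies the determinant by 1
  + e, so the size is at least d (1 + e)^(p/d) with equality at 0, and the derivatives agree; that
  of the bound is p.\<close>

lemma lewis_isotropy:
  assumes T: "det (mat d d T) \<noteq> (0::real)" and size: "row_lp_size p n d (change_basis d A T) = real d"
    and max: "\<And>T'. \<bar>det (mat d d T')\<bar> \<le> \<bar>det (mat d d T)\<bar> * (row_lp_size p n d (change_basis d A T') / real d) powr (real d / p)"
    and j: "j < d" and k: "k < d" and p: "0 < p"
  defines "u \<equiv> change_basis d A T"
  shows "(\<Sum>i<n. (\<Sum>l<d. (u i l)\<^sup>2) powr (p/2 - 1) * u i j * u i k) = (if j = k then 1 else 0)"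
proof -
  define F where "F e = row_lp_size p n d (\<lambda>i l. u i l + (if l = j then e * u i k else 0))" for e
  let ?G = "\<Sum>i<n. (\<Sum>l<d. (u i l)\<^sup>2) powr (p/2 - 1) * u i j * u i k"
  have F': "(F has_field_derivative p * ?G) (at 0)"
    unfolding F_def by (rule row_lp_size_row_addition_deriv[OF j k p])
  have F0: "F 0 = real d" using size by (simp add: F_def u_def cong: if_cong)
  have Fnn: "0 \<le> F e" for e by (simp add: F_def row_lp_size_def sum_nonneg)
  have F_eq: "F e = row_lp_size p n d (change_basis d A (row_addition j k e T))" for e
    unfolding F_def u_def by (rule arg_cong[where f="row_lp_size p n d"], intro ext, simp only: change_basis_row_addition)
  have F_ge: "\<bar>if j = k then 1 + e else 1\<bar> \<le> (F e / real d) powr (real d / p)" for e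
    using max[of "row_addition j k e T"] T j k unfolding det_row_addition[OF j k] F_eq abs_mult
    by (simp add: mult.commute)
  have root: "real d * x powr (p / real d) \<le> F e" if "0 < x" "x \<le> (F e / real d) powr (real d / p)" for x e
  proof -
    have "x powr (p / real d) \<le> ((F e / real d) powr (real d / p)) powr (p / real d)"
      using that p by (intro powr_mono2) auto
    also have "\<dots> = F e / real d" using p j Fnn[of e] by (simp add: powr_powr)
    finally show ?thesis using j by (simp add: field_simps)
  qed
  show ?thesis
  proof (cases "j = k")
    case False
    have "F 0 \<le> F e" for e
      using root[of 1 e] F_ge[of e] False F0 by simp
    then have "p * ?G = 0" using DERIV_local_min[OF F', of 1] by simp
    then show ?thesis using False p by simp
  next
    case True
    define H where "H e = F e - real d * (1 + e) powr (p / real d)" for e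
    have "((\<lambda>e. real d * (1 + e) powr (p / real d)) has_field_derivative p) (at 0)"
      using j by (auto intro!: derivative_eq_intros)
    then have "(H has_field_derivative p * ?G - p) (at 0)"
      unfolding H_def by (intro DERIV_diff F')
    \<comment> \<open>For |e| < 1 the factor 1 + e is positive, so the absolute value in
      \<open>F_ge\<close> disappears.\<close>
    moreover have "H 0 \<le> H e" if "\<bar>0 - e\<bar> < 1" for e
      using root[of "1 + e" e] F_ge[of e] True F0 that by (simp add: H_def abs_less_iff)
    ultimately have "p * ?G - p = 0" by (intro DERIV_local_min[of H _ 0 1]) auto
    then show ?thesis using True p by (simp add: algebra_simps)
  qed
qed

text \<open>Isotropy expresses |z|^2 as the sum of r^(p/2 - 1) y^2 over the rows. By Cauchy-Schwarz
  y^2 \<le> r |z|^2; raised to the power 1 - p/2, positive as p < 2, it replaces all of y^2 but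
  |y|^p and cancels the power of r.\<close>

lemma isotropic_norm_bound:
  fixes u :: "nat \<Rightarrow> nat \<Rightarrow> real"
  assumes p: "0 < p" "p < 2"
    and iso: "\<And>j k. j < d \<Longrightarrow> k < d \<Longrightarrow>
      (\<Sum>i<n. (\<Sum>l<d. (u i l)\<^sup>2) powr (p/2 - 1) * u i j * u i k) = (if j = k then 1 else 0)"
  shows "(\<Sum>j<d. (z j)\<^sup>2) powr (p/2) \<le> (\<Sum>i<n. \<bar>\<Sum>j<d. u i j * z j\<bar> powr p)"
proof -
  define r where "r i = (\<Sum>l<d. (u i l)\<^sup>2)" for i
  define y where "y i = (\<Sum>j<d. u i j * z j)" for i
  define N where "N = (\<Sum>j<d. (z j)\<^sup>2)"
  have iso': "(\<Sum>i<n. r i powr (p/2 - 1) * u i j * u i k) = (if j = k then 1 else 0)" if "j < d" "k < d" for j k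
    using iso[OF that] by (simp add: r_def)
  have N: "0 \<le> N" and r: "0 \<le> r i" for i by (auto simp: N_def r_def sum_nonneg)
  have "N = (\<Sum>j<d. \<Sum>k<d. z j * z k * (\<Sum>i<n. r i powr (p/2 - 1) * u i j * u i k))"
  proof -
    have "(\<Sum>k<d. z j * z k * (\<Sum>i<n. r i powr (p/2 - 1) * u i j * u i k)) = (z j)\<^sup>2" if "j < d" for j
    proof -
      have "(\<Sum>k<d. z j * z k * (\<Sum>i<n. r i powr (p/2 - 1) * u i j * u i k)) = (\<Sum>k<d. if k = j then (z j)\<^sup>2 else 0)"
        using that by (intro sum.cong refl) (auto simp: iso' power2_eq_square)
      then show ?thesis using that by simp
    qed
    then show ?thesis by (simp add: N_def)
  qed
  also have "\<dots> = (\<Sum>j<d. \<Sum>k<d. \<Sum>i<n. r i powr (p/2 - 1) * ((u i j * z j) * (u i k * z k)))"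
    by (simp add: sum_distrib_left mult_ac)
  also have "\<dots> = (\<Sum>j<d. \<Sum>i<n. \<Sum>k<d. r i powr (p/2 - 1) * ((u i j * z j) * (u i k * z k)))"
    by (intro sum.cong refl sum.swap)
  also have "\<dots> = (\<Sum>i<n. \<Sum>j<d. \<Sum>k<d. r i powr (p/2 - 1) * ((u i j * z j) * (u i k * z k)))"
    by (rule sum.swap)
  also have "\<dots> = (\<Sum>i<n. r i powr (p/2 - 1) * (y i)\<^sup>2)"
    unfolding y_def power2_eq_square sum_product by (simp add: sum_distrib_left)
  also have "\<dots> \<le> (\<Sum>i<n. N powr (1 - p/2) * \<bar>y i\<bar> powr p)"
  proof (intro sum_mono)
    fix i
    have CS: "(y i)\<^sup>2 \<le> r i * N" unfolding y_def r_def N_def by (rule Cauchy_Schwarz_ineq_sum)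
    show "r i powr (p/2 - 1) * (y i)\<^sup>2 \<le> N powr (1 - p/2) * \<bar>y i\<bar> powr p"
    proof (cases "y i = 0")
      case False
      then have "0 < (y i)\<^sup>2" by simp
      then have "0 < r i * N" using CS by linarith
      then have pos: "0 < r i" "0 < N" using r[of i] N by (auto simp: zero_less_mult_iff)
      have y2: "(y i)\<^sup>2 = ((y i)\<^sup>2) powr (1 - p/2) * ((y i)\<^sup>2) powr (p/2)"
        using False by (simp add: powr_add[symmetric])
      have y2p: "((y i)\<^sup>2) powr (p/2) = \<bar>y i\<bar> powr p"
        by (rule square_powr_half)
      have "((y i)\<^sup>2) powr (1 - p/2) \<le> (r i * N) powr (1 - p/2)"
        using CS p by (intro powr_mono2) auto
      also have "\<dots> = r i powr (1 - p/2) * N powr (1 - p/2)"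
        using pos by (simp add: powr_mult)
      finally have le: "((y i)\<^sup>2) powr (1 - p/2) \<le> r i powr (1 - p/2) * N powr (1 - p/2)" .
      have rr: "r i powr (p/2 - 1) * r i powr (1 - p/2) = 1"
        using pos by (simp add: powr_add[symmetric])
      have "r i powr (p/2 - 1) * (y i)\<^sup>2 = r i powr (p/2 - 1) * (((y i)\<^sup>2) powr (1 - p/2) * \<bar>y i\<bar> powr p)"
        by (simp only: y2p[symmetric] y2[symmetric])
      also have "\<dots> \<le> r i powr (p/2 - 1) * ((r i powr (1 - p/2) * N powr (1 - p/2)) * \<bar>y i\<bar> powr p)"
        by (intro mult_left_mono mult_right_mono le) auto
      also have "\<dots> = (r i powr (p/2 - 1) * r i powr (1 - p/2)) * (N powr (1 - p/2) * \<bar>y i\<bar> powr p)"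
        by (simp only: mult_ac)
      also have "\<dots> = N powr (1 - p/2) * \<bar>y i\<bar> powr p" by (simp only: rr mult_1)
      finally show ?thesis .
    qed (use p in auto)
  qed
  finally have main: "N \<le> N powr (1 - p/2) * (\<Sum>i<n. \<bar>y i\<bar> powr p)" by (simp add: sum_distrib_left)
  have "N powr (p/2) \<le> (\<Sum>i<n. \<bar>y i\<bar> powr p)"
  proof (cases "N = 0")
    case True
    then show ?thesis by (simp add: sum_nonneg)
  next
    case False
    then have "0 < N" using N by simp
    then have "N powr (1 - p/2) * N powr (p/2) \<le> N powr (1 - p/2) * (\<Sum>i<n. \<bar>y i\<bar> powr p)"
      using main by (simp add: powr_add[symmetric])
    then show ?thesis using \<open>0 < N\<close> by simp
  qed
  then show ?thesis by (simp add: N_def y_def)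
qed

text \<open>Lewis's change of density.\<close>
lemma lewis_basis:
  assumes A: "A \<in> carrier_mat n d"
    and inj: "\<And>v. v \<in> carrier_vec d \<Longrightarrow> A *\<^sub>v v = 0\<^sub>v n \<Longrightarrow> v = 0\<^sub>v d"
    and p: "0 < p" "p < 2" and d: "0 < d"
  obtains u :: "nat \<Rightarrow> nat \<Rightarrow> real" where
    "\<And>x. x \<in> carrier_vec d \<Longrightarrow> \<exists>z. \<forall>i<n. (A *\<^sub>v x) $ i = (\<Sum>j<d. u i j * z j)"
    "(\<Sum>i<n. (\<Sum>j<d. (u i j)\<^sup>2) powr (p/2)) = real d"
    "\<And>z. (\<Sum>j<d. (z j)\<^sup>2) powr (p/2) \<le> (\<Sum>i<n. \<bar>\<Sum>j<d. u i j * z j\<bar> powr p)"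
proof -
  obtain B where B: "B \<in> carrier_mat d n" "B * A = 1\<^sub>m d"
    using injective_left_inverse[OF A inj] by metis
  obtain T where T: "det (mat d d T) \<noteq> (0::real)"
    "row_lp_size p n d (change_basis d A T) = real d"
    "\<And>T'. \<bar>det (mat d d T')\<bar> \<le> \<bar>det (mat d d T)\<bar> * (row_lp_size p n d (change_basis d A T') / real d) powr (real d / p)"
    using max_det_basis[OF A B p(1) d] by metis
  let ?u = "change_basis d A T"
  show ?thesis
  proof (rule that[of ?u])
    show "(\<Sum>i<n. (\<Sum>j<d. (?u i j)\<^sup>2) powr (p/2)) = real d"
      using T(2) by (simp add: row_lp_size_def)
    show "(\<Sum>j<d. (z j)\<^sup>2) powr (p/2) \<le> (\<Sum>i<n. \<bar>\<Sum>j<d. ?u i j * z j\<bar> powr p)" for z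
      using lewis_isotropy[OF T _ _ p(1)] by (intro isotropic_norm_bound p) auto
    fix x :: "real Matrix.vec" assume x: "x \<in> carrier_vec d"
    let ?M = "transpose_mat (mat d d T)"
    have M: "?M \<in> carrier_mat d d" by auto
    have "det ?M \<noteq> 0" using T(1) by (subst det_transpose[of _ d]) auto
    then obtain N where N: "N \<in> carrier_mat d d" "?M * N = 1\<^sub>m d"
      using nonzero_det_right_inverse[OF M] by metis
    \<comment> \<open>Since T^T v = x, the vector A x equals A T^T v, and v gives its coordinates in
      the new basis.\<close>
    define v where "v = N *\<^sub>v x"
    have v: "v \<in> carrier_vec d" using N x by (auto simp: v_def)
    have "?M *\<^sub>v v = x" unfolding v_def
      by (subst assoc_mult_mat_vec[OF M N(1) x, symmetric]) (use N x in simp)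
    then have xl: "x $ l = (\<Sum>j<d. T (j, l) * v $ j)" if "l < d" for l
      using that v M arg_cong[of _ _ "\<lambda>y. y $ l"] by (auto simp: scalar_prod_def atLeast0LessThan)
    have "(A *\<^sub>v x) $ i = (\<Sum>j<d. ?u i j * v $ j)" if "i < n" for i
    proof -
      have "(A *\<^sub>v x) $ i = (\<Sum>l<d. A $$ (i, l) * x $ l)"
        using A x that by (auto simp: scalar_prod_def atLeast0LessThan intro!: sum.cong)
      also have "\<dots> = (\<Sum>l<d. \<Sum>j<d. A $$ (i, l) * T (j, l) * v $ j)"
        by (intro sum.cong refl) (simp add: xl sum_distrib_left mult_ac)
      also have "\<dots> = (\<Sum>j<d. ?u i j * v $ j)"
        unfolding change_basis_def sum_distrib_right by (rule sum.swap)
      finally show ?thesis .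
    qed
    then show "\<exists>z. \<forall>i<n. (A *\<^sub>v x) $ i = (\<Sum>j<d. ?u i j * z j)" by blast
  qed
qed

section \<open>The sketching program\<close>

text \<open>Registers 0, 1 and 3 hold \<open>n\<close>, \<open>d\<close> and the number \<open>m\<close> of listed entries, register 5 holds \<open>2 * m\<close> and
  register 6 the index of the current entry; instructions 2 to 21 form the loop.\<close>
definition sketch_program :: "instr list" where
  "sketch_program =
    [WConst 4 1,
     WAdd 5 3 3,
     JumpWLess 6 3 4,
     Jump 22,
     WLoad 7 6,
     WAdd 8 7 5,
     WLoad 8 8,
     WMul 8 8 1,
     WAdd 8 8 3,
     WAdd 8 8 0,
     WAdd 9 6 3,
     WLoad 9 9,
     WAdd 8 8 9,
     WAdd 7 7 3,
     RLoad 0 6,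
     RLoad 1 7,
     RMul 0 0 1,
     RLoad 1 8,
     RAdd 0 0 1,
     RStore 8 0,
     WAdd 6 6 4,
     Jump 2]"

lemma run_0: "run w P 0 S = S"
  by (simp add: run_def)

lemma run_Suc: "run w P (Suc t) S = run w P t (step w P S)"
  by (simp add: run_def funpow_swap1)

lemma run_add: "run w P (t + t') S = run w P t' (run w P t S)"
  by (simp add: run_def funpow_add add.commute[of t])

lemma length_sketch_program: "length sketch_program = 22"
  by (simp add: sketch_program_def)

lemma sketch_program_nth:
  "sketch_program ! 0 = WConst 4 1"
  "sketch_program ! (Suc 0) = WAdd 5 3 3"
  "sketch_program ! 2 = JumpWLess 6 3 4"
  "sketch_program ! 3 = Jump 22"
  "sketch_program ! 4 = WLoad 7 6"
  "sketch_program ! 5 = WAdd 8 7 5"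
  "sketch_program ! 6 = WLoad 8 8"
  "sketch_program ! 7 = WMul 8 8 1"
  "sketch_program ! 8 = WAdd 8 8 3"
  "sketch_program ! 9 = WAdd 8 8 0"
  "sketch_program ! 10 = WAdd 9 6 3"
  "sketch_program ! 11 = WLoad 9 9"
  "sketch_program ! 12 = WAdd 8 8 9"
  "sketch_program ! 13 = WAdd 7 7 3"
  "sketch_program ! 14 = RLoad 0 6"
  "sketch_program ! 15 = RLoad 1 7"
  "sketch_program ! 16 = RMul 0 0 1"
  "sketch_program ! 17 = RLoad 1 8"
  "sketch_program ! 18 = RAdd 0 0 1"
  "sketch_program ! 19 = RStore 8 0"
  "sketch_program ! 20 = WAdd 6 6 4"
  "sketch_program ! 21 = Jump 2"
  by (simp_all add: sketch_program_def)

lemma step_sketch_program: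
  assumes "l < 22"
  shows "step w sketch_program \<lparr>pc = l, wreg = R, rreg = Q, wmem = W, rmem = M\<rparr>
    = exec_instr w (sketch_program ! l) \<lparr>pc = l, wreg = R, rreg = Q, wmem = W, rmem = M\<rparr>"
  using assms by (simp add: step_def halted_def length_sketch_program)

text \<open>The bounds exclude wrap-around for every word the iteration forms, so the reductions
  modulo 2^w vanish. The 19 steps are the successful test and instructions 4 to 21.\<close>

lemma sketch_program_loop_body:
  assumes "R 0 = n" "R 1 = d" "R 3 = m" "R 4 = 1" "R 5 = 2 * m" "R 6 = i" "i < m"
    and "W i = r" "W (r + 2 * m) = k" "W (i + m) = j"
    and "r + 2 * m < 2 ^ w" "k * d + m + n + j < 2 ^ w" "k < 2 ^ w" "i + m < 2 ^ w" 
  shows "\<exists>R' Q'. run w sketch_program 19 \<lparr>pc = 2, wreg = R, rreg = Q, wmem = W, rmem = M\<rparr>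
    = \<lparr>pc = 2, wreg = R', rreg = Q', wmem = W,
        rmem = M(k * d + m + n + j := M (k * d + m + n + j) + M i * M (r + m))\<rparr>
    \<and> R' 0 = n \<and> R' 1 = d \<and> R' 3 = m \<and> R' 4 = 1 \<and> R' 5 = 2 * m \<and> R' 6 = Suc i"
proof -
  have "19 = Suc (Suc (Suc (Suc (Suc (Suc (Suc (Suc (Suc (Suc (Suc (Suc (Suc (Suc (Suc (Suc (Suc (Suc (Suc 0))))))))))))))))))" by simp
  moreover have "k * d < 2 ^ w" "k * d + m < 2 ^ w" "k * d + m + n < 2 ^ w" "r < 2 ^ w" "r + m < 2 ^ w" "Suc i < 2 ^ w" "j < 2 ^ w"
    using assms by linarith+
  ultimately show ?thesis
    using assms by (simp only:) (simp add: run_Suc run_0 step_sketch_program sketch_program_nth set_wreg_def set_rreg_def add.commute add.left_commute)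
qed

text \<open>The real memory after the first \<open>i\<close> entries.\<close>
definition scatter :: "(nat \<Rightarrow> real) \<Rightarrow> (nat \<Rightarrow> nat) \<Rightarrow> nat \<Rightarrow> nat \<Rightarrow> nat \<Rightarrow> nat \<Rightarrow> nat \<Rightarrow> real" where
  "scatter M W m d n i = (\<lambda>a. M a + (\<Sum>e<i. if a = W (W e + 2 * m) * d + m + n + W (e + m) then M e * M (W e + m) else 0))"

lemma sketch_program_loop:
  fixes M :: "nat \<Rightarrow> real"
  assumes R: "R 0 = n" "R 1 = d" "R 3 = m" "R 4 = 1" "R 5 = 2 * m" "R 6 = 0"
    and bound: "\<And>e. e < m \<Longrightarrow> W e + 2 * m < 2 ^ w" "2 * m < 2 ^ w"
      "\<And>e. e < m \<Longrightarrow> W (W e + 2 * m) * d + m + n + W (e + m) < 2 ^ w"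
      "\<And>e. e < m \<Longrightarrow> W (W e + 2 * m) < 2 ^ w"
      "\<And>e. e < m \<Longrightarrow> W e < n"
    and i: "i \<le> m"
  shows "\<exists>R' Q'. run w sketch_program (19 * i) \<lparr>pc = 2, wreg = R, rreg = Q, wmem = W, rmem = M\<rparr>
    = \<lparr>pc = 2, wreg = R', rreg = Q', wmem = W,
        rmem = scatter M W m d n i\<rparr>
    \<and> R' 0 = n \<and> R' 1 = d \<and> R' 3 = m \<and> R' 4 = 1 \<and> R' 5 = 2 * m \<and> R' 6 = i"
  using i
proof (induction i)
  case 0
  then show ?case using R by (simp add: run_0 scatter_def)
next
  case (Suc i)
  define addr where "addr e = W (W e + 2 * m) * d + m + n + W (e + m)" for e
  let ?N = "scatter M W m d n"
  have i: "i < m" using Suc by simp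
  obtain R' Q' where IH: "run w sketch_program (19 * i) \<lparr>pc = 2, wreg = R, rreg = Q, wmem = W, rmem = M\<rparr>
      = \<lparr>pc = 2, wreg = R', rreg = Q', wmem = W, rmem = ?N i\<rparr>"
    "R' 0 = n" "R' 1 = d" "R' 3 = m" "R' 4 = 1" "R' 5 = 2 * m" "R' 6 = i"
    using Suc by auto
  \<comment> \<open>Output addresses start at m + n, so the updates never overwrite the entries and
    scalars still to be read.\<close>
  have N_low: "?N i a = M a" if "a < m + n" for a
    unfolding scatter_def using that by (auto intro!: sum.neutral simp: addr_def)
  have "?N i i * ?N i (W i + m) = M i * M (W i + m)"
    using i bound(5)[OF i] by (simp add: N_low)
  moreover have "(?N i)(addr i := ?N i (addr i) + M i * M (W i + m)) = ?N (Suc i)"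
    by (auto simp: scatter_def addr_def fun_eq_iff)
  moreover have "\<exists>R'' Q''. run w sketch_program 19 \<lparr>pc = 2, wreg = R', rreg = Q', wmem = W, rmem = ?N i\<rparr>
      = \<lparr>pc = 2, wreg = R'', rreg = Q'', wmem = W,
          rmem = (?N i)(addr i := ?N i (addr i) + ?N i i * ?N i (W i + m))\<rparr>
      \<and> R'' 0 = n \<and> R'' 1 = d \<and> R'' 3 = m \<and> R'' 4 = 1 \<and> R'' 5 = 2 * m \<and> R'' 6 = Suc i"
    unfolding addr_def
    by (rule sketch_program_loop_body[OF IH(2-) i refl refl refl]) (use i bound bound(2) in auto)
  ultimately have "\<exists>R'' Q''. run w sketch_program (19 * i + 19) \<lparr>pc = 2, wreg = R, rreg = Q, wmem = W, rmem = M\<rparr>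
      = \<lparr>pc = 2, wreg = R'', rreg = Q'', wmem = W, rmem = ?N (Suc i)\<rparr>
      \<and> R'' 0 = n \<and> R'' 1 = d \<and> R'' 3 = m \<and> R'' 4 = 1 \<and> R'' 5 = 2 * m \<and> R'' 6 = Suc i"
    unfolding run_add IH(1) by simp
  then show ?case by (simp add: add.commute)
qed

lemma sketch_program_run:
  fixes M Q :: "nat \<Rightarrow> real"
  assumes R: "R 0 = n" "R 1 = d" "R 3 = m" "R 6 = 0"
    and bound: "\<And>e. e < m \<Longrightarrow> W e + 2 * m < 2 ^ w" "2 * m < 2 ^ w" "1 < (2::nat) ^ w"
      "\<And>e. e < m \<Longrightarrow> W (W e + 2 * m) * d + m + n + W (e + m) < 2 ^ w"
      "\<And>e. e < m \<Longrightarrow> W (W e + 2 * m) < 2 ^ w"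
      "\<And>e. e < m \<Longrightarrow> W e < n"
  defines "S \<equiv> run w sketch_program (19 * m + 4) \<lparr>pc = 0, wreg = R, rreg = Q, wmem = W, rmem = M\<rparr>"
  shows "halted sketch_program S"
    and "rmem S = scatter M W m d n m"
proof -
  let ?R = "R(4 := 1, 5 := 2 * m)"
  \<comment> \<open>With words of 0 bits the constant 1 in register 4 would be 0.\<close>
  have w: "w \<noteq> 0" using bound(3) by (cases w) auto
  have s1: "run w sketch_program (Suc (Suc 0)) \<lparr>pc = 0, wreg = R, rreg = Q, wmem = W, rmem = M\<rparr>
      = \<lparr>pc = 2, wreg = ?R, rreg = Q, wmem = W, rmem = M\<rparr>"
    using R bound w
    by (simp add: run_Suc run_0 step_sketch_program sketch_program_nth set_wreg_def mult_2)
  obtain R' Q' where s2: "run w sketch_program (19 * m) \<lparr>pc = 2, wreg = ?R, rreg = Q, wmem = W, rmem = M\<rparr>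
    = \<lparr>pc = 2, wreg = R', rreg = Q', wmem = W,
        rmem = scatter M W m d n m\<rparr>"
    "R' 3 = m" "R' 6 = m"
    using sketch_program_loop[of ?R n d m W w m Q M] R bound by auto
  have s3: "run w sketch_program (Suc (Suc 0)) \<lparr>pc = 2, wreg = R', rreg = Q', wmem = W, rmem = M'\<rparr>
      = \<lparr>pc = 22, wreg = R', rreg = Q', wmem = W, rmem = M'\<rparr>" for M' :: "nat \<Rightarrow> real"
    using s2 by (simp add: run_Suc run_0 step_sketch_program sketch_program_nth)
  \<comment> \<open>Two initial instructions, m iterations, then the failing test and the jump out
    of the program.\<close>
  have t: "19 * m + 4 = Suc (Suc 0) + (19 * m + Suc (Suc 0))" by simp
  show "halted sketch_program S"
    and "rmem S = scatter M W m d n m"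
    unfolding S_def t run_add s1 s2(1) s3 by (auto simp: halted_def length_sketch_program)
qed

section \<open>Entries of the sketched matrix\<close>

lemma Pi_mat_carrier: "Pi_mat s n h g \<in> carrier_mat s n"
  unfolding Pi_mat_def S_mat_def D_mat_def by (intro mult_carrier_mat[of _ s n]) (auto intro!: carrier_matI)

lemma Pi_mat_index:
  assumes "k < s" "i < n"
  shows "Pi_mat s n h g $$ (k, i) = (if h i = k then g i else 0)"
proof -
  have S: "S_mat s n h \<in> carrier_mat s n" by (auto simp: S_mat_def intro!: carrier_matI)
  have "Pi_mat s n h g $$ (k, i) = S_mat s n h $$ (k, i) * g i"
    unfolding Pi_mat_def D_mat_def using assms by (simp add: mat_diag_mult_right[OF S])
  then show ?thesis
    using assms by (auto simp: S_mat_def mat_of_cols_index unit_vec_def)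
qed

lemma Pi_mat_mult_index:
  assumes "A \<in> carrier_mat n d" "k < s" "j < d"
  shows "(Pi_mat s n h g * A) $$ (k, j) = (\<Sum>i<n. if h i = k then g i * A $$ (i, j) else 0)"
proof -
  have "(Pi_mat s n h g * A) $$ (k, j) = (\<Sum>i<n. Pi_mat s n h g $$ (k, i) * A $$ (i, j))"
    using assms Pi_mat_carrier[of s n h g]
    by (auto simp: scalar_prod_def atLeast0LessThan intro!: sum.cong)
  then show ?thesis using assms by (auto simp: Pi_mat_index intro!: sum.cong)
qed

lemma finite_nonzero_positions: "finite (nonzero_positions A)"
  by (rule finite_subset[of _ "{..<dim_row A} \<times> {..<dim_col A}"]) (auto simp: nonzero_positions_def)

text \<open>The s d output cells are zero at the start and each listed entry is added to exactly one
  of them, so the time does not involve s d. Since nnz A is at least 1, 19 m + 4 is at most 23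
  m.\<close>

lemma sketch_program_correct:
  assumes A: "A \<in> carrier_mat n d" and nz: "0 < nnz A" and h: "\<And>i. i < n \<Longrightarrow> h i < s"
  shows "computes_sketch_within sketch_program (23 * nnz A) s A h g"
  unfolding computes_sketch_within_def
proof (intro allI impI)
  fix es w
  assume es: "lists_nonzeros es A" and w: "2 * nnz A + dim_row A + s * dim_col A < 2 ^ w"
  define m where "m = length es"
  have m: "m = nnz A"
    using es by (auto simp: lists_nonzeros_def nnz_def m_def distinct_card[symmetric])
  have dims: "dim_row A = n" "dim_col A = d" using A by auto
  have e: "fst (es ! e) < n" "snd (es ! e) < d" if "e < m" for e
    using es that nth_mem[of e es] dims
    by (auto simp: lists_nonzeros_def nonzero_positions_def m_def)
  define S\<^sub>0 where "S\<^sub>0 = input_state s A es h g"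
  have s0: "S\<^sub>0 = \<lparr>pc = 0, wreg = wreg S\<^sub>0, rreg = rreg S\<^sub>0, wmem = wmem S\<^sub>0, rmem = rmem S\<^sub>0\<rparr>"
    by (simp add: S\<^sub>0_def input_state_def Let_def)
  have R: "wreg S\<^sub>0 0 = n" "wreg S\<^sub>0 1 = d" "wreg S\<^sub>0 3 = m" "wreg S\<^sub>0 6 = 0"
    by (auto simp: S\<^sub>0_def input_state_def Let_def dims m_def)
  have W: "wmem S\<^sub>0 e = fst (es ! e)" "wmem S\<^sub>0 (e + m) = snd (es ! e)"
    "wmem S\<^sub>0 (fst (es ! e) + 2 * m) = h (fst (es ! e))" if "e < m" for e
    using that e[OF that] by (auto simp: S\<^sub>0_def input_state_def Let_def dims m_def)
  have M: "rmem S\<^sub>0 e = A $$ (es ! e)" "rmem S\<^sub>0 (fst (es ! e) + m) = g (fst (es ! e))" if "e < m" for e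
    using that e[OF that] by (auto simp: S\<^sub>0_def input_state_def Let_def dims m_def)
  have M0: "rmem S\<^sub>0 (m + n + a) = 0" for a
    by (auto simp: S\<^sub>0_def input_state_def Let_def dims m_def)
  have addr: "k * d + j < s * d" if "k < s" "j < d" for k j
  proof -
    have "k * d + j < Suc k * d" using that by simp
    also have "\<dots> \<le> s * d" using that by (intro mult_right_mono) auto
    finally show ?thesis .
  qed
  have he: "h (fst (es ! e)) < s" if "e < m" for e using h e that by blast
  have w': "2 * m + n + s * d < 2 ^ w" using w m dims by simp
  define S where "S = run w sketch_program (19 * m + 4) S\<^sub>0"
  have bounds: "\<And>e. e < m \<Longrightarrow> wmem S\<^sub>0 e + 2 * m < 2 ^ w" "2 * m < 2 ^ w" "1 < (2::nat) ^ w"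
      "\<And>e. e < m \<Longrightarrow> wmem S\<^sub>0 (wmem S\<^sub>0 e + 2 * m) * d + m + n + wmem S\<^sub>0 (e + m) < 2 ^ w"
      "\<And>e. e < m \<Longrightarrow> wmem S\<^sub>0 (wmem S\<^sub>0 e + 2 * m) < 2 ^ w"
      "\<And>e. e < m \<Longrightarrow> wmem S\<^sub>0 e < n"
  proof -
    show "2 * m < 2 ^ w" "1 < (2::nat) ^ w" using w' nz m by linarith+
    fix e assume em: "e < m"
    note e = e[OF em] W[OF em] he[OF em]
    show "wmem S\<^sub>0 e + 2 * m < 2 ^ w" "wmem S\<^sub>0 e < n" using e w' by linarith+
    show "wmem S\<^sub>0 (wmem S\<^sub>0 e + 2 * m) * d + m + n + wmem S\<^sub>0 (e + m) < 2 ^ w"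
      using e w' addr[OF e(6,2)] by simp
    \<comment> \<open>The hash value occupies a register before it is multiplied, so it needs a
      bound of its own; d is positive because some column index lies below it.\<close>
    have "h (fst (es ! e)) \<le> h (fst (es ! e)) * d" using e(2) by (cases d) auto
    then have "h (fst (es ! e)) < 2 ^ w" using w' addr[OF e(6,2)] by linarith
    then show "wmem S\<^sub>0 (wmem S\<^sub>0 e + 2 * m) < 2 ^ w"
      using e by simp
  qed
  have run0: "run w sketch_program (19 * m + 4)
      \<lparr>pc = 0, wreg = wreg S\<^sub>0, rreg = rreg S\<^sub>0, wmem = wmem S\<^sub>0, rmem = rmem S\<^sub>0\<rparr> = S"
    by (simp add: S_def s0[symmetric])
  have fin1: "halted sketch_program S"
    unfolding run0[symmetric] by (rule sketch_program_run(1)[OF R bounds])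
  have fin2: "rmem S = scatter (rmem S\<^sub>0) (wmem S\<^sub>0) m d n m"
    using sketch_program_run(2)[OF R bounds, where M="rmem S\<^sub>0" and Q="rreg S\<^sub>0"]
    unfolding run0 by blast
  have res: "holds_result (m + n) (Pi_mat s n h g * A) S"
    unfolding holds_result_def
  proof (intro allI impI)
    fix k j assume "k < dim_row (Pi_mat s n h g * A)" "j < dim_col (Pi_mat s n h g * A)"
    then have kj: "k < s" "j < d" using dims Pi_mat_carrier[of s n h g] by auto
    let ?f = "\<lambda>(r, c). if h r = k \<and> c = j then A $$ (r, c) * g r else 0"
    have z: "rmem S\<^sub>0 (m + n + k * d + j) = 0"
      using M0[of "k * d + j"] by (simp add: add.assoc)
    have "rmem S (m + n + k * d + j) = (\<Sum>e<m. if m + n + k * d + j = wmem S\<^sub>0 (wmem S\<^sub>0 e + 2 * m) * d + m + n + wmem S\<^sub>0 (e + m)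
        then rmem S\<^sub>0 e * rmem S\<^sub>0 (wmem S\<^sub>0 e + m) else 0)"
      unfolding fin2 scatter_def z by simp
    also have "\<dots> = (\<Sum>e<m. ?f (es ! e))"
    proof (intro sum.cong refl)
      fix e' assume "e' \<in> {..<m}"
      then have em: "e' < m" by simp
      note ee = e[OF em] W[OF em] M[OF em]
      \<comment> \<open>Row-major addresses determine both indices, by division with remainder, as
        column indices lie below d.\<close>
      have "(m + n + k * d + j = h (fst (es ! e')) * d + m + n + snd (es ! e')) \<longleftrightarrow>
          h (fst (es ! e')) = k \<and> snd (es ! e') = j" (is "?l \<longleftrightarrow> ?r")
      proof
        assume ?l
        then have eq: "j + d * k = snd (es ! e') + d * h (fst (es ! e'))" by (simp add: mult.commute)
        have "(j + d * k) div d = k" "(j + d * k) mod d = j" using kj by auto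
        moreover have "(snd (es ! e') + d * h (fst (es ! e'))) div d = h (fst (es ! e'))"
          "(snd (es ! e') + d * h (fst (es ! e'))) mod d = snd (es ! e')" using ee(2) by auto
        ultimately show ?r using eq by metis
      qed auto
      then show "(if m + n + k * d + j = wmem S\<^sub>0 (wmem S\<^sub>0 e' + 2 * m) * d + m + n + wmem S\<^sub>0 (e' + m)
          then rmem S\<^sub>0 e' * rmem S\<^sub>0 (wmem S\<^sub>0 e' + m) else 0) = ?f (es ! e')"
        using ee by (cases "es ! e'") auto
    qed
    also have "\<dots> = (\<Sum>x\<in>nonzero_positions A. ?f x)"
    proof -
      have "inj_on ((!) es) {..<m}" using es by (auto simp: lists_nonzeros_def m_def inj_on_def nth_eq_iff_index_eq)
      moreover have "(!) es ` {..<m} = nonzero_positions A"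
        using es by (auto simp: lists_nonzeros_def m_def set_conv_nth)
      ultimately show ?thesis using sum.reindex[of "(!) es" "{..<m}" ?f] by simp
    qed
    also have "\<dots> = (\<Sum>x\<in>{..<n} \<times> {..<d}. ?f x)"
      by (rule sum.mono_neutral_left) (auto simp: nonzero_positions_def dims split: if_splits)
    also have "\<dots> = (\<Sum>i<n. \<Sum>c<d. if c = j then (if h i = k then A $$ (i, c) * g i else 0) else 0)"
      unfolding sum.cartesian_product[symmetric] by (intro sum.cong refl) auto
    also have "\<dots> = (\<Sum>i<n. if h i = k then g i * A $$ (i, j) else 0)"
      using kj by (intro sum.cong refl) (auto simp: mult.commute)
    also have "\<dots> = (Pi_mat s n h g * A) $$ (k, j)"
      using Pi_mat_mult_index[OF A kj] by simp
    finally show "rmem S (m + n + k * dim_col (Pi_mat s n h g * A) + j) = (Pi_mat s n h g * A) $$ (k, j)"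
      using dims by simp
  qed
  show "\<exists>t\<le>23 * nnz A. let S = run w sketch_program t (input_state s A es h g) in
      halted sketch_program S \<and> holds_result (nnz A + dim_row A) (Pi_mat s (dim_row A) h g * A) S"
    using fin1 res nz by (intro exI[of _ "19 * m + 4"]) (auto simp: S_def S\<^sub>0_def m dims)
qed

text \<open>A rank counts independent columns as a set, so repeated columns are ruled out first:
  with fewer than d distinct columns the rank would be below d. After that a nonzero kernel vector
  is a linear dependence.\<close>

lemma full_column_rank_mult_vec_eq_0:
  assumes A: "A \<in> carrier_mat n d" and full: "full_column_rank A"
    and v: "v \<in> carrier_vec d" "A *\<^sub>v v = 0\<^sub>v n"
  shows "v = 0\<^sub>v d"
proof (rule ccontr)
  assume nz: "v \<noteq> 0\<^sub>v d"
  interpret vec_space "TYPE(real)" n .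
  have rank: "vec_space.rank n A = d" using A full by (simp add: full_column_rank_def)
  have dist: "distinct (cols A)"
  proof (rule ccontr)
    assume "\<not> distinct (cols A)"
    then have "card (set (cols A)) < d"
      using A card_length[of "cols A"] card_distinct[of "cols A"] by fastforce
    moreover obtain S where S: "maximal S (\<lambda>T. T \<subseteq> set (cols A) \<and> lin_indpt T)"
      using maximal_exists_superset[of "set (cols A)" "\<lambda>T. T \<subseteq> set (cols A) \<and> lin_indpt T" "{}"]
      by (auto simp: lin_dep_def)
    then have "card S \<le> card (set (cols A))" by (simp add: card_mono maximal_def)
    ultimately show False using rank_card_indpt[OF A S] rank by simp
  qed
  have "module.lin_dep class_ring (module_vec TYPE(real) n) (set (cols A))"
    by (rule vec_space.lin_depI[OF A v(1) nz v(2) dist])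
  moreover have "\<not> module.lin_dep class_ring (module_vec TYPE(real) n) (set (cols A))"
    by (rule vec_space.full_rank_lin_indpt[OF A rank dist])
  ultimately show False by simp
qed

lemma full_column_rank_nnz_pos:
  assumes A: "A \<in> carrier_mat n d" and full: "full_column_rank A" and d: "0 < d"
  shows "0 < nnz A"
proof (rule ccontr)
  assume "\<not> 0 < nnz A"
  then have "nonzero_positions A = {}" using finite_nonzero_positions by (auto simp: nnz_def)
  then have "A *\<^sub>v unit_vec d 0 = 0\<^sub>v n"
    using A by (intro eq_vecI) (auto simp: nonzero_positions_def scalar_prod_def)
  then have "unit_vec d 0 = (0\<^sub>v d :: real Matrix.vec)"
    using full_column_rank_mult_vec_eq_0[OF A full] by simp
  then show False using d by (metis index_unit_vec(1) index_zero_vec(1) zero_neq_one)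
qed

section \<open>The embedding\<close>

lemma std_stable_coordinates:
  assumes D: "std_stable p D"
  shows "prob_space (\<Pi>\<^sub>M i\<in>{..<n::nat}. D)"
    and "\<And>i. i < n \<Longrightarrow> (\<lambda>w. w i) \<in> borel_measurable (\<Pi>\<^sub>M i\<in>{..<n}. D)"
    and "1 < p \<Longrightarrow> p < 2 \<Longrightarrow> stable_family (\<Pi>\<^sub>M i\<in>{..<n}. D) (\<lambda>i w. w i) {..<n} p"
proof -
  interpret D: real_distribution D using std_stableD[OF D] by blast
  interpret P: product_prob_space "\<lambda>_. D" "{..<n}"
    by (rule product_prob_spaceI) (rule D.prob_space_axioms)
  show ps: "prob_space (\<Pi>\<^sub>M i\<in>{..<n::nat}. D)" by (rule P.P.prob_space_axioms)
  show meas: "(\<lambda>w. w i) \<in> borel_measurable (\<Pi>\<^sub>M i\<in>{..<n}. D)" if "i < n" for i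
    using measurable_component_singleton[of i "{..<n}" "\<lambda>_. D"] that
    by (simp add: measurable_cong_sets[OF refl D.events_eq_borel])
  have dist: "distr (\<Pi>\<^sub>M i\<in>{..<n}. D) borel (\<lambda>w. w i) = D" if "i < n" for i
  proof -
    have "distr (\<Pi>\<^sub>M i\<in>{..<n}. D) borel (\<lambda>w. w i) = distr (\<Pi>\<^sub>M i\<in>{..<n}. D) D (\<lambda>w. w i)"
      by (rule distr_cong) auto
    also have "\<dots> = D" using P.PiM_component[of i] that by simp
    finally show ?thesis .
  qed
  have "prob_space.indep_vars (\<Pi>\<^sub>M i\<in>{..<n}. D) (\<lambda>_. borel) (\<lambda>i w. w i) {..<n}"
  \<comment> \<open>The characterisation of independence by the joint distribution is applied to a
    nonempty index set.\<close>
  proof (cases "n = 0")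
    case True
    then show ?thesis
      unfolding prob_space.indep_vars_def[OF ps] prob_space.indep_sets_def[OF ps] by simp
  next
    case False
    have sets: "sets (\<Pi>\<^sub>M i\<in>{..<n}. borel) = sets (\<Pi>\<^sub>M i\<in>{..<n}. D)"
      by (rule sets_PiM_cong) auto
    have "distr (\<Pi>\<^sub>M i\<in>{..<n}. D) (\<Pi>\<^sub>M i\<in>{..<n}. borel) (\<lambda>x. \<lambda>i\<in>{..<n}. x i)
        = distr (\<Pi>\<^sub>M i\<in>{..<n}. D) (\<Pi>\<^sub>M i\<in>{..<n}. D) (\<lambda>x. x)"
      using sets by (intro distr_cong) (auto simp: space_PiM PiE_restrict)
    also have "\<dots> = (\<Pi>\<^sub>M i\<in>{..<n}. D)" by (rule distr_id)
    also have "\<dots> = (\<Pi>\<^sub>M i\<in>{..<n}. distr (\<Pi>\<^sub>M i\<in>{..<n}. D) borel (\<lambda>w. w i))"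
      by (rule PiM_cong) (auto simp: dist)
    finally show ?thesis
      using False meas by (subst prob_space.indep_vars_iff_distr_eq_PiM'[OF ps]) auto
  qed
  then show "1 < p \<Longrightarrow> p < 2 \<Longrightarrow> stable_family (\<Pi>\<^sub>M i\<in>{..<n}. D) (\<lambda>i w. w i) {..<n} p"
    using dist D by (intro stable_family.intro stable_family_axioms.intro ps) auto
qed

text \<open>As a measure, the uniform pmf lives on all natural numbers, so hash values lie below s
  only almost everywhere.\<close>

lemma uniform_hash:
  fixes n s :: nat
  assumes s: "0 < s"
  defines "P \<equiv> \<Pi>\<^sub>M i\<in>{..<n::nat}. measure_pmf (pmf_of_set {..<s})"
  shows "prob_space P"
    and "\<And>i. i < n \<Longrightarrow> (\<lambda>w. w i) \<in> measurable P (count_space UNIV)"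
    and "\<And>i j. i < n \<Longrightarrow> j < n \<Longrightarrow> i \<noteq> j \<Longrightarrow> measure P {w \<in> space P. w i = w j} \<le> 1 / real s"
    and "AE w in P. \<forall>i<n. w i < s"
proof -
  let ?p = "pmf_of_set {..<s}"
  have ps: "set_pmf ?p = {..<s}" using s by (intro set_pmf_of_set) auto
  interpret P: product_prob_space "\<lambda>_::nat. measure_pmf ?p" "{..<n}"
    by (rule product_prob_spaceI) (rule measure_pmf.prob_space_axioms)
  show "prob_space P" unfolding P_def by (rule P.P.prob_space_axioms)
  interpret prob_space P by fact
  show meas: "(\<lambda>w. w i) \<in> measurable P (count_space UNIV)" if "i < n" for i
    using measurable_component_singleton[of i "{..<n}" "\<lambda>_. measure_pmf ?p"] that
    by (simp add: P_def)
  have "AE w in P. w i < s" if "i < n" for i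
    unfolding P_def using that by (intro P.AE_component) (auto simp: AE_measure_pmf_iff ps)
  then have "AE w in P. \<forall>i\<in>{..<n}. w i < s" by (intro AE_finite_allI) auto
  then show range: "AE w in P. \<forall>i<n. w i < s" by eventually_elim auto
  fix i j assume ij: "i < n" "j < n" "i \<noteq> j"
  \<comment> \<open>A collision is split by its common value, which turns it into cylinder events
    with product probabilities 1 / s^2.\<close>
  define E where "E k = {w \<in> space P. \<forall>l\<in>{i, j}. w l \<in> {k}}" for k
  have Em: "E k \<in> events" for k
  proof -
    have "E k = ((\<lambda>w. w i) -` {k} \<inter> space P) \<inter> ((\<lambda>w. w j) -` {k} \<inter> space P)" by (auto simp: E_def)
    then show ?thesis using measurable_sets[OF meas[OF ij(1)], of "{k}"] measurable_sets[OF meas[OF ij(2)], of "{k}"] by auto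
  qed
  have pmf: "pmf ?p k = 1 / real s" if "k < s" for k
    using s that by (subst pmf_of_set) auto
  have Ep: "prob (E k) = 1 / (real s)\<^sup>2" if "k < s" for k
  proof -
    have "emeasure P (E k) = (\<Prod>l\<in>{i, j}. emeasure (measure_pmf ?p) {k})"
      unfolding E_def P_def using ij by (intro P.emeasure_PiM_Collect) auto
    also have "\<dots> = ennreal (1 / real s) * ennreal (1 / real s)"
      using ij that pmf by (simp add: emeasure_pmf_single)
    also have "\<dots> = ennreal (1 / (real s)\<^sup>2)"
      by (simp add: ennreal_mult[symmetric] power2_eq_square)
    finally show ?thesis by (simp add: emeasure_eq_measure)
  qed
  have "measure P {w \<in> space P. w i = w j} \<le> prob (\<Union>k<s. E k)"
  proof (rule finite_measure_mono_AE)
    show "AE w in P. w \<in> {w \<in> space P. w i = w j} \<longrightarrow> w \<in> (\<Union>k<s. E k)"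
      using range by eventually_elim (use ij in \<open>auto simp: E_def\<close>)
  qed (use Em in auto)
  also have "\<dots> \<le> (\<Sum>k<s. prob (E k))" using Em by (intro finite_measure_subadditive_finite) auto
  also have "\<dots> = 1 / real s" using s by (simp add: Ep power2_eq_square)
  finally show "measure P {w \<in> space P. w i = w j} \<le> 1 / real s" .
qed

text \<open>Fubini's theorem as conditioning: a bound over the scalars for each fixed good hash is
  integrated over the hashes.\<close>

lemma pair_measure_lower_bound:
  assumes M: "prob_space M" and N: "prob_space N" and E: "E \<in> sets (M \<Otimes>\<^sub>M N)" and G: "G \<in> sets M"
    and c: "0 \<le> c" "\<And>x. x \<in> G \<Longrightarrow> c \<le> measure N (Pair x -` E)"
  shows "c * measure M G \<le> measure (M \<Otimes>\<^sub>M N) E"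
proof -
  interpret M: prob_space M by fact
  interpret N: prob_space N by fact
  interpret P: pair_prob_space M N ..
  have "ennreal (c * measure M G) = (\<integral>\<^sup>+x. ennreal c * indicator G x \<partial>M)"
    using G c by (simp add: nn_integral_cmult_indicator M.emeasure_eq_measure ennreal_mult)
  also have "\<dots> \<le> (\<integral>\<^sup>+x. emeasure N (Pair x -` E) \<partial>M)"
    using c by (intro nn_integral_mono) (auto simp: indicator_def N.emeasure_eq_measure)
  also have "\<dots> = emeasure (M \<Otimes>\<^sub>M N) E" using E by (rule N.emeasure_pair_measure_alt[symmetric])
  finally show ?thesis by (simp add: P.emeasure_eq_measure)
qed

section \<open>Measurability of the embedding event\<close>

lemma tendsto_lp_sum:
  fixes f :: "'i \<Rightarrow> nat \<Rightarrow> real"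
  assumes "0 < p" "\<And>i. i \<in> I \<Longrightarrow> f i \<longlonglongrightarrow> c i"
  shows "(\<lambda>m. (\<Sum>i\<in>I. \<bar>f i m\<bar> powr p) powr (1/p)) \<longlonglongrightarrow> (\<Sum>i\<in>I. \<bar>c i\<bar> powr p) powr (1/p)"
  using assms by (intro tendsto_powr' tendsto_sum tendsto_rabs tendsto_const assms(2)) (auto intro!: sum_nonneg always_eventually)

text \<open>Rational points are indexed by \<open>rat list\<close>, a countable type, so that a
  quantifier over all of them preserves measurability.\<close>

lemma rational_vector_approximation:
  fixes x :: "real Matrix.vec"
  assumes "x \<in> carrier_vec d"
  obtains l :: "nat \<Rightarrow> rat list" where "\<And>j. j < d \<Longrightarrow> (\<lambda>m. vec d (\<lambda>j. of_rat (l m ! j)) $ j) \<longlonglongrightarrow> x $ j"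
proof -
  have "\<exists>r :: rat. \<bar>of_rat r - x $ j\<bar> < 1 / real (Suc m)" for j m
  proof -
    obtain r where "x $ j - 1 / real (Suc m) < of_rat r" "of_rat r < x $ j + 1 / real (Suc m)"
      using of_rat_dense[of "x $ j - 1 / real (Suc m)" "x $ j + 1 / real (Suc m)"] by auto
    then show ?thesis by (intro exI[of _ r]) (simp add: abs_less_iff)
  qed
  then obtain r :: "nat \<Rightarrow> nat \<Rightarrow> rat" where r: "\<And>j m. \<bar>of_rat (r j m) - x $ j\<bar> < 1 / real (Suc m)"
    by metis
  show ?thesis
  proof (rule that)
    fix j assume j: "j < d"
    have "(\<lambda>m. of_rat (r j m) :: real) \<longlonglongrightarrow> x $ j"
    proof (rule LIM_zero_cancel, rule Lim_null_comparison)
      show "\<forall>\<^sub>F m in sequentially. norm (of_rat (r j m) - x $ j) \<le> 1 / real (Suc m)"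
        using r by (intro always_eventually allI) (simp add: less_imp_le)
      show "(\<lambda>m. 1 / real (Suc m)) \<longlonglongrightarrow> 0" by (rule LIMSEQ_Suc[OF lim_1_over_n])
    qed
    then show "(\<lambda>m. vec d (\<lambda>j. of_rat (map (\<lambda>j. r j m) [0..<d] ! j)) $ j) \<longlonglongrightarrow> x $ j"
      using j by simp
  qed
qed

definition sketch_entry :: "nat \<Rightarrow> (nat \<Rightarrow> nat) \<Rightarrow> (nat \<Rightarrow> real) \<Rightarrow> (nat \<Rightarrow> real) \<Rightarrow> nat \<Rightarrow> real" where
  "sketch_entry n h g v k = (\<Sum>i<n. if h i = k then g i * v i else 0)"

lemma mult_mat_vec_index:
  assumes "A \<in> carrier_mat n d" "x \<in> carrier_vec d" "i < n"
  shows "(A *\<^sub>v x) $ i = (\<Sum>j<d. A $$ (i, j) * x $ j)"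
  using assms by (auto simp: scalar_prod_def atLeast0LessThan intro!: sum.cong)

lemma lp_norm_mult:
  assumes "A \<in> carrier_mat n d"
  shows "lp_norm p (A *\<^sub>v x) = (\<Sum>i<n. \<bar>(A *\<^sub>v x) $ i\<bar> powr p) powr (1/p)"
  using assms by (simp add: lp_norm_def)

lemma lp_norm_sketch:
  assumes A: "A \<in> carrier_mat n d" and x: "x \<in> carrier_vec d"
  shows "lp_norm p (Pi_mat s n h g * A *\<^sub>v x)
    = (\<Sum>k<s. \<bar>sketch_entry n h g (\<lambda>i. (A *\<^sub>v x) $ i) k\<bar> powr p) powr (1/p)"
proof -
  have Pi: "Pi_mat s n h g \<in> carrier_mat s n" by (rule Pi_mat_carrier)
  have "Pi_mat s n h g * A *\<^sub>v x = Pi_mat s n h g *\<^sub>v (A *\<^sub>v x)"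
    by (rule assoc_mult_mat_vec[OF Pi A x])
  moreover have "(Pi_mat s n h g *\<^sub>v (A *\<^sub>v x)) $ k = sketch_entry n h g (\<lambda>i. (A *\<^sub>v x) $ i) k" if "k < s" for k
  proof -
    have Ax: "A *\<^sub>v x \<in> carrier_vec n" using A x by auto
    have "(Pi_mat s n h g *\<^sub>v (A *\<^sub>v x)) $ k = (\<Sum>i<n. Pi_mat s n h g $$ (k, i) * (A *\<^sub>v x) $ i)"
      by (rule mult_mat_vec_index[OF Pi Ax that])
    also have "\<dots> = sketch_entry n h g (\<lambda>i. (A *\<^sub>v x) $ i) k"
      unfolding sketch_entry_def using that by (intro sum.cong refl) (simp add: Pi_mat_index)
    finally show ?thesis .
  qed
  ultimately show ?thesis using Pi by (simp add: lp_norm_def)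
qed

text \<open>The quantifier over all \<open>x\<close> is reduced to rational \<open>x\<close>, as both norms are continuous in \<open>x\<close>.\<close>
lemma embedding_event_measurable:
  fixes p lo hi :: real
  assumes A: "A \<in> carrier_mat n d" and p: "0 < p" and D: "std_stable p' D" and s: "0 < s"
  defines "\<Omega> \<equiv> sketch_space D s n"
  shows "{(h, g) \<in> space \<Omega>. \<forall>x\<in>carrier_vec d.
      lo * lp_norm p (A *\<^sub>v x) \<le> lp_norm p (Pi_mat s n h g * A *\<^sub>v x) \<and>
      lp_norm p (Pi_mat s n h g * A *\<^sub>v x) \<le> hi * lp_norm p (A *\<^sub>v x)} \<in> sets \<Omega>"
proof -
  let ?r = "\<lambda>l :: rat list. vec d (\<lambda>j. real_of_rat (l ! j))"
  define Q where "Q h g x \<longleftrightarrow> lo * lp_norm p (A *\<^sub>v x) \<le> lp_norm p (Pi_mat s n h g * A *\<^sub>v x) \<and>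
      lp_norm p (Pi_mat s n h g * A *\<^sub>v x) \<le> hi * lp_norm p (A *\<^sub>v x)" for h g x
  have dense: "Q h g x" if x: "x \<in> carrier_vec d" and all: "\<forall>l. Q h g (?r l)" for h g x
  proof -
    obtain l where l: "\<And>j. j < d \<Longrightarrow> (\<lambda>m. ?r (l m) $ j) \<longlonglongrightarrow> x $ j"
      using rational_vector_approximation[OF x] by metis
    have lA: "(\<lambda>m. (A *\<^sub>v ?r (l m)) $ i) \<longlonglongrightarrow> (A *\<^sub>v x) $ i" if "i < n" for i
    proof -
      have "(\<lambda>m. \<Sum>j<d. A $$ (i, j) * ?r (l m) $ j) \<longlonglongrightarrow> (\<Sum>j<d. A $$ (i, j) * x $ j)"
        using l by (intro tendsto_sum tendsto_mult tendsto_const) auto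
      moreover have "(A *\<^sub>v ?r (l m)) $ i = (\<Sum>j<d. A $$ (i, j) * ?r (l m) $ j)" for m
        by (rule mult_mat_vec_index[OF A _ that]) simp
      ultimately show ?thesis using mult_mat_vec_index[OF A x that] by simp
    qed
    have n1: "(\<lambda>m. lp_norm p (A *\<^sub>v ?r (l m))) \<longlonglongrightarrow> lp_norm p (A *\<^sub>v x)"
      unfolding lp_norm_mult[OF A] using lA by (intro tendsto_lp_sum p) auto
    have "(\<lambda>m. sketch_entry n h g (\<lambda>i. (A *\<^sub>v ?r (l m)) $ i) k) \<longlonglongrightarrow> sketch_entry n h g (\<lambda>i. (A *\<^sub>v x) $ i) k" for k
      unfolding sketch_entry_def
    proof (intro tendsto_sum)
      fix i assume "i \<in> {..<n}"
      then have "i < n" by simp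
      show "(\<lambda>m. if h i = k then g i * (A *\<^sub>v ?r (l m)) $ i else 0) \<longlonglongrightarrow> (if h i = k then g i * (A *\<^sub>v x) $ i else 0)"
      proof (cases "h i = k")
        case True
        show ?thesis unfolding if_P[OF True] by (intro tendsto_mult tendsto_const lA \<open>i < n\<close>)
      next
        case False
        show ?thesis unfolding if_not_P[OF False] by (rule tendsto_const)
      qed
    qed
    then have n2: "(\<lambda>m. lp_norm p (Pi_mat s n h g * A *\<^sub>v ?r (l m))) \<longlonglongrightarrow> lp_norm p (Pi_mat s n h g * A *\<^sub>v x)"
      using lp_norm_sketch[OF A] x by (simp only: lp_norm_sketch[OF A] vec_carrier) (intro tendsto_lp_sum p)
    have "lo * lp_norm p (A *\<^sub>v x) \<le> lp_norm p (Pi_mat s n h g * A *\<^sub>v x)"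
      using all unfolding Q_def by (intro LIMSEQ_le[OF tendsto_mult[OF tendsto_const n1] n2]) auto
    moreover have "lp_norm p (Pi_mat s n h g * A *\<^sub>v x) \<le> hi * lp_norm p (A *\<^sub>v x)"
      using all unfolding Q_def by (intro LIMSEQ_le[OF n2 tendsto_mult[OF tendsto_const n1]]) auto
    ultimately show ?thesis by (simp add: Q_def)
  qed
  have hm: "(\<lambda>w. fst w i) \<in> measurable \<Omega> (count_space UNIV)" if "i < n" for i
    unfolding \<Omega>_def sketch_space_def
    by (rule measurable_compose[OF measurable_fst uniform_hash(2)[OF s that]])
  have gm: "(\<lambda>w. snd w i) \<in> borel_measurable \<Omega>" if "i < n" for i
    unfolding \<Omega>_def sketch_space_def
    by (rule measurable_compose[OF measurable_snd std_stable_coordinates(2)[OF D that]])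
  have em: "(\<lambda>w. sketch_entry n (fst w) (snd w) v k) \<in> borel_measurable \<Omega>" for v k
    unfolding sketch_entry_def
  proof (intro borel_measurable_sum measurable_If)
    fix i assume "i \<in> {..<n}"
    then have i: "i < n" by simp
    show "(\<lambda>w. snd w i * v i) \<in> borel_measurable \<Omega>" using gm[OF i] by simp
    have "(\<lambda>w. fst w i) -` {k} \<inter> space \<Omega> \<in> sets \<Omega>" by (rule measurable_sets[OF hm[OF i]]) simp
    also have "(\<lambda>w. fst w i) -` {k} \<inter> space \<Omega> = {w \<in> space \<Omega>. fst w i = k}" by auto
    finally show "{w \<in> space \<Omega>. fst w i = k} \<in> sets \<Omega>" .
  qed simp
  have nm: "(\<lambda>w. lp_norm p (Pi_mat s n (fst w) (snd w) * A *\<^sub>v ?r l)) \<in> borel_measurable \<Omega>" for l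
    unfolding lp_norm_sketch[OF A vec_carrier] using em by measurable
  have "{w \<in> space \<Omega>. \<forall>l. Q (fst w) (snd w) (?r l)} \<in> sets \<Omega>"
  proof (intro sets.sets_Collect_countable_All)
    fix l
    have "{w \<in> space \<Omega>. lo * lp_norm p (A *\<^sub>v ?r l) \<le> lp_norm p (Pi_mat s n (fst w) (snd w) * A *\<^sub>v ?r l) \<and>
        lp_norm p (Pi_mat s n (fst w) (snd w) * A *\<^sub>v ?r l) \<le> hi * lp_norm p (A *\<^sub>v ?r l)} \<in> sets \<Omega>"
      using nm[of l] by measurable
    then show "{w \<in> space \<Omega>. Q (fst w) (snd w) (?r l)} \<in> sets \<Omega>" unfolding Q_def .
  qed
  also have "{w \<in> space \<Omega>. \<forall>l. Q (fst w) (snd w) (?r l)} = {(h, g) \<in> space \<Omega>. \<forall>x\<in>carrier_vec d. Q h g x}"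
    using dense by (auto simp: vec_carrier)
  finally show ?thesis unfolding Q_def .
qed

text \<open>The rows of weight above \<open>1 / (2 * K)\<close> are the heavy ones, \<open>2 ^ L\<close> is the truncation level
  in \<open>sum_weak_type_tail\<close>, and \<open>N\<close> the mesh of the grid. With \<open>1 / 5184\<close> the rate in
  \<open>std_stable_laplace\<close>, \<open>165888 = 32 * 5184\<close> and \<open>663552 = 128 * 5184\<close>; \<open>1 / (2304 * d)\<close> is the
  level below which a diagonal entry counts as small, and \<open>512 = 16 * 32\<close> and
  \<open>8704 = 16 * 544\<close> come from Markov's inequality.\<close>
definition admissible :: "real \<Rightarrow> nat \<Rightarrow> nat \<Rightarrow> real \<Rightarrow> real \<Rightarrow> real \<Rightarrow> nat \<Rightarrow> nat \<Rightarrow> bool" where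
  "admissible p d s C\<^sub>1 C\<^sub>2 K L N \<longleftrightarrow>
    0 < K \<and> 0 < s \<and> 64 * K\<^sup>2 * (real d)\<^sup>2 \<le> real s \<and> 256 * K * (real d)\<^sup>2 \<le> real s \<and>
    16 * real s \<le> 2 ^ L \<and>
    8704 * K * (real d)\<^sup>2 * (1 + real L) / real s \<le> (1 / (2304 * real d)) powr p / 16 \<and>
    16 * (real d)\<^sup>2 \<le> real N \<and> 663552 * real d * (512 * real d * (1 + real L)) \<le> real N \<and>
    (2 * real N + 1) ^ d * exp (- K / 165888) \<le> 1 / 16 \<and>
    512 * real d * (1 + real L) \<le> C\<^sub>2 powr p * (real d * ln (real d)) \<and>
    1 / (C\<^sub>1 powr p * (real d * ln (real d))\<^sup>2) \<le> (1 / (2304 * real d)) powr p / 16 \<and>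
    1 / (C\<^sub>1 powr p * (real d * ln (real d))\<^sup>2) \<le> 1 / 663552"

text \<open>Everything is measured in q = d ln d, with d at most 2 q. Heavy collisions ask for a
  multiple of q^4, and s exceeds \<omega> q^5. The truncation level, and with it the upper constant,
  grows with ln \<omega>; this is \<open>B\<close>.\<close>

lemma parameter_choice_fixed:
  fixes p \<omega> B :: real and d :: nat
  assumes p: "1 < p" "p < 2" and d: "2 \<le> d" and B: "B = 40 + 4 * ln \<omega>"
    and w: "1 \<le> \<omega>" "192 * \<omega> powr (1/4) \<le> \<omega>" "768 * \<omega> powr (1/8) \<le> \<omega>"
      "17408 * \<omega> powr (1/8) * B / \<omega> \<le> 1 / 254803968"
      "2 * ln (3 * 339738624 * B) + 6 \<le> \<omega> powr (1/8) / 165888"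
  defines "s \<equiv> sketch_dim \<omega> d"
  shows "\<exists>K L N. admissible p d s 1000000000 (512 * B) K L N"
proof -
  define l where "l = ln (real d)"
  define q where "q = real d * l"
  \<comment> \<open>\<open>K\<close> has to beat d times the logarithm of the mesh, which depends on
    \<omega> only through ln \<open>B\<close>, while K^2 d^2 has to stay below s. A small power of
    \<omega> achieves both once \<omega> is large.\<close>
  define K where "K = \<omega> powr (1/8) * q"
  define L where "L = nat \<lceil>log 2 (16 * real s)\<rceil>"
  \<comment> \<open>339738624 = 663552 * 512, from the rounding error against the upper bound
    \<open>R\<close>.\<close>
  define N where "N = 339738624 * d\<^sup>2 * (1 + L)"
  have ln2': "2/3 \<le> ln (2::real)" by (rule ln2_ge_two_thirds)
  then have ln2: "1/2 \<le> ln (2::real)" by simp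
  have ln2l: "ln 2 \<le> l" using d by (simp add: l_def)
  have l: "1 \<le> 2 * l" using ln2 ln2l by linarith
  have lle: "l \<le> real d" using ln_le_minus_one[of "real d"] d by (simp add: l_def)
  have dq: "real d \<le> 2 * q" using l d mult_left_mono[of 1 "2*l" "real d"] by (simp add: q_def)
  have q1: "1 \<le> q" using dq d by simp
  have d2q: "(real d)\<^sup>2 \<le> 3 * q\<^sup>2"
  proof -
    have "2/3 \<le> l" using ln2' ln2l by linarith
    then have "(2/3)\<^sup>2 \<le> l\<^sup>2" by (intro power_mono) auto
    then have "1 \<le> 3 * l\<^sup>2" by (simp add: power_divide)
    then have "(real d)\<^sup>2 * 1 \<le> (real d)\<^sup>2 * (3 * l\<^sup>2)" by (intro mult_left_mono) auto
    then show ?thesis by (simp add: q_def power_mult_distrib mult_ac)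
  qed
  have qd2: "q \<le> (real d)\<^sup>2" using lle by (simp add: q_def power2_eq_square mult_left_mono)
  have lnw: "0 \<le> ln \<omega>" using w by simp
  have B40: "40 \<le> B" using lnw B by simp
  have wq: "1 \<le> \<omega> * q ^ 5" using w q1 mult_mono[of 1 \<omega> 1 "q^5"] by simp
  have s_eq: "s = nat \<lceil>\<omega> * q ^ 5\<rceil>" by (simp add: s_def sketch_dim_def q_def l_def power_mult_distrib mult.assoc)
  have s1: "\<omega> * q ^ 5 \<le> real s" "real s \<le> \<omega> * q ^ 5 + 1"
    unfolding s_eq using wq by (auto simp: of_nat_nat ceiling_le_iff)
  have s2: "real s \<le> 2 * \<omega> * q ^ 5" using s1 wq by linarith
  have s0: "0 < real s" using s1 wq by linarith
  have L1: "16 * real s \<le> 2 ^ L"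
  proof -
    have "log 2 (16 * real s) \<le> real L" unfolding L_def by linarith
    then have "2 powr (log 2 (16 * real s)) \<le> 2 powr real L" by (intro powr_mono) auto
    then show ?thesis using s0 by (simp add: powr_realpow)
  qed
  have L2: "1 + real L \<le> B * l"
  proof -
    have "1 \<le> 16 * real s" using s1 wq by linarith
    then have "0 \<le> log 2 (16 * real s)" by simp
    then have "real L \<le> log 2 (16 * real s) + 1" unfolding L_def by linarith
    also have "log 2 (16 * real s) = 4 + ln (real s) / ln 2"
    proof -
      have "log 2 (16::real) = 4" using log_pow_cancel[of "2::real" 4] by simp
      then show ?thesis using s0 by (simp add: log_def ln_mult add_divide_distrib)
    qed
    also have "ln (real s) / ln 2 \<le> (ln 2 + ln \<omega> + 5 * ln q) / ln 2"
    proof (rule divide_right_mono)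
      have "ln (real s) \<le> ln (2 * \<omega> * q ^ 5)" using s0 s2 by simp
      then show "ln (real s) \<le> ln 2 + ln \<omega> + 5 * ln q"
        using w q1 by (simp add: ln_mult ln_realpow)
    qed auto
    also have "\<dots> = 1 + (ln \<omega> + 5 * ln q) / ln 2" by (simp add: add_divide_distrib)
    also have "(ln \<omega> + 5 * ln q) / ln 2 \<le> (ln \<omega> + 5 * ln q) / (1/2)"
      using lnw q1 ln2 by (intro divide_left_mono) auto
    also have "ln q \<le> 2 * l"
    proof -
      have "ln q \<le> ln ((real d)\<^sup>2)" using qd2 q1 d by simp
      then show ?thesis using d by (simp add: l_def ln_realpow)
    qed
    finally have "1 + real L \<le> 7 + 2 * ln \<omega> + 20 * l" by simp
    also have "7 + 2 * ln \<omega> \<le> (7 + 2 * ln \<omega>) * (2 * l)"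
      using lnw l mult_left_mono[of 1 "2*l" "7 + 2 * ln \<omega>"] by simp
    \<comment> \<open>The left side is (34 + 4 ln \<omega>) l, the origin of
      \<open>B\<close>.\<close>
    also have "(7 + 2 * ln \<omega>) * (2 * l) + 20 * l \<le> B * l"
      using l by (simp add: B algebra_simps)
    finally show ?thesis by simp
  qed
  have w8: "0 < \<omega> powr (1/8)" using w by simp
  have lam: "0 < K" using w8 q1 by (simp add: K_def)
  have c1: "64 * K\<^sup>2 * (real d)\<^sup>2 \<le> real s"
  proof -
    have w4: "(\<omega> powr (1/8))\<^sup>2 = \<omega> powr (1/4)" using w by (simp add: powr_power)
    have "64 * K\<^sup>2 * (real d)\<^sup>2 \<le> 64 * K\<^sup>2 * (3 * q\<^sup>2)"
      using d2q by (intro mult_left_mono) auto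
    also have "\<dots> = 192 * \<omega> powr (1/4) * q ^ 4"
    proof -
      have "K\<^sup>2 = \<omega> powr (1/4) * q\<^sup>2" by (simp add: K_def power_mult_distrib w4)
      then show ?thesis by (simp add: power2_eq_square power4_eq_xxxx)
    qed
    also have "\<dots> \<le> \<omega> * q ^ 5"
      using w q1 by (intro mult_mono power_increasing) auto
    finally show ?thesis using s1 by linarith
  qed
  have c2: "256 * K * (real d)\<^sup>2 \<le> real s"
  proof -
    have "256 * K * (real d)\<^sup>2 \<le> 256 * K * (3 * q\<^sup>2)"
      using d2q lam by (intro mult_left_mono) auto
    also have "\<dots> = 768 * \<omega> powr (1/8) * q ^ 3"
      by (simp add: K_def power2_eq_square power3_eq_cube)
    also have "\<dots> \<le> \<omega> * q ^ 5"
      using w q1 by (intro mult_mono power_increasing) auto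
    finally show ?thesis using s1 by linarith
  qed
  have pd: "1 / (15925248 * q\<^sup>2) \<le> (1 / (2304 * real d)) powr p"
  proof -
    have "1 / (15925248 * q\<^sup>2) \<le> 1 / (5308416 * (real d)\<^sup>2)"
      using d2q d q1 by (intro divide_left_mono mult_pos_pos) auto
    also have "\<dots> = (1 / (2304 * real d)) powr 2" using d by (simp add: power_divide power_mult_distrib)
    also have "\<dots> \<le> (1 / (2304 * real d)) powr p"
      using p d by (intro powr_mono') auto
    finally show ?thesis .
  qed
  have c3: "8704 * K * (real d)\<^sup>2 * (1 + real L) / real s \<le> (1 / (2304 * real d)) powr p / 16"
  proof -
    have "8704 * K * (real d)\<^sup>2 * (1 + real L) / real s \<le> 8704 * K * (real d)\<^sup>2 * (B * l) / (\<omega> * q ^ 5)"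
      using lam L2 s1 wq B40 l by (intro frac_le mult_left_mono mult_nonneg_nonneg) auto
    also have "8704 * K * (real d)\<^sup>2 * (B * l) = 8704 * \<omega> powr (1/8) * B * q\<^sup>2 * real d"
      by (simp add: K_def q_def power2_eq_square)
    also have "\<dots> \<le> 8704 * \<omega> powr (1/8) * B * q\<^sup>2 * (2 * q)"
      using dq w8 B40 by (intro mult_left_mono) auto
    also have "\<dots> / (\<omega> * q ^ 5) = 17408 * \<omega> powr (1/8) * B / \<omega> * (1 / q\<^sup>2)"
      using w q1 by (simp add: field_simps eval_nat_numeral)
    also have "\<dots> \<le> 1 / 254803968 * (1 / q\<^sup>2)"
      using w by (intro mult_right_mono) auto
    also have "\<dots> = 1 / (15925248 * q\<^sup>2) / 16" by simp
    also have "\<dots> \<le> (1 / (2304 * real d)) powr p / 16" using pd by (intro divide_right_mono) auto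
    finally show ?thesis using wq by (simp add: divide_right_mono)
  qed
  have N1: "16 * (real d)\<^sup>2 \<le> real N"
  proof -
    have "16 * (real d)\<^sup>2 * 1 \<le> 339738624 * (real d)\<^sup>2 * (1 + real L)" by (intro mult_mono) auto
    then show ?thesis by (simp add: N_def)
  qed
  have N2: "663552 * real d * (512 * real d * (1 + real L)) \<le> real N"
    by (simp add: N_def power2_eq_square algebra_simps)
  have c4: "(2 * real N + 1) ^ d * exp (- K / 165888) \<le> 1 / 16"
  proof -
    have "1 \<le> (real d)\<^sup>2" using d by (simp add: one_le_power)
    then have "1 \<le> real N" using N1 by linarith
    then have "2 * real N + 1 \<le> 3 * real N" by simp
    also have "\<dots> = 3 * 339738624 * (real d)\<^sup>2 * (1 + real L)" by (simp add: N_def algebra_simps)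
    also have "\<dots> \<le> 3 * 339738624 * (real d)\<^sup>2 * (B * real d)"
    proof (intro mult_left_mono)
      have "B * l \<le> B * real d" using lle B40 by (intro mult_left_mono) auto
      then show "1 + real L \<le> B * real d" using L2 by linarith
    qed auto
    also have "\<dots> = (3 * 339738624 * B) * real d ^ 3" by (simp add: power2_eq_square power3_eq_cube)
    finally have "ln (2 * real N + 1) \<le> ln ((3 * 339738624 * B) * real d ^ 3)"
      using B40 d by simp
    also have "\<dots> = ln (3 * 339738624 * B) + 3 * l"
      using B40 d by (simp add: ln_mult ln_realpow l_def)
    finally have lnN: "ln (2 * real N + 1) \<le> ln (3 * 339738624 * B) + 3 * l" .
    have lnB: "0 \<le> ln (3 * 339738624 * B)" using B40 by simp
    have "real d * ln (2 * real N + 1) + 3 \<le> real d * (ln (3 * 339738624 * B) + 3 * l) + 3 * q"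
      using lnN q1 by (intro add_mono mult_left_mono) auto
    also have "\<dots> = real d * ln (3 * 339738624 * B) + 6 * q" by (simp add: q_def algebra_simps)
    also have "\<dots> \<le> (2 * q) * ln (3 * 339738624 * B) + 6 * q"
      using dq lnB by (intro add_right_mono mult_right_mono) auto
    also have "\<dots> = (2 * ln (3 * 339738624 * B) + 6) * q" by (simp add: algebra_simps)
    also have "\<dots> \<le> (\<omega> powr (1/8) / 165888) * q" using w q1 by (intro mult_right_mono) auto
    also have "\<dots> = K / 165888" by (simp add: K_def)
    finally have le: "real d * ln (2 * real N + 1) - K / 165888 \<le> -3" by simp
    have "(2 * real N + 1) ^ d = exp (real d * ln (2 * real N + 1))"
      by (simp add: exp_of_nat_mult)
    then have "(2 * real N + 1) ^ d * exp (- K / 165888) = exp (real d * ln (2 * real N + 1) - K / 165888)"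
      by (simp add: exp_add[symmetric])
    also have "\<dots> \<le> exp (-3)" using le by simp
    also have "\<dots> \<le> 1 / 16"
    proof -
      \<comment> \<open>An elementary lower bound for exp 3: 1.1^30 exceeds 17.\<close>
      have "(11/10::real) ^ 30 \<le> exp (1/10) ^ 30"
        using exp_ge_add_one_self[of "1/10::real"] by (intro power_mono) auto
      also have "exp (1/10::real) ^ 30 = exp 3" by (simp add: exp_of_nat_mult[symmetric])
      finally have "16 \<le> exp (3::real)" by (simp add: power_divide)
      then show ?thesis by (simp add: exp_minus inverse_eq_divide frac_le)
    qed
    finally show ?thesis .
  qed
  have c5: "512 * real d * (1 + real L) \<le> (512 * B) powr p * q"
  proof -
    have "512 * real d * (1 + real L) \<le> 512 * real d * (B * l)"
      using L2 by (intro mult_left_mono) auto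
    also have "\<dots> = (512 * B) powr 1 * q" using B40 by (simp add: q_def)
    also have "\<dots> \<le> (512 * B) powr p * q"
      using B40 p q1 by (intro mult_right_mono powr_mono) auto
    finally show ?thesis .
  qed
  \<comment> \<open>10^9 exceeds 254803968 = 16 * 3 * 2304^2 as well as 663552, and p > 1 makes its
    p-th power only larger.\<close>
  have big: "1000000000 \<le> (1000000000::real) powr p"
    using powr_mono[of 1 p "1000000000::real"] p by simp
  have c6: "1 / (1000000000 powr p * q\<^sup>2) \<le> (1 / (2304 * real d)) powr p / 16"
  proof -
    have "254803968 * q\<^sup>2 \<le> 1000000000 powr p * q\<^sup>2" using big by (intro mult_right_mono) auto
    then have "1 / (1000000000 powr p * q\<^sup>2) \<le> 1 / (254803968 * q\<^sup>2)"
      using q1 by (intro divide_left_mono) auto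
    also have "\<dots> = 1 / (15925248 * q\<^sup>2) / 16" by simp
    also have "\<dots> \<le> (1 / (2304 * real d)) powr p / 16" using pd by (intro divide_right_mono) auto
    finally show ?thesis .
  qed
  have c7: "1 / (1000000000 powr p * q\<^sup>2) \<le> 1 / 663552"
  proof -
    have "663552 * 1 \<le> 1000000000 powr p * q\<^sup>2" using big q1 by (intro mult_mono) auto
    then show ?thesis by (intro divide_left_mono) auto
  qed
  show ?thesis
    unfolding admissible_def using lam c1 c2 L1 c3 N1 N2 c4 c5 c6 c7 s0 unfolding q_def l_def
    by (intro exI[of _ K] conjI exI[of _ L] exI[of _ N]) auto
qed

lemma parameter_choice:
  fixes p :: real
  assumes p: "1 < p" "p < 2"
  shows "\<exists>\<omega>\<^sub>0>0. \<forall>\<omega>\<ge>\<omega>\<^sub>0. \<exists>C\<^sub>1>0. \<exists>C\<^sub>2>0. \<forall>d\<ge>2. \<exists>K L N.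
    admissible p d (sketch_dim \<omega> d) C\<^sub>1 C\<^sub>2 K L N"
proof -
  let ?B = "\<lambda>\<omega>::real. 40 + 4 * ln \<omega>"
  have "eventually (\<lambda>\<omega>::real. 1 \<le> \<omega>) at_top" by (rule eventually_ge_at_top)
  moreover have "eventually (\<lambda>\<omega>::real. 192 * \<omega> powr (1/4) \<le> \<omega>) at_top" by real_asymp
  moreover have "eventually (\<lambda>\<omega>::real. 768 * \<omega> powr (1/8) \<le> \<omega>) at_top" by real_asymp
  moreover have "eventually (\<lambda>\<omega>::real. 17408 * \<omega> powr (1/8) * ?B \<omega> / \<omega> \<le> 1 / 254803968) at_top" by real_asymp
  moreover have "eventually (\<lambda>\<omega>::real. 2 * ln (3 * 339738624 * ?B \<omega>) + 6 \<le> \<omega> powr (1/8) / 165888) at_top" by real_asymp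
  ultimately have "eventually (\<lambda>\<omega>::real. 1 \<le> \<omega> \<and> 192 * \<omega> powr (1/4) \<le> \<omega> \<and> 768 * \<omega> powr (1/8) \<le> \<omega> \<and>
      17408 * \<omega> powr (1/8) * ?B \<omega> / \<omega> \<le> 1 / 254803968 \<and>
      2 * ln (3 * 339738624 * ?B \<omega>) + 6 \<le> \<omega> powr (1/8) / 165888) at_top"
    by eventually_elim blast
  then obtain w0 where w0: "\<And>\<omega>. w0 \<le> \<omega> \<Longrightarrow> 1 \<le> \<omega> \<and> 192 * \<omega> powr (1/4) \<le> \<omega> \<and> 768 * \<omega> powr (1/8) \<le> \<omega> \<and>
      17408 * \<omega> powr (1/8) * ?B \<omega> / \<omega> \<le> 1 / 254803968 \<and>
      2 * ln (3 * 339738624 * ?B \<omega>) + 6 \<le> \<omega> powr (1/8) / 165888"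
    unfolding eventually_at_top_linorder by blast
  show ?thesis
  proof (rule exI[of _ "max 1 w0"], rule conjI, simp, intro allI impI)
    fix \<omega> assume "max 1 w0 \<le> \<omega>"
    then have w: "w0 \<le> \<omega>" "1 \<le> \<omega>" by auto
    then have B: "0 < 512 * ?B \<omega>" by (simp add: add_pos_nonneg)
    note fix_d = parameter_choice_fixed[OF p _ refl, of _ \<omega>]
    show "\<exists>C\<^sub>1>0. \<exists>C\<^sub>2>0. \<forall>d\<ge>2. \<exists>K L N. admissible p d (sketch_dim \<omega> d) C\<^sub>1 C\<^sub>2 K L N"
      by (rule exI[of _ 1000000000], rule conjI, simp, rule exI[of _ "512 * ?B \<omega>"], rule conjI[OF B], intro allI impI, rule fix_d)
        (use w0[OF w(1)] in blast)+
  qed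
qed

section \<open>From the unit sphere to all vectors\<close>

context lewis_rows
begin

lemma sketch_power_bounds_all:
  assumes h: "\<And>i. i < n \<Longrightarrow> h i < s" and gh: "good_hash n weight K \<xi> h"
    and gs: "good_scaling s K N a R R' h g"
    and a: "0 < a" and R': "R' \<le> a powr p / 16"
    and N: "16 * (real d)\<^sup>2 \<le> real N" "663552 * real d * R \<le> real N"
    and t: "t = (\<Sum>i<n. \<bar>col_comb z i\<bar> powr p)"
  shows "sketch_power s h g z \<le> R * t" "min (a powr p / 16) (1 / 663552) * t \<le> sketch_power s h g z"
proof -
  have t0: "0 \<le> t" by (simp add: t sum_nonneg)
  have "sketch_power s h g z \<le> R * t \<and> min (a powr p / 16) (1 / 663552) * t \<le> sketch_power s h g z"
  proof (cases "t = 0")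
    case True
    then have "col_comb z i = 0" if "i < n" for i
      using that by (auto simp: t sum_nonneg_eq_0_iff)
    then have "sketch_power s h g z = 0" by (simp add: sketch_power_def bucket_def)
    then show ?thesis using True by simp
  next
    case False
    then have tp: "0 < t" using t0 by simp
    define c where "c = t powr (- (1/p))"
    have "c powr p = t powr (-1)" using p1 by (simp add: c_def powr_powr)
    then have c: "0 < c" "c powr p = 1 / t"
      using tp by (auto simp: c_def powr_minus_divide)
    define z' where "z' j = c * z j" for j
    have yz: "col_comb z' i = c * col_comb z i" for i by (simp add: col_comb_def z'_def sum_distrib_left mult_ac)
    have scale: "\<bar>c * v\<bar> powr p = \<bar>v\<bar> powr p / t" for v
      using c by (simp add: abs_mult powr_mult)
    have "(\<Sum>i<n. \<bar>col_comb z' i\<bar> powr p) = 1"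
      unfolding yz scale using tp by (simp add: sum_divide_distrib[symmetric] t[symmetric])
    note b = sketch_power_bounds[OF h gh gs a R' N this]
    have "(\<Sum>i\<in>bucket h k. g i * col_comb z' i) = c * (\<Sum>i\<in>bucket h k. g i * col_comb z i)" for k
      by (simp add: yz sum_distrib_left mult_ac)
    then have "sketch_power s h g z' = sketch_power s h g z / t"
      by (simp add: sketch_power_def scale sum_divide_distrib)
    then have "sketch_power s h g z = sketch_power s h g z' * t" using tp by simp
    then show ?thesis using mult_right_mono[OF b(1), of t] mult_right_mono[OF b(2), of t] tp by simp
  qed
  then show "sketch_power s h g z \<le> R * t" "min (a powr p / 16) (1 / 663552) * t \<le> sketch_power s h g z"
    by auto
qed

lemma sketch_entry_power:
  assumes "\<And>i. i < n \<Longrightarrow> v i = col_comb z i"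
  shows "(\<Sum>k<s. \<bar>sketch_entry n h g v k\<bar> powr p) = sketch_power s h g z"
proof -
  have "sketch_entry n h g v k = (\<Sum>i\<in>bucket h k. g i * col_comb z i)" for k
  proof -
    have "bucket h k = {i \<in> {..<n}. h i = k}" by (auto simp: bucket_def)
    then have "(\<Sum>i\<in>bucket h k. g i * col_comb z i) = (\<Sum>i<n. if h i = k then g i * col_comb z i else 0)"
      by (simp only: sum.inter_filter finite_lessThan)
    then show ?thesis using assms by (auto simp: sketch_entry_def intro!: sum.cong)
  qed
  then show ?thesis by (simp add: sketch_power_def)
qed

end

lemma embedding_probability:
  fixes p :: real and s :: nat and D :: "real measure"
  assumes p: "1 < p" "p < 2" and D: "std_stable p D"
    and A: "A \<in> carrier_mat n d" and full: "full_column_rank A" and d: "2 \<le> d"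
    and adm: "admissible p d s C\<^sub>1 C\<^sub>2 K L N" and C12: "0 < C\<^sub>1" "0 < C\<^sub>2"
  defines "\<Omega> \<equiv> sketch_space D s n"
  shows "1 / 2 \<le> measure \<Omega> {(h, g) \<in> space \<Omega>. \<forall>x\<in>carrier_vec d.
      1 / (C\<^sub>1 * (real d * ln (real d)) powr (2 / p)) * lp_norm p (A *\<^sub>v x)
        \<le> lp_norm p (Pi_mat s n h g * A *\<^sub>v x) \<and>
      lp_norm p (Pi_mat s n h g * A *\<^sub>v x)
        \<le> C\<^sub>2 * (real d * ln (real d)) powr (1 / p) * lp_norm p (A *\<^sub>v x)}"
    (is "_ \<le> measure \<Omega> ?E")
proof -
  define q where "q = real d * ln (real d)"
  have q: "0 < q" using d by (simp add: q_def)
  have k: "0 < K" "64 * K\<^sup>2 * (real d)\<^sup>2 \<le> real s" "256 * K * (real d)\<^sup>2 \<le> real s"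
    and s: "0 < s" and L: "16 * real s \<le> 2 ^ L"
    and noise: "8704 * K * (real d)\<^sup>2 * (1 + real L) / real s \<le> (1 / (2304 * real d)) powr p / 16"
    and N: "16 * (real d)\<^sup>2 \<le> real N" "663552 * real d * (512 * real d * (1 + real L)) \<le> real N"
    and net: "(2 * real N + 1) ^ d * exp (- K / 165888) \<le> 1 / 16"
    and C: "512 * real d * (1 + real L) \<le> C\<^sub>2 powr p * q"
      "1 / (C\<^sub>1 powr p * q\<^sup>2) \<le> (1 / (2304 * real d)) powr p / 16" "1 / (C\<^sub>1 powr p * q\<^sup>2) \<le> 1 / 663552"
    using adm unfolding admissible_def q_def[symmetric] by blast+
  have inj: "v = 0\<^sub>v d" if "v \<in> carrier_vec d" "A *\<^sub>v v = 0\<^sub>v n" for v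
    by (rule full_column_rank_mult_vec_eq_0[OF A full that])
  obtain u :: "nat \<Rightarrow> nat \<Rightarrow> real" where u:
    "\<And>x. x \<in> carrier_vec d \<Longrightarrow> \<exists>z. \<forall>i<n. (A *\<^sub>v x) $ i = (\<Sum>j<d. u i j * z j)"
    "(\<Sum>i<n. (\<Sum>j<d. (u i j)\<^sup>2) powr (p/2)) = real d"
    "\<And>z. (\<Sum>j<d. (z j)\<^sup>2) powr (p/2) \<le> (\<Sum>i<n. \<bar>\<Sum>j<d. u i j * z j\<bar> powr p)"
    by (rule lewis_basis[OF A inj, of p]) (use p d in auto)
  interpret lewis_rows p n d u
    using p d u by unfold_locales auto
  define a where "a = 1 / (2304 * real d)"
  define R where "R = 512 * real d * (1 + real L)"
  define R' where "R' = 8704 * K * (real d)\<^sup>2 * (1 + real L) / real s"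
  have a0: "0 < a" using d by (simp add: a_def)
  have N0: "0 < N" using N(1) d by (cases "N = 0") auto
  let ?PH = "\<Pi>\<^sub>M i\<in>{..<n}. measure_pmf (pmf_of_set {..<s})" and ?PD = "\<Pi>\<^sub>M i\<in>{..<n}. D"
  have Om: "\<Omega> = ?PH \<Otimes>\<^sub>M ?PD" by (simp add: \<Omega>_def sketch_space_def)
  interpret PH: prob_space ?PH by (rule uniform_hash(1)[OF s])
  interpret PD: prob_space ?PD by (rule std_stable_coordinates(1)[OF D])

  have E: "?E \<in> sets \<Omega>"
    unfolding \<Omega>_def using p by (intro embedding_event_measurable[OF A _ D s]) auto
  let ?good = "{h \<in> space ?PH. good_hash n weight K (32 * K * (real d)\<^sup>2 / real s) h}"
  have good: "?good \<in> PH.events" "13 / 16 \<le> PH.prob ?good"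
    by (rule PH.good_hash_prob[where H="\<lambda>h. h", OF uniform_hash(2)[OF s] uniform_hash(3)[OF s] weight_nonneg sum_weight _ k(1) _ k(2,3)];
      use s d in simp)+
  \<comment> \<open>The deterministic bounds need every hash value below s, so this almost sure
    condition is made part of the event.\<close>
  define G where "G = {h \<in> ?good. \<forall>i<n. h i < s}"
  have Gm: "G \<in> PH.events"
  proof -
    have "G = ?good \<inter> (\<Inter>i\<in>{..<n}. (\<lambda>h. h i) -` {..<s} \<inter> space ?PH) \<inter> space ?PH"
      by (auto simp: G_def)
    \<comment> \<open>For n = 0 the intersection is the whole type, hence the extra intersection
      with the space.\<close>
    moreover have "(\<Inter>i\<in>{..<n}. (\<lambda>h. h i) -` {..<s} \<inter> space ?PH) \<inter> space ?PH \<in> PH.events"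
    proof (cases "n = 0")
      case False
      then have "(\<Inter>i\<in>{..<n}. (\<lambda>h. h i) -` {..<s} \<inter> space ?PH) \<in> PH.events"
        by (intro sets.finite_INT measurable_sets[OF uniform_hash(2)[OF s]]) auto
      then show ?thesis by auto
    qed auto
    ultimately show ?thesis using good(1) by (simp add: Int_assoc)
  qed
  have G: "13 / 16 \<le> PH.prob G"
  proof -
    have "PH.prob ?good \<le> PH.prob G"
    proof (rule PH.finite_measure_mono_AE[OF _ Gm])
      show "AE h in ?PH. h \<in> ?good \<longrightarrow> h \<in> G"
        using uniform_hash(4)[OF s, of n] by eventually_elim (auto simp: G_def)
    qed
    then show ?thesis using good(2) by linarith
  qed
  have emb: "(h, g) \<in> ?E" if hG: "h \<in> G" and g: "g \<in> space ?PD" "good_scaling s K N a R R' h g" for h g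
  proof -
    have h: "good_hash n weight K (32 * K * (real d)\<^sup>2 / real s) h" "\<And>i. i < n \<Longrightarrow> h i < s" "h \<in> space ?PH"
      using hG by (auto simp: G_def)
    have "1 / (C\<^sub>1 * q powr (2 / p)) * lp_norm p (A *\<^sub>v x) \<le> lp_norm p (Pi_mat s n h g * A *\<^sub>v x) \<and>
      lp_norm p (Pi_mat s n h g * A *\<^sub>v x) \<le> C\<^sub>2 * q powr (1 / p) * lp_norm p (A *\<^sub>v x)"
      if x: "x \<in> carrier_vec d" for x
    proof -
      obtain z where z: "\<And>i. i < n \<Longrightarrow> (A *\<^sub>v x) $ i = col_comb z i"
        using u(1)[OF x] unfolding col_comb_def by blast
      define t where "t = (\<Sum>i<n. \<bar>col_comb z i\<bar> powr p)"
      have t0: "0 \<le> t" by (simp add: t_def sum_nonneg)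
      have norm1: "lp_norm p (A *\<^sub>v x) = t powr (1/p)"
        unfolding lp_norm_mult[OF A] t_def by (intro arg_cong2[where f="(powr)"] sum.cong refl) (simp only: z lessThan_iff)
      have norm2: "lp_norm p (Pi_mat s n h g * A *\<^sub>v x) = sketch_power s h g z powr (1/p)"
        unfolding lp_norm_sketch[OF A x] by (subst sketch_entry_power[OF z]) auto
      note b = sketch_power_bounds_all[OF h(2,1) g(2) a0 noise[folded R'_def a_def] N(1) N(2)[folded R_def] t_def]
      have "1 / (C\<^sub>1 powr p * q\<^sup>2) * t \<le> min (a powr p / 16) (1 / 663552) * t"
        using C(2,3) t0 by (intro mult_right_mono) (auto simp: a_def)
      then have "(1 / (C\<^sub>1 powr p * q\<^sup>2) * t) powr (1/p) \<le> sketch_power s h g z powr (1/p)"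
        using b(2) p t0 C12 by (intro powr_mono2) auto
      moreover have "(1 / (C\<^sub>1 powr p * q\<^sup>2) * t) powr (1/p) = 1 / (C\<^sub>1 * q powr (2 / p)) * t powr (1/p)"
      proof -
        have "q\<^sup>2 = q powr 2" using q by simp
        then have "(C\<^sub>1 powr p * q\<^sup>2) powr (1/p) = C\<^sub>1 * q powr (2 / p)"
          using C12 p by (simp only: powr_mult powr_powr) simp
        then show ?thesis using t0 by (simp only: powr_mult powr_divide powr_one_eq_one)
      qed
      moreover have "sketch_power s h g z powr (1/p) \<le> (C\<^sub>2 powr p * q * t) powr (1/p)"
      proof (rule powr_mono2)
        have "R * t \<le> C\<^sub>2 powr p * q * t" using C(1) t0 by (intro mult_right_mono) (auto simp: R_def)
        then show "sketch_power s h g z \<le> C\<^sub>2 powr p * q * t" using b(1) by linarith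
      qed (use p in \<open>auto simp: sketch_power_def sum_nonneg\<close>)
      moreover have "(C\<^sub>2 powr p * q * t) powr (1/p) = C\<^sub>2 * q powr (1 / p) * t powr (1/p)"
        using C12 p by (simp only: powr_mult powr_powr) simp
      ultimately show ?thesis unfolding norm1 norm2 by simp
    qed
    then show ?thesis using h(3) g(1) unfolding q_def by (auto simp: Om space_pair_measure)
  qed
  \<comment> \<open>5/8 * 13/16 = 65/128, just above 1/2.\<close>
  have "5 / 8 * PH.prob G \<le> measure (?PH \<Otimes>\<^sub>M ?PD) ?E"
  proof (rule pair_measure_lower_bound[OF PH.prob_space_axioms PD.prob_space_axioms _ Gm])
    show E': "?E \<in> sets (?PH \<Otimes>\<^sub>M ?PD)" using E by (simp add: Om)
    fix h assume hG: "h \<in> G"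
    then have h: "good_hash n weight K (32 * K * (real d)\<^sup>2 / real s) h" "\<And>i. i < n \<Longrightarrow> h i < s"
      by (auto simp: G_def)
    have "5 / 8 \<le> PD.prob {g \<in> space ?PD. good_scaling s K N a R R' h (\<lambda>i. g i)}"
      by (rule good_scaling_prob(2)[OF std_stable_coordinates(3)[OF D p] h(2) s k(1) h(1) L N0 R_def R'_def a_def net])
    also have "\<dots> \<le> PD.prob (Pair h -` ?E)"
      using emb[OF hG] by (intro PD.finite_measure_mono sets_Pair1[OF E']) auto
    finally show "5 / 8 \<le> PD.prob (Pair h -` ?E)" .
  qed simp
  then show ?thesis using G unfolding Om by linarith
qed

theorem theorem4:
  fixes p :: real and \<D> :: "real measure"
  assumes "1 < p" and "p < 2" and "std_stable p \<D>"
  shows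
    "(\<exists>\<delta>>0. \<exists>\<omega>\<^sub>0>0. \<forall>\<omega>\<ge>\<omega>\<^sub>0. \<exists>C\<^sub>1>0. \<exists>C\<^sub>2>0.
        \<forall>(n::nat) (d::nat). \<forall>A\<in>carrier_mat n d. 2 \<le> d \<longrightarrow> full_column_rank A \<longrightarrow>
          (let s = sketch_dim \<omega> d; \<Omega> = sketch_space \<D> s n in
           measure \<Omega> {(h, g) \<in> space \<Omega>. \<forall>x\<in>carrier_vec d.
             1 / (C\<^sub>1 * (real d * ln (real d)) powr (2 / p)) * lp_norm p (A *\<^sub>v x)
               \<le> lp_norm p (Pi_mat s n h g * A *\<^sub>v x) \<and>
             lp_norm p (Pi_mat s n h g * A *\<^sub>v x)
               \<le> C\<^sub>2 * (real d * ln (real d)) powr (1 / p) * lp_norm p (A *\<^sub>v x)}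
           \<ge> \<delta>))
     \<and> (\<exists>P c. \<forall>(n::nat) (d::nat) (s::nat). \<forall>A\<in>carrier_mat n d. 2 \<le> d \<longrightarrow> full_column_rank A \<longrightarrow>
          (\<forall>h g. (\<forall>i<n. h i < s) \<longrightarrow> computes_sketch_within P (c * nnz A) s A h g))"
proof (rule conjI, goal_cases)
  case 1
  obtain \<omega>\<^sub>0 where w0: "0 < \<omega>\<^sub>0" and params: "\<forall>\<omega>\<ge>\<omega>\<^sub>0. \<exists>C\<^sub>1>0. \<exists>C\<^sub>2>0. \<forall>d\<ge>2. \<exists>K L N.
      admissible p d (sketch_dim \<omega> d) C\<^sub>1 C\<^sub>2 K L N"
    using parameter_choice[OF assms(1,2)] by (elim exE conjE)
  show ?case
  proof (rule exI[of _ "1/2"], rule conjI, simp, rule exI[of _ \<omega>\<^sub>0], rule conjI[OF w0], intro allI impI, goal_cases)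
    case (1 \<omega>)
    with params obtain C\<^sub>1 C\<^sub>2 where C: "0 < C\<^sub>1" "0 < C\<^sub>2"
      and par: "\<forall>d\<ge>2. \<exists>K L N. admissible p d (sketch_dim \<omega> d) C\<^sub>1 C\<^sub>2 K L N"
      by blast
    show ?case
    proof (rule exI[of _ C\<^sub>1], rule conjI[OF C(1)], rule exI[of _ C\<^sub>2], rule conjI[OF C(2)], unfold Let_def,
        intro allI ballI impI, goal_cases)
      case (1 n d A)
      then obtain K L N where "admissible p d (sketch_dim \<omega> d) C\<^sub>1 C\<^sub>2 K L N"
        using par by blast
      with 1 show ?case by (intro embedding_probability[OF assms _ _ _ _ C])
    qed
  qed
next
  case 2
  show ?case
    by (rule exI[of _ sketch_program], rule exI[of _ 23])
      (auto intro!: sketch_program_correct full_column_rank_nnz_pos)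
qed

end
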